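(* Let $\ell>0$ and $n=n_1+\dots+n_r$ with $n_1,\dots,n_r\in\mathbb N$. Let $$B(x)=\operatorname{diag}\big(\beta_1(x)I_{n_1},\dots,\beta_r(x)I_{n_r}\big),\qquad x\in[0,\ell],$$ where the $\beta_k$ are real-valued, $\beta_k,1/\beta_k\in L^\infty[0,\ell]$, each $\beta_k$ has constant nonzero sign, and for some $\theta>0$ and some $r_-\in\{0,1,\dots,r\}$, $$\beta_1(x)<\dots<\beta_{r_-}(x)<-\theta<0<\theta<\beta_{r_-+1}(x)<\dots<\beta_r(x),\qquad \beta_k(x)+\theta<\beta_{k+1}(x)\ (k=1,\dots,r-1),\qquad x\in[0,\ell].$$ Let $Q=(Q_{jk})_{j,k=1}^r$ be a block matrix function with $Q_{jk}\in L^1([0,\ell];\mathbb C^{n_j\times n_k})$ and $Q_{jj}\equiv0$ for $j=1,\dots,r$. Put $\rho_j(x)=\int_0^x\beta_j(t)\,dt$ and $n_{\min}=\min\{n_1,\dots,n_r\}$. Let $A=\begin{pmatrix}A_1\\ \vdots\\ A_r\end{pmatrix}\in\mathbb C^{n\times n_{\min}}$ with $A_j\in\mathbb C^{n_j\times n_{\min}}$ and $\operatorname{rank}A_j=n_{\min}$ for all $j$. For $\lambda\in\mathbb C$ let $Y_A(\cdot,\lambda)$ be the $n\times n_{\min}$ matrix solution of $-iB(x)^{-1}(Y'+Q(x)Y)=\lambda Y$ on $[0,\ell]$ with $Y_A(0,\lambda)=A$, and let $e_A(x,\lambda)=\begin{pmatrix}e^{i\lambda\rho_1(x)}A_1\\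 \vdots\\ e^{i\lambda\rho_r(x)}A_r\end{pmatrix}$ (the solution of the same equation with $Q=0$ and the same initial value). Then there exists a block matrix kernel $K_A=(K_{jk})_{j,k=1}^r$ with $$K_A\in\big(X_{1,0}(\Omega)\cap X_{\infty,0}(\Omega)\big)\otimes\mathbb C^{n\times n}$$ such that $$Y_A(x,\lambda)=e_A(x,\lambda)+\int_0^xK_A(x,t)B(t)e_A(t,\lambda)\,dt,\qquad x\in[0,\ell],\ \lambda\in\mathbb C.$$
   Context: $\Omega:=\{(x,t):0\le t\le x\le\ell\}$. $X_1(\Omega)$ (resp. $X_\infty(\Omega)$) is the Banach space of (classes of) measurable functions $f$ on $\Omega$ with $\|f\|_{X_1}=\operatorname{ess\,sup}_{t\in[0,\ell]}\int_t^\ell|f(x,t)|\,dx<\infty$ (resp. $\|f\|_{X_\infty}=\operatorname{ess\,sup}_{x\in[0,\ell]}\int_0^x|f(x,t)|\,dt<\infty$). $X_{1,0}(\Omega)$ and $X_{\infty,0}(\Omega)$ denote the closures of $C(\Omega)$ in $X_1(\Omega)$ and $X_\infty(\Omega)$ respectively. For a set $S$ of scalar functions, $S\otimes\mathbb C^{n\times m}$ denotes the set of $n\times m$ matrix functions all of whose entries lie in $S$. *)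

theory Defs
  imports "HOL-Analysis.Analysis" "HOL-Probability.Essential_Supremum"
    "Jordan_Normal_Form.DL_Rank"
begin

text \<open>Block structure: block sizes ns = [n_1,...,n_r]; blocks are consecutive
  index ranges of {0..<n}, n = sum_list ns. Blocks are numbered 0..r-1.\<close>

definition blk :: "nat list \<Rightarrow> nat \<Rightarrow> nat" where
  "blk ns i = (LEAST k. i < sum_list (take (Suc k) ns))"

definition Omega :: "real \<Rightarrow> (real \<times> real) set" where
  "Omega l = {(x, t). 0 \<le> t \<and> t \<le> x \<and> x \<le> l}"

definition X1_norm :: "real \<Rightarrow> (real \<times> real \<Rightarrow> complex) \<Rightarrow> ennreal" where
  "X1_norm l f = esssup (restrict_space lborel {0..l})
     (\<lambda>t. \<integral>\<^sup>+ x. indicator (Omega l) (x, t) * ennreal (norm (f (x, t))) \<partial>lborel)"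

definition Xinf_norm :: "real \<Rightarrow> (real \<times> real \<Rightarrow> complex) \<Rightarrow> ennreal" where
  "Xinf_norm l f = esssup (restrict_space lborel {0..l})
     (\<lambda>x. \<integral>\<^sup>+ t. indicator (Omega l) (x, t) * ennreal (norm (f (x, t))) \<partial>lborel)"

text \<open>X_{1,0}(Omega), X_{infinity,0}(Omega): closures of C(Omega) in the respective norms.
  (We ask for a Borel measurable representative.)\<close>

definition X1_0 :: "real \<Rightarrow> (real \<times> real \<Rightarrow> complex) \<Rightarrow> bool" where
  "X1_0 l f \<longleftrightarrow> f \<in> borel_measurable borel \<and>
     (\<forall>\<epsilon>>0. \<exists>g. continuous_on (Omega l) g \<and> X1_norm l (\<lambda>p. f p - g p) < ennreal \<epsilon>)"

definition Xinf_0 :: "real \<Rightarrow> (real \<times> real \<Rightarrow> complex) \<Rightarrow> bool" where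
  "Xinf_0 l f \<longleftrightarrow> f \<in> borel_measurable borel \<and>
     (\<forall>\<epsilon>>0. \<exists>g. continuous_on (Omega l) g \<and> Xinf_norm l (\<lambda>p. f p - g p) < ennreal \<epsilon>)"

definition Linf_on :: "real \<Rightarrow> (real \<Rightarrow> real) \<Rightarrow> bool" where
  "Linf_on l f \<longleftrightarrow> f \<in> borel_measurable (lebesgue_on {0..l}) \<and>
     (\<exists>C. AE x in lebesgue_on {0..l}. \<bar>f x\<bar> \<le> C)"

text \<open>Y (entries Y i m, i < n, m < c) solves Y' + Q Y = i lambda B Y on [0,l] with
  Y(0) = A, in the sense of absolutely continuous (Caratheodory) solutions, written
  in the equivalent integral form.\<close>

definition is_solution ::
  "real \<Rightarrow> nat \<Rightarrow> nat \<Rightarrow> (nat \<Rightarrow> real \<Rightarrow> real) \<Rightarrow> (nat \<Rightarrow> nat \<Rightarrow> real \<Rightarrow> complex)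
   \<Rightarrow> (nat \<Rightarrow> nat \<Rightarrow> complex) \<Rightarrow> complex \<Rightarrow> (nat \<Rightarrow> nat \<Rightarrow> real \<Rightarrow> complex) \<Rightarrow> bool" where
  "is_solution l n c Bd Q A lam Y \<longleftrightarrow>
     (\<forall>i<n. \<forall>m<c.
        set_integrable lebesgue {0..l}
          (\<lambda>t. \<i> * lam * complex_of_real (Bd i t) * Y i m t - (\<Sum>k<n. Q i k t * Y k m t)) \<and>
        (\<forall>x\<in>{0..l}. Y i m x = A i m +
           (LINT t:{0..x}|lebesgue.
              \<i> * lam * complex_of_real (Bd i t) * Y i m t - (\<Sum>k<n. Q i k t * Y k m t))))"

end

(* The transformed unknown Y - e_A is, for each fixed x, the Fourier transform of a density F(x, .)
   supported between the smallest and the largest characteristic, so a kernel built only from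
   the first and the last block suffices: substitute u = rho_1(t) for u < 0 and u = rho_r(t) for
   u > 0, and use left inverses of A_1 and A_r to turn F into matrix blocks.

   F is the sum of the Picard iterates.  The delta masses of e_A are smeared out along rays in
   the first step, because the velocities beta_j - beta_k stay away from 0; every later step is a
   Volterra operator along characteristics.  Such an operator maps limits of continuous functions
   with respect to sup_x int |f(x, u)| du to limits of continuous functions with respect to both
   that norm and sup_u int |f(x, u)| dx, the second one because the speeds are bounded below.
   In the clock int (1 + sum |Q_jk|) the iterates decay factorially, which gives both the
   convergence of the series and the vanishing of the Picard remainder of any solution. *)

theory Submission
  imports Defs
begin

text \<open>The zero diagonal blocks of Q make the first step possible. A wave that moves with speed
  beta_k up to time s and with beta_i afterwards ends at u = rho_i(x) + rho_k(s) - rho_i(s); the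
  derivative of u in s is beta_k - beta_i, bounded away from 0, so the masses q_ik(s) ds become a
  density in u. The density does not involve lambda, which enters only through the test function
  e^{i lambda u}; hence one kernel serves all lambda. Since lambda is complex, this exponential is
  bounded only for bounded u, so the support of the density is tracked at every point and not up to
  null sets. The kernel has to act on e_A for one A only: if L is a left inverse of A_r, then F L
  times A_r is F again, and B(t) dt becomes du. If all speeds have one sign, one of the two sides of
  u = 0 is empty. The coefficients are Lebesgue measurable and matter on [0, l] only. They are
  replaced by Borel functions on the whole line with the same separation by theta, so that each
  rho_j becomes a bijection of the line with a Lipschitz inverse.\<close>

section \<open>Primitives of speeds and change of variables\<close>

text \<open>An interval integral carries a sign for x < 0, so the primitive lives on the whole line;
  speeds are extended there, and \<open>prim b\<close> becomes a bijection.\<close>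

definition prim :: "(real \<Rightarrow> real) \<Rightarrow> real \<Rightarrow> real" where
  "prim b x = (LBINT s=ereal 0..ereal x. b s)"

lemma prim_0 [simp]: "prim b 0 = 0"
  by (simp add: prim_def)

lemma prim_uminus: "prim (\<lambda>x. - b x) x = - prim b x"
  unfolding prim_def by (rule interval_lebesgue_integral_uminus)

lemma prim_diff:
  assumes loc: "\<And>x y. set_integrable lborel {x..y} b" and "x \<le> y"
  shows "prim b y - prim b x = (LBINT s:{x..y}. b s)"
proof -
  have "interval_lebesgue_integrable lborel (min (ereal 0) (min (ereal x) (ereal y)))
          (max (ereal 0) (max (ereal x) (ereal y))) b"
    using \<open>x \<le> y\<close> unfolding interval_lebesgue_integrable_def
    by (auto intro!: set_integrable_subset[OF loc[of "min 0 x" "max 0 y"]]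
        simp: einterval_iff min_def max_def split: if_splits)
  from interval_integral_sum[OF this]
  have "prim b x + (LBINT s=ereal x..ereal y. b s) = prim b y"
    unfolding prim_def .
  then show ?thesis by (simp add: interval_integral_Icc[OF \<open>x \<le> y\<close>])
qed

lemma prim_sub:
  assumes "\<And>x y. set_integrable lborel {x..y} b" "\<And>x y. set_integrable lborel {x..y} c"
  shows "prim (\<lambda>x. b x - c x) x = prim b x - prim c x"
proof -
  have "interval_lebesgue_integrable lborel (ereal 0) (ereal x) f"
    if "\<And>x y. set_integrable lborel {x..y} f" for f :: "real \<Rightarrow> real"
    unfolding interval_lebesgue_integrable_def
    by (auto intro!: set_integrable_subset[OF that[of "min 0 x" "max 0 x"]] simp: einterval_iff)
  then show ?thesis
    unfolding prim_def using assms by simp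
qed

lemma continuous_prim:
  assumes loc: "\<And>x y. set_integrable lborel {x..y} b"
  shows "continuous_on S (prim b)"
proof -
  have "isCont (prim b) x" for x
  proof -
    define N where "N = \<bar>x\<bar> + 1"
    have "continuous_on {-N..N} (\<lambda>y. prim b (-N) + integral {-N..y} b)"
      by (intro continuous_intros indefinite_integral_continuous_1 set_borel_integral_eq_integral loc)
    moreover have "prim b (-N) + integral {-N..y} b = prim b y" if "y \<in> {-N..N}" for y
      using prim_diff[OF loc, of "-N" y] set_borel_integral_eq_integral(2)[OF loc, of "-N" y] that by simp
    ultimately have "continuous_on {-N..N} (prim b)"
      by (rule continuous_on_eq)
    then show ?thesis
      by (rule continuous_on_interior) (auto simp: N_def)
  qed
  then show ?thesis
    by (simp add: continuous_at_imp_continuous_on)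
qed

text \<open>A coefficient of constant sign that stays away from 0 on the whole line. The locale
  serves the speeds themselves, differences of two speeds, and the clock
  \<open>weight\<close>.\<close>

locale speed =
  fixes b :: "real \<Rightarrow> real" and \<theta> :: real
  assumes meas [measurable]: "b \<in> borel_measurable borel"
    and loc: "\<And>x y. set_integrable lborel {x..y} b"
    and pos: "0 < \<theta>"
    and away: "(\<forall>x. \<theta> \<le> b x) \<or> (\<forall>x. b x \<le> - \<theta>)"
begin

lemma cont: "continuous_on S (prim b)"
  by (rule continuous_prim[OF loc])

lemma prim_measurable [measurable]: "prim b \<in> borel_measurable borel"
  by (rule borel_measurable_continuous_onI[OF cont])

lemma increase:
  assumes "\<forall>x. \<theta> \<le> b x" "x \<le> y"
  shows "\<theta> * (y - x) \<le> prim b y - prim b x"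
proof -
  have "(LBINT s:{x..y}. \<theta>) \<le> (LBINT s:{x..y}. b s)"
    using assms by (intro set_integral_mono loc) (simp_all add: set_integrable_def)
  then show ?thesis
    using prim_diff[OF loc \<open>x \<le> y\<close>] \<open>x \<le> y\<close> by (simp add: set_lebesgue_integral_def mult.commute)
qed

end

lemma speed_uminus:
  assumes "speed b \<theta>"
  shows "speed (\<lambda>x. - b x) \<theta>"
proof -
  interpret speed b \<theta> by fact
  show ?thesis
  proof
    show "set_integrable lborel {x..y} (\<lambda>x. - b x)" for x y
      using loc[of x y] by (simp add: set_integrable_def)
    show "(\<forall>x. \<theta> \<le> - b x) \<or> (\<forall>x. - b x \<le> - \<theta>)"
      using away by (simp add: le_minus_iff disj_commute)
  qed (simp_all add: pos)
qed

context speed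
begin

text \<open>The sign of \<open>b\<close>; multiplied by it, \<open>prim b\<close> is increasing in
  both cases.\<close>

definition direction :: real where
  "direction = (if \<forall>x. \<theta> \<le> b x then 1 else - 1)"

lemma abs_eq: "\<bar>b x\<bar> = direction * b x"
proof (cases "\<forall>x. \<theta> \<le> b x")
  case True
  then have "0 < b x" using pos by (meson less_le_trans)
  then show ?thesis using True by (simp add: direction_def)
next
  case False
  then have "b x \<le> - \<theta>" using away by blast
  then show ?thesis using False pos by (simp add: direction_def)
qed

lemma expand:
  assumes "x \<le> y"
  shows "\<theta> * (y - x) \<le> direction * (prim b y - prim b x)"
proof (cases "\<forall>x. \<theta> \<le> b x")
  case True
  then show ?thesis using increase[OF True assms] by (simp add: direction_def)
next
  case False
  then have neg: "\<forall>x. \<theta> \<le> - b x" using away by (auto simp: le_minus_iff)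
  interpret m: speed "\<lambda>x. - b x" \<theta> by (rule speed_uminus[OF speed_axioms])
  show ?thesis using m.increase[OF neg assms] False by (auto simp: direction_def prim_uminus)
qed

lemma le_iff: "direction * prim b x \<le> direction * prim b y \<longleftrightarrow> x \<le> y"
proof (cases "x \<le> y")
  case True
  then have "0 \<le> \<theta> * (y - x)" using pos by simp
  then show ?thesis using expand[OF True] True by (simp add: right_diff_distrib)
next
  case False
  then have "0 < \<theta> * (x - y)" using pos by simp
  then show ?thesis using expand[of y x] False by (simp add: right_diff_distrib)
qed

lemma inj: "prim b x = prim b y \<longleftrightarrow> x = y"
proof
  assume "prim b x = prim b y"
  then have "x \<le> y" "y \<le> x" using le_iff[of x y] le_iff[of y x] by simp_all
  then show "x = y" by simp
qed simp

lemma surj: "\<exists>x. prim b x = z"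
proof -
  \<comment> \<open>\<open>direction * prim b\<close> vanishes at 0 and grows at least at rate
    \<theta>, so on [-N, N] it passes through all values between -|z| and |z|.\<close>
  define N where "N = \<bar>z\<bar> / \<theta>"
  have "N \<ge> 0" and N: "\<theta> * N = \<bar>z\<bar>" using pos by (simp_all add: N_def)
  have "\<theta> * N \<le> direction * prim b N" "\<theta> * N \<le> - (direction * prim b (-N))"
    using expand[of 0 N] expand[of "-N" 0] \<open>N \<ge> 0\<close> by simp_all
  moreover have "direction * z \<le> \<bar>z\<bar>" "- \<bar>z\<bar> \<le> direction * z"
    using abs_ge_self[of z] abs_ge_minus_self[of z] by (auto simp: direction_def minus_le_iff)
  ultimately have "direction * prim b (-N) \<le> direction * z" "direction * z \<le> direction * prim b N"
    using N by linarith+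
  then have "\<exists>x. -N \<le> x \<and> x \<le> N \<and> direction * prim b x = direction * z"
    using \<open>N \<ge> 0\<close>
    by (intro IVT'[where f = "\<lambda>x. direction * prim b x"] continuous_on_mult_left cont) simp_all
  moreover have "direction \<noteq> 0" by (simp add: direction_def)
  ultimately show ?thesis by auto
qed

end

text \<open>Lebesgue measure is determined by its values on boxes. The preimage of an open interval
  under the strictly increasing \<open>prim b\<close> is an open interval, whose mass with density
  \<open>b\<close> is the increment of the primitive. This yields the substitution rule for a merely
  locally integrable \<open>b\<close>.\<close>

lemma (in speed) distr_prim_pos:
  assumes "\<forall>x. \<theta> \<le> b x"
  shows "distr (density lborel (\<lambda>x. ennreal (b x))) borel (prim b) = lborel"
proof (rule lborel_eqI[symmetric])
  fix c d :: real assume "\<And>i. i \<in> Basis \<Longrightarrow> inner c i \<le> inner d i"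
  then have "c \<le> d" by simp
  have mono: "prim b x < prim b y \<longleftrightarrow> x < y" for x y
    using le_iff[of y x] assms by (simp add: direction_def not_le[symmetric])
  obtain c' where c': "prim b c' = c" using surj by blast
  obtain d' where d': "prim b d' = d" using surj by blast
  have "c' \<le> d'" using mono[of d' c'] \<open>c \<le> d\<close> c' d' by simp
  have "prim b -` box c d = {c'<..<d'}"
    using mono[of c'] mono[of _ d'] by (auto simp: box_real c' d')
  then have "emeasure (distr (density lborel (\<lambda>x. ennreal (b x))) borel (prim b)) (box c d)
      = (\<integral>\<^sup>+x. ennreal (b x) * indicator {c'<..<d'} x \<partial>lborel)"
    by (simp add: emeasure_distr emeasure_density)
  also have "\<dots> = (\<integral>\<^sup>+x. ennreal (indicator {c'..d'} x *\<^sub>R b x) \<partial>lborel)"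
    using AE_lborel_singleton[of c'] AE_lborel_singleton[of d']
    by (intro nn_integral_cong_AE) (auto split: split_indicator)
  also have "\<dots> = ennreal (LBINT x:{c'..d'}. b x)"
    unfolding set_lebesgue_integral_def
  proof (rule nn_integral_eq_integral)
    have "0 \<le> b x" for x using assms[rule_format, of x] pos by linarith
    then show "AE x in lborel. 0 \<le> indicator {c'..d'} x *\<^sub>R b x"
      by (simp add: zero_le_mult_iff)
  qed (use loc[of c' d'] in \<open>simp add: set_integrable_def\<close>)
  also have "\<dots> = ennreal (d - c)"
    using prim_diff[OF loc \<open>c' \<le> d'\<close>] c' d' by simp
  finally show "emeasure (distr (density lborel (\<lambda>x. ennreal (b x))) borel (prim b)) (box c d)
      = ennreal (\<Prod>i\<in>Basis. inner (d - c) i)"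
    by simp
qed simp

context speed
begin

lemma distr_prim: "distr (density lborel (\<lambda>x. ennreal \<bar>b x\<bar>)) borel (prim b) = lborel"
proof (cases "\<forall>x. \<theta> \<le> b x")
  case True
  then have "\<bar>b x\<bar> = b x" for x using True[rule_format, of x] pos by linarith
  then show ?thesis using distr_prim_pos[OF True] by simp
next
  case False
  \<comment> \<open>The reflection of u to -u preserves Lebesgue measure and reduces a negative
    speed to a positive one.\<close>
  then have neg: "\<forall>x. \<theta> \<le> - b x" using away by (auto simp: le_minus_iff)
  interpret m: speed "\<lambda>x. - b x" \<theta> by (rule speed_uminus[OF speed_axioms])
  have abs: "\<bar>b x\<bar> = - b x" for x using neg[rule_format, of x] pos by linarith
  have "distr (density lborel (\<lambda>x. ennreal \<bar>b x\<bar>)) borel (prim b)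
     = distr (distr (density lborel (\<lambda>x. ennreal \<bar>b x\<bar>)) borel (\<lambda>x. - prim b x)) borel uminus"
    by (subst distr_distr) (auto simp: comp_def)
  also have "distr (density lborel (\<lambda>x. ennreal \<bar>b x\<bar>)) borel (\<lambda>x. - prim b x) = lborel"
    using m.distr_prim_pos[OF neg] by (simp add: abs prim_uminus[abs_def])
  finally show ?thesis by (simp add: lborel_distr_uminus)
qed

lemma nn_integral_prim:
  assumes [measurable]: "f \<in> borel_measurable borel"
  shows "(\<integral>\<^sup>+s. ennreal \<bar>b s\<bar> * f (prim b s) \<partial>lborel) = (\<integral>\<^sup>+u. f u \<partial>lborel)"
proof -
  have "(\<integral>\<^sup>+u. f u \<partial>lborel) = (\<integral>\<^sup>+u. f u \<partial>distr (density lborel (\<lambda>x. ennreal \<bar>b x\<bar>)) borel (prim b))"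
    by (simp add: distr_prim)
  also have "\<dots> = (\<integral>\<^sup>+s. ennreal \<bar>b s\<bar> * f (prim b s) \<partial>lborel)"
    by (simp add: nn_integral_distr nn_integral_density)
  finally show ?thesis ..
qed

lemma abs_ge: "\<theta> \<le> \<bar>b x\<bar>"
  using away
proof
  assume "\<forall>x. \<theta> \<le> b x"
  then have "\<theta> \<le> b x" ..
  then show ?thesis by linarith
next
  assume "\<forall>x. b x \<le> - \<theta>"
  then have "b x \<le> - \<theta>" ..
  then show ?thesis by linarith
qed

text \<open>Dropping the Jacobian costs 1 / \<theta>. The bounds in the x direction and the passage
  from u to t rest on this.\<close>

lemma nn_integral_prim_le:
  assumes [measurable]: "f \<in> borel_measurable borel"
  shows "(\<integral>\<^sup>+s. f (prim b s) \<partial>lborel) \<le> ennreal (1 / \<theta>) * (\<integral>\<^sup>+u. f u \<partial>lborel)"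
proof -
  have "(\<integral>\<^sup>+s. f (prim b s) \<partial>lborel) \<le> (\<integral>\<^sup>+s. ennreal (1/\<theta>) * (ennreal \<bar>b s\<bar> * f (prim b s)) \<partial>lborel)"
  proof (rule nn_integral_mono)
    fix s
    have "ennreal 1 \<le> ennreal (1/\<theta> * \<bar>b s\<bar>)"
      using abs_ge[of s] pos by (intro ennreal_leI) simp
    then have "1 \<le> ennreal (1/\<theta>) * ennreal \<bar>b s\<bar>"
      using pos by (subst ennreal_mult[symmetric]) simp_all
    then show "f (prim b s) \<le> ennreal (1/\<theta>) * (ennreal \<bar>b s\<bar> * f (prim b s))"
      using mult_right_mono[of 1 "ennreal (1/\<theta>) * ennreal \<bar>b s\<bar>" "f (prim b s)"] by (simp add: mult.assoc)
  qed
  also have "\<dots> = ennreal (1 / \<theta>) * (\<integral>\<^sup>+u. f u \<partial>lborel)"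
    by (simp add: nn_integral_cmult nn_integral_prim)
  finally show ?thesis .
qed

lemma integral_prim:
  fixes f :: "real \<Rightarrow> 'a::{banach, second_countable_topology}"
  assumes [measurable]: "f \<in> borel_measurable borel"
  shows "(LINT s|lborel. \<bar>b s\<bar> *\<^sub>R f (prim b s)) = (LINT u|lborel. f u)"
    and "integrable lborel (\<lambda>s. \<bar>b s\<bar> *\<^sub>R f (prim b s)) \<longleftrightarrow> integrable lborel f"
proof -
  have "(LINT u|lborel. f u) = (LINT u|distr (density lborel (\<lambda>x. ennreal \<bar>b x\<bar>)) borel (prim b). f u)"
    by (simp add: distr_prim)
  also have "\<dots> = (LINT s|lborel. \<bar>b s\<bar> *\<^sub>R f (prim b s))"
    by (simp add: integral_distr integral_density)
  finally show "(LINT s|lborel. \<bar>b s\<bar> *\<^sub>R f (prim b s)) = (LINT u|lborel. f u)" ..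
  have "integrable lborel f \<longleftrightarrow> integrable (distr (density lborel (\<lambda>x. ennreal \<bar>b x\<bar>)) borel (prim b)) f"
    by (simp add: distr_prim)
  also have "\<dots> \<longleftrightarrow> integrable lborel (\<lambda>s. \<bar>b s\<bar> *\<^sub>R f (prim b s))"
    by (simp add: integrable_distr_eq integrable_density)
  finally show "integrable lborel (\<lambda>s. \<bar>b s\<bar> *\<^sub>R f (prim b s)) \<longleftrightarrow> integrable lborel f" ..
qed

text \<open>The time at which the characteristic through the origin reaches a given u.\<close>

definition clock :: "real \<Rightarrow> real" where
  "clock = the_inv (prim b)"

lemma clock_prim [simp]: "clock (prim b x) = x"
  unfolding clock_def by (rule the_inv_f_f) (auto simp: inj inj_on_def)

lemma prim_clock [simp]: "prim b (clock x) = x"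
  using surj[of x] by auto

text \<open>The expansion rate \<theta> of \<open>prim b\<close> makes its inverse Lipschitz with
  constant 1 / \<theta>.\<close>

lemma clock_measurable [measurable]: "clock \<in> borel_measurable borel"
proof -
  have "\<bar>clock u - clock v\<bar> \<le> 1/\<theta> * \<bar>u - v\<bar>" for u v
  proof -
    have "\<theta> * \<bar>clock u - clock v\<bar> \<le> \<bar>direction * (u - v)\<bar>"
    proof (cases "clock u \<le> clock v")
      case True
      then show ?thesis using expand[OF True] by (simp add: abs_minus_commute right_diff_distrib)
    next
      case False
      then show ?thesis using expand[of "clock v" "clock u"] by simp
    qed
    also have "\<dots> = \<bar>u - v\<bar>"
      by (simp add: direction_def abs_mult)
    finally show ?thesis using pos by (simp add: field_simps)
  qed
  then have "lipschitz_on (1/\<theta>) UNIV clock"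
    using pos by (intro lipschitz_onI) (auto simp: dist_real_def)
  then have "continuous_on UNIV clock"
    by (rule lipschitz_on_continuous_on)
  then show ?thesis by (rule borel_measurable_continuous_onI)
qed

end

section \<open>Uniform approximation on strips\<close>

lemma L1_approx_indicator:
  fixes c :: complex
  assumes A: "A \<in> sets lborel" and e: "0 < e"
  obtains g where "continuous_on UNIV g" "bounded (range g)"
    "(\<integral>\<^sup>+x. norm (indicator A x *\<^sub>R c - g x) \<partial>(lborel :: real measure)) \<le> ennreal e"
proof -
  \<comment> \<open>The error lives on U - C, which has measure at most 2 d, and is at most |c|
    there; the 1 in the denominator covers c = 0.\<close>
  define d where "d = e / (2 * (norm c + 1))"
  have nc: "0 < norm c + 1" by (rule add_nonneg_pos) simp_all
  then have d: "0 < d" using e by (simp add: d_def)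
  have A': "A \<in> sets lebesgue" using A by simp
  obtain U where U: "open U" "A \<subseteq> U" "emeasure lebesgue (U - A) < ennreal d"
    using sets_lebesgue_outer_open[OF A' d] by metis
  obtain C where C: "closed C" "C \<subseteq> A" "emeasure lebesgue (A - C) < ennreal d"
    using sets_lebesgue_inner_closed[OF A' d] by metis
  obtain \<phi> :: "real \<Rightarrow> real" where \<phi>: "continuous_on UNIV \<phi>"
    and seg: "\<And>x. \<phi> x \<in> closed_segment 1 0"
    and on: "\<And>x. x \<in> C \<Longrightarrow> \<phi> x = 1" and off: "\<And>x. x \<in> - U \<Longrightarrow> \<phi> x = 0"
    using Urysohn[of C "- U" "1::real" 0] U C by (metis (no_types, opaque_lifting) Compl_disjoint closed_Compl disjoint_eq_subset_Compl double_complement order_trans)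
  have range: "0 \<le> \<phi> x" "\<phi> x \<le> 1" for x
    using seg[of x] by (auto simp: closed_segment_eq_real_ivl split: if_splits)
  have [measurable]: "\<phi> \<in> borel_measurable borel"
    using \<phi> by (rule borel_measurable_continuous_onI)
  have [measurable]: "A \<in> sets borel" "U \<in> sets borel" "C \<in> sets borel"
    using A U C by auto
  have "norm (indicator A x *\<^sub>R c - \<phi> x *\<^sub>R c) \<le> norm c * indicator (U - C) x" for x
  proof -
    have "\<bar>indicator A x - \<phi> x\<bar> \<le> (indicator (U - C) x :: real)"
      using range[of x] on[of x] off[of x] U(2) C(2) by (auto simp: indicator_def)
    from mult_left_mono[OF this norm_ge_zero[of c]] show ?thesis
      by (simp add: scaleR_diff_left[symmetric] mult.commute del: of_real_diff)
  qed
  then have "(\<integral>\<^sup>+x. norm (indicator A x *\<^sub>R c - \<phi> x *\<^sub>R c) \<partial>lborel)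
      \<le> (\<integral>\<^sup>+x. ennreal (norm c) * indicator (U - C) x \<partial>lborel)"
    by (intro nn_integral_mono) (simp add: ennreal_leI ennreal_indicator[symmetric] ennreal_mult[symmetric])
  also have "\<dots> = ennreal (norm c) * emeasure lborel (U - C)"
    by (simp add: nn_integral_cmult_indicator)
  also have "\<dots> \<le> ennreal (norm c) * (ennreal d + ennreal d)"
  proof (rule mult_left_mono)
    have "U - C = (U - A) \<union> (A - C)" using U C by auto
    then have "emeasure lborel (U - C) \<le> emeasure lborel (U - A) + emeasure lborel (A - C)"
      using emeasure_subadditive[of "U - A" lborel "A - C"] by simp
    also have "\<dots> \<le> ennreal d + ennreal d"
      using U(3) C(3) by (intro add_mono less_imp_le) simp_all
    finally show "emeasure lborel (U - C) \<le> ennreal d + ennreal d" .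
  qed simp
  also have "\<dots> = ennreal (norm c * (2 * d))"
    using d by (simp add: ennreal_mult ennreal_plus[symmetric] del: ennreal_plus)
  also have "\<dots> \<le> ennreal e"
  proof (rule ennreal_leI)
    have "norm c * (2 * d) = e * (norm c / (norm c + 1))"
      using nc by (simp add: d_def divide_simps)
    also have "\<dots> \<le> e * 1"
      using e nc by (intro mult_left_mono) (simp_all add: divide_le_eq)
    finally show "norm c * (2 * d) \<le> e" by simp
  qed
  finally have "(\<integral>\<^sup>+x. norm (indicator A x *\<^sub>R c - \<phi> x *\<^sub>R c) \<partial>lborel) \<le> ennreal e" .
  moreover have "continuous_on UNIV (\<lambda>x. \<phi> x *\<^sub>R c)"
    by (intro continuous_intros \<phi>)
  moreover have "bounded (range (\<lambda>x. \<phi> x *\<^sub>R c))"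
  proof (rule boundedI)
    fix y assume "y \<in> range (\<lambda>x. \<phi> x *\<^sub>R c)"
    then obtain x where "y = \<phi> x *\<^sub>R c" by auto
    then show "norm y \<le> norm c"
      using range[of x] by (simp add: mult_left_le_one_le)
  qed
  ultimately show ?thesis using that by blast
qed

lemma L1_triangle:
  fixes f g h :: "'a \<Rightarrow> complex"
  assumes [measurable]: "f \<in> borel_measurable M" "g \<in> borel_measurable M" "h \<in> borel_measurable M"
    and fg: "(\<integral>\<^sup>+x. norm (f x - g x) \<partial>M) \<le> ennreal (e / 2)"
    and gh: "(\<integral>\<^sup>+x. norm (g x - h x) \<partial>M) \<le> ennreal (e / 2)" and e: "0 < e"
  shows "(\<integral>\<^sup>+x. norm (f x - h x) \<partial>M) \<le> ennreal e"
proof -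
  have "(\<integral>\<^sup>+x. norm (f x - h x) \<partial>M)
     \<le> (\<integral>\<^sup>+x. ennreal (norm (f x - g x)) + ennreal (norm (g x - h x)) \<partial>M)"
  proof (intro nn_integral_mono)
    fix x
    have "norm (f x - h x) \<le> norm (f x - g x) + norm (g x - h x)"
      using norm_triangle_ineq[of "f x - g x" "g x - h x"] by simp
    then show "ennreal (norm (f x - h x)) \<le> ennreal (norm (f x - g x)) + ennreal (norm (g x - h x))"
      by (simp add: ennreal_plus[symmetric] ennreal_leI del: ennreal_plus)
  qed
  also have "\<dots> = (\<integral>\<^sup>+x. norm (f x - g x) \<partial>M) + (\<integral>\<^sup>+x. norm (g x - h x) \<partial>M)"
    by (rule nn_integral_add) measurable
  also have "\<dots> \<le> ennreal (e / 2) + ennreal (e / 2)"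
    by (rule add_mono[OF fg gh])
  also have "\<dots> = ennreal e"
    using e by (subst ennreal_plus[symmetric]) simp_all
  finally show ?thesis .
qed

lemma L1_add:
  fixes f1 f2 g1 g2 :: "'a \<Rightarrow> complex"
  assumes [measurable]: "f1 \<in> borel_measurable M" "f2 \<in> borel_measurable M"
      "g1 \<in> borel_measurable M" "g2 \<in> borel_measurable M"
    and "(\<integral>\<^sup>+x. norm (f1 x - g1 x) \<partial>M) \<le> ennreal (e / 2)"
      "(\<integral>\<^sup>+x. norm (f2 x - g2 x) \<partial>M) \<le> ennreal (e / 2)" "0 < e"
  shows "(\<integral>\<^sup>+x. norm (f1 x + f2 x - (g1 x + g2 x)) \<partial>M) \<le> ennreal e"
  by (rule L1_triangle[of _ _ "\<lambda>x. g1 x + f2 x"]) (use assms in simp_all)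

text \<open>Induction over integrable functions: indicators, sums, dominated limits. Boundedness of
  g is carried along because a bounded approximant is what later makes the Volterra integrals
  converge when the coefficient is merely integrable.\<close>

lemma L1_approx_continuous:
  fixes f :: "real \<Rightarrow> complex"
  assumes "integrable lborel f"
  shows "\<forall>e>0. \<exists>g. continuous_on UNIV g \<and> bounded (range g) \<and>
    (\<integral>\<^sup>+x. norm (f x - g x) \<partial>lborel) \<le> ennreal e"
  using assms
proof (induction rule: integrable_induct)
  case (base A c)
  then show ?case using L1_approx_indicator by metis
next
  case (add f1 f2)
  show ?case
  proof (intro allI impI)
    fix e :: real assume "0 < e"
    then have e2: "0 < e / 2" by simp
    obtain g1 where g1: "continuous_on UNIV g1" "bounded (range g1)"
      "(\<integral>\<^sup>+x. norm (f1 x - g1 x) \<partial>lborel) \<le> ennreal (e / 2)" using add.IH(1) e2 by blast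
    obtain g2 where g2: "continuous_on UNIV g2" "bounded (range g2)"
      "(\<integral>\<^sup>+x. norm (f2 x - g2 x) \<partial>lborel) \<le> ennreal (e / 2)" using add.IH(2) e2 by blast
    have [measurable]: "f1 \<in> borel_measurable borel" "f2 \<in> borel_measurable borel"
      using add.hyps by (simp_all add: borel_measurable_integrable)
    have [measurable]: "g1 \<in> borel_measurable borel" "g2 \<in> borel_measurable borel"
      using g1 g2 by (simp_all add: borel_measurable_continuous_onI)
    have "(\<integral>\<^sup>+x. norm (f1 x + f2 x - (g1 x + g2 x)) \<partial>lborel) \<le> ennreal e"
      using g1(3) g2(3) \<open>0 < e\<close> by (intro L1_add) simp_all
    then show "\<exists>g. continuous_on UNIV g \<and> bounded (range g) \<and>
        (\<integral>\<^sup>+x. norm (f1 x + f2 x - g x) \<partial>lborel) \<le> ennreal e"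
      using g1 g2 by (intro exI[of _ "\<lambda>x. g1 x + g2 x"]) (simp add: continuous_on_add bounded_plus_comp)
  qed
next
  case (lim f s)
  show ?case
  proof (intro allI impI)
    fix e :: real assume "0 < e"
    then have e2: "0 < e / 2" by simp
    have [measurable]: "f \<in> borel_measurable borel" "s i \<in> borel_measurable borel" for i
      using lim.hyps by (simp_all add: borel_measurable_integrable)
    have "(\<lambda>i. \<integral>\<^sup>+x. norm (f x - s i x) \<partial>lborel) \<longlonglongrightarrow> 0"
    proof (rule nn_integral_dominated_convergence_norm[where w = "\<lambda>x. 2 * norm (f x)"])
      show "(\<integral>\<^sup>+x. ennreal (2 * norm (f x)) \<partial>lborel) < \<infinity>"
        using lim.hyps(4) unfolding integrable_iff_bounded
        by (simp add: ennreal_mult nn_integral_cmult ennreal_mult_less_top)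
    qed (use lim.hyps in auto)
    then have "\<forall>\<^sub>F i in sequentially. (\<integral>\<^sup>+x. norm (f x - s i x) \<partial>lborel) < ennreal (e / 2)"
    proof (rule order_tendstoD(2))
      show "0 < ennreal (e / 2)" using e2 by (simp only: ennreal_less_zero_iff)
    qed
    then obtain i where i: "(\<integral>\<^sup>+x. norm (f x - s i x) \<partial>lborel) \<le> ennreal (e / 2)"
      by (meson eventually_happens' less_imp_le sequentially_bot)
    obtain g where g: "continuous_on UNIV g" "bounded (range g)"
      "(\<integral>\<^sup>+x. norm (s i x - g x) \<partial>lborel) \<le> ennreal (e / 2)" using lim.IH e2 by blast
    have [measurable]: "g \<in> borel_measurable borel"
      using g by (simp add: borel_measurable_continuous_onI)
    have "(\<integral>\<^sup>+x. norm (f x - g x) \<partial>lborel) \<le> ennreal e"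
      by (rule L1_triangle[OF _ _ _ i g(3) \<open>0 < e\<close>]) simp_all
    then show "\<exists>g. continuous_on UNIV g \<and> bounded (range g) \<and>
        (\<integral>\<^sup>+x. norm (f x - g x) \<partial>lborel) \<le> ennreal e"
      using g by blast
  qed
qed

text \<open>Stated for an arbitrary measure, since it is applied to every strip and to Lebesgue
  measure on a single vertical line. The integrals have a finite sum, so the series of norms is
  finite almost everywhere; on the remaining null set the value of \<open>suminf\<close> is
  arbitrary and harmless.\<close>

lemma nn_integral_suminf_tail:
  fixes f :: "nat \<Rightarrow> 'a \<Rightarrow> complex"
  assumes [measurable]: "\<And>N. f N \<in> borel_measurable M"
    and le: "\<And>N. (\<integral>\<^sup>+p. norm (f N p) \<partial>M) \<le> ennreal (c N)"
    and c: "\<And>N. 0 \<le> c N" "summable c"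
  shows "AE p in M. summable (\<lambda>N. norm (f N p))"
    and "(\<integral>\<^sup>+p. norm ((\<Sum>N. f N p) - (\<Sum>N<K. f N p)) \<partial>M) \<le> ennreal (\<Sum>N. c (N + K))"
proof -
  have sum_le: "(\<integral>\<^sup>+p. (\<Sum>N. ennreal (norm (f (N + K) p))) \<partial>M) \<le> ennreal (\<Sum>N. c (N + K))" for K
  proof -
    have "(\<integral>\<^sup>+p. (\<Sum>N. ennreal (norm (f (N + K) p))) \<partial>M) = (\<Sum>N. \<integral>\<^sup>+p. norm (f (N + K) p) \<partial>M)"
      by (rule nn_integral_suminf) simp
    also have "\<dots> \<le> (\<Sum>N. ennreal (c (N + K)))"
      by (intro suminf_le le) simp_all
    also have "\<dots> = ennreal (\<Sum>N. c (N + K))"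
      using c by (intro suminf_ennreal2) (simp_all add: summable_iff_shift)
    finally show ?thesis .
  qed
  have "(\<integral>\<^sup>+p. (\<Sum>N. ennreal (norm (f N p))) \<partial>M) \<noteq> \<infinity>"
    using sum_le[of 0] by (auto simp: top_unique)
  then have "AE p in M. (\<Sum>N. ennreal (norm (f N p))) \<noteq> \<infinity>"
    by (intro nn_integral_noteq_infinite) simp_all
  then show ae: "AE p in M. summable (\<lambda>N. norm (f N p))"
    by eventually_elim (rule summable_suminf_not_top, simp_all)
  have "(\<integral>\<^sup>+p. norm ((\<Sum>N. f N p) - (\<Sum>N<K. f N p)) \<partial>M)
      \<le> (\<integral>\<^sup>+p. (\<Sum>N. ennreal (norm (f (N + K) p))) \<partial>M)"
  proof (rule nn_integral_mono_AE)
    show "AE p in M. ennreal (norm ((\<Sum>N. f N p) - (\<Sum>N<K. f N p)))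
        \<le> (\<Sum>N. ennreal (norm (f (N + K) p)))"
      using ae
    proof eventually_elim
      case (elim p)
      then have sn: "summable (\<lambda>N. norm (f (N + K) p))"
        by (rule summable_ignore_initial_segment)
      have "norm ((\<Sum>N. f N p) - (\<Sum>N<K. f N p)) = norm (\<Sum>N. f (N + K) p)"
        using suminf_split_initial_segment[OF summable_norm_cancel[OF elim], of K] by simp
      also have "\<dots> \<le> (\<Sum>N. norm (f (N + K) p))"
        by (rule summable_norm[OF sn])
      finally show ?case
        using sn by (subst suminf_ennreal2) (simp_all add: ennreal_leI)
    qed
  qed
  also note sum_le
  finally show "(\<integral>\<^sup>+p. norm ((\<Sum>N. f N p) - (\<Sum>N<K. f N p)) \<partial>M) \<le> ennreal (\<Sum>N. c (N + K))" .
qed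

text \<open>The strips carry Lebesgue measure on the lines x = const and u = const, so a supremum over all of
  them is the larger of the two norms and one class of limits serves both closures.\<close>

definition strips :: "real \<Rightarrow> (real \<times> real) measure set" where
  "strips l = (\<lambda>x. distr lborel borel (\<lambda>u. (x, u))) ` {0..l} \<union>
     range (\<lambda>u. distr (density lborel (indicator {0..l})) borel (\<lambda>x. (x, u)))"

lemma nn_integral_vertical:
  assumes [measurable]: "f \<in> borel_measurable borel"
  shows "(\<integral>\<^sup>+p. f p \<partial>distr lborel borel (\<lambda>u. (x::real, u::real))) = (\<integral>\<^sup>+u. f (x, u) \<partial>lborel)"
  by (simp add: nn_integral_distr)

lemma nn_integral_horizontal:
  assumes [measurable]: "f \<in> borel_measurable borel"
  shows "(\<integral>\<^sup>+p. f p \<partial>distr (density lborel (indicator {0..l})) borel (\<lambda>x. (x::real, u::real)))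
    = (\<integral>\<^sup>+x. indicator {0..l} x * f (x, u) \<partial>lborel)"
  by (simp add: nn_integral_distr nn_integral_density)

lemma strips_all:
  assumes [measurable]: "f \<in> borel_measurable borel"
  shows "(\<forall>M\<in>strips l. (\<integral>\<^sup>+p. f p \<partial>M) \<le> c) \<longleftrightarrow>
    (\<forall>x\<in>{0..l}. (\<integral>\<^sup>+u. f (x, u) \<partial>lborel) \<le> c) \<and>
    (\<forall>u. (\<integral>\<^sup>+x. indicator {0..l} x * f (x, u) \<partial>lborel) \<le> c)"
  unfolding strips_def ball_Un ball_simps by (simp add: nn_integral_vertical nn_integral_horizontal)

lemma strips_measurable: "M \<in> strips l \<Longrightarrow> f \<in> borel_measurable borel \<Longrightarrow> f \<in> borel_measurable M"
  by (auto simp: strips_def)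

text \<open>The approximants are bounded and continuous on the whole plane, because shifts along
  characteristics do not respect \<open>Omega l\<close>. The error is controlled on every line and
  not just on almost every one, so that the lines u = \<open>prim b t\<close> can be picked out
  later.\<close>

definition approximable :: "real \<Rightarrow> (real \<times> real \<Rightarrow> complex) \<Rightarrow> bool" where
  "approximable l f \<longleftrightarrow> f \<in> borel_measurable borel \<and>
    (\<forall>e>0. \<exists>g. continuous_on UNIV g \<and> bounded (range g) \<and>
      (\<forall>M\<in>strips l. (\<integral>\<^sup>+p. norm (f p - g p) \<partial>M) \<le> ennreal e))"

lemma approximableD:
  assumes "approximable l f" "0 < e"
  obtains g where "continuous_on UNIV g" "bounded (range g)"
    "\<And>M. M \<in> strips l \<Longrightarrow> (\<integral>\<^sup>+p. norm (f p - g p) \<partial>M) \<le> ennreal e"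
  using assms unfolding approximable_def by blast

lemma approximable_0: "approximable l (\<lambda>_. 0)"
  unfolding approximable_def
proof (intro conjI allI impI)
  fix e :: real assume "0 < e"
  then show "\<exists>g. continuous_on UNIV g \<and> bounded (range g) \<and>
      (\<forall>M\<in>strips l. (\<integral>\<^sup>+p. norm (0 - g p) \<partial>M) \<le> ennreal e)"
    by (intro exI[of _ "\<lambda>_. 0"]) simp
qed simp

lemma approximable_trans:
  assumes [measurable]: "f \<in> borel_measurable borel"
    and *: "\<And>e. 0 < e \<Longrightarrow> \<exists>h. approximable l h \<and> (\<forall>M\<in>strips l. (\<integral>\<^sup>+p. norm (f p - h p) \<partial>M) \<le> ennreal e)"
  shows "approximable l f"
  unfolding approximable_def
proof (intro conjI allI impI)
  fix e :: real assume "0 < e"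
  then have e2: "0 < e / 2" by simp
  obtain h where h: "approximable l h" "\<forall>M\<in>strips l. (\<integral>\<^sup>+p. norm (f p - h p) \<partial>M) \<le> ennreal (e / 2)"
    using *[OF e2] by blast
  obtain g where g: "continuous_on UNIV g" "bounded (range g)"
    "\<And>M. M \<in> strips l \<Longrightarrow> (\<integral>\<^sup>+p. norm (h p - g p) \<partial>M) \<le> ennreal (e / 2)"
    using approximableD[OF h(1) e2] by blast
  have [measurable]: "h \<in> borel_measurable borel" "g \<in> borel_measurable borel"
    using h g by (simp_all add: approximable_def borel_measurable_continuous_onI)
  have "(\<integral>\<^sup>+p. norm (f p - g p) \<partial>M) \<le> ennreal e" if M: "M \<in> strips l" for M
    using h(2) M by (intro L1_triangle[OF _ _ _ _ g(3)[OF M] \<open>0 < e\<close>] strips_measurable[OF M]) simp_all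
  then show "\<exists>g. continuous_on UNIV g \<and> bounded (range g) \<and>
      (\<forall>M\<in>strips l. (\<integral>\<^sup>+p. norm (f p - g p) \<partial>M) \<le> ennreal e)"
    using g by blast
qed simp

lemma approximable_add:
  assumes f1: "approximable l f1" and f2: "approximable l f2"
  shows "approximable l (\<lambda>p. f1 p + f2 p)"
  unfolding approximable_def
proof (intro conjI allI impI)
  have [measurable]: "f1 \<in> borel_measurable borel" "f2 \<in> borel_measurable borel"
    using assms by (simp_all add: approximable_def)
  show "(\<lambda>p. f1 p + f2 p) \<in> borel_measurable borel" by simp
  fix e :: real assume "0 < e"
  then have e2: "0 < e / 2" by simp
  obtain g1 where g1: "continuous_on UNIV g1" "bounded (range g1)"
    "\<And>M. M \<in> strips l \<Longrightarrow> (\<integral>\<^sup>+p. norm (f1 p - g1 p) \<partial>M) \<le> ennreal (e / 2)"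
    using approximableD[OF f1 e2] by blast
  obtain g2 where g2: "continuous_on UNIV g2" "bounded (range g2)"
    "\<And>M. M \<in> strips l \<Longrightarrow> (\<integral>\<^sup>+p. norm (f2 p - g2 p) \<partial>M) \<le> ennreal (e / 2)"
    using approximableD[OF f2 e2] by blast
  have [measurable]: "g1 \<in> borel_measurable borel" "g2 \<in> borel_measurable borel"
    using g1 g2 by (simp_all add: borel_measurable_continuous_onI)
  have "(\<integral>\<^sup>+p. norm (f1 p + f2 p - (g1 p + g2 p)) \<partial>M) \<le> ennreal e" if M: "M \<in> strips l" for M
    by (intro L1_add[OF _ _ _ _ g1(3)[OF M] g2(3)[OF M] \<open>0 < e\<close>] strips_measurable[OF M]) simp_all
  then show "\<exists>g. continuous_on UNIV g \<and> bounded (range g) \<and>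
      (\<forall>M\<in>strips l. (\<integral>\<^sup>+p. norm (f1 p + f2 p - g p) \<partial>M) \<le> ennreal e)"
    using g1 g2 by (intro exI[of _ "\<lambda>x. g1 x + g2 x"]) (simp add: continuous_on_add bounded_plus_comp)
qed

lemma approximable_cmult:
  assumes f: "approximable l f"
  shows "approximable l (\<lambda>p. c * f p)"
  unfolding approximable_def
proof (intro conjI allI impI)
  have [measurable]: "f \<in> borel_measurable borel"
    using assms by (simp add: approximable_def)
  show "(\<lambda>p. c * f p) \<in> borel_measurable borel" by simp
  fix e :: real assume e: "0 < e"
  have nc: "0 < norm c + 1" by (rule add_nonneg_pos) simp_all
  then have d: "0 < e / (norm c + 1)" using e by simp
  obtain g where g: "continuous_on UNIV g" "bounded (range g)"
    "\<And>M. M \<in> strips l \<Longrightarrow> (\<integral>\<^sup>+p. norm (f p - g p) \<partial>M) \<le> ennreal (e / (norm c + 1))"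
    using approximableD[OF f d] by blast
  have [measurable]: "g \<in> borel_measurable borel"
    using g by (simp add: borel_measurable_continuous_onI)
  have "(\<integral>\<^sup>+p. norm (c * f p - c * g p) \<partial>M) \<le> ennreal e" if M: "M \<in> strips l" for M
  proof -
    have "(\<integral>\<^sup>+p. norm (c * f p - c * g p) \<partial>M) = (\<integral>\<^sup>+p. ennreal (norm c) * ennreal (norm (f p - g p)) \<partial>M)"
      by (simp add: right_diff_distrib[symmetric] norm_mult ennreal_mult)
    also have "\<dots> = ennreal (norm c) * (\<integral>\<^sup>+p. norm (f p - g p) \<partial>M)"
      by (rule nn_integral_cmult) (simp add: strips_measurable[OF M])
    also have "\<dots> \<le> ennreal (norm c) * ennreal (e / (norm c + 1))"
      using g(3)[OF M] by (rule mult_left_mono) simp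
    also have "\<dots> = ennreal (e * (norm c / (norm c + 1)))"
      using d by (simp add: ennreal_mult[symmetric] mult.commute)
    also have "\<dots> \<le> ennreal (e * 1)"
      using e nc by (intro ennreal_leI mult_left_mono) (simp_all add: divide_le_eq)
    finally show ?thesis by simp
  qed
  moreover have "bounded (range (\<lambda>p. c * g p))"
    using bounded_linear_image[OF g(2) bounded_linear_mult_right[of c]] by (simp add: image_image)
  ultimately show "\<exists>g. continuous_on UNIV g \<and> bounded (range g) \<and>
      (\<forall>M\<in>strips l. (\<integral>\<^sup>+p. norm (c * f p - g p) \<partial>M) \<le> ennreal e)"
    using g by (intro exI[of _ "\<lambda>x. c * g x"]) (simp add: continuous_on_mult_left)
qed

lemma approximable_sum:
  assumes "\<And>i. i \<in> I \<Longrightarrow> approximable l (f i)"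
  shows "approximable l (\<lambda>p. \<Sum>i\<in>I. f i p)"
  using assms by (induction I rule: infinite_finite_induct) (simp_all add: approximable_0 approximable_add)

text \<open>The bound c N is the same for all strips, so a single partial sum is close on all of
  them at once.\<close>

lemma approximable_suminf:
  assumes f: "\<And>N. approximable l (f N)"
    and le: "\<And>N M. M \<in> strips l \<Longrightarrow> (\<integral>\<^sup>+p. norm (f N p) \<partial>M) \<le> ennreal (c N)"
    and c: "\<And>N. 0 \<le> c N" "summable c"
  shows "approximable l (\<lambda>p. \<Sum>N. f N p)"
proof (rule approximable_trans)
  have [measurable]: "f N \<in> borel_measurable borel" for N
    using f by (simp add: approximable_def)
  show "(\<lambda>p. \<Sum>N. f N p) \<in> borel_measurable borel" by simp
  fix e :: real assume e: "0 < e"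
  have "(\<lambda>K. \<Sum>N. c (N + K)) \<longlonglongrightarrow> 0"
    using c(2) by (rule suminf_exist_split2)
  then have "\<forall>\<^sub>F K in sequentially. (\<Sum>N. c (N + K)) < e"
    using e by (intro order_tendstoD)
  then obtain K where K: "(\<Sum>N. c (N + K)) < e"
    by (meson eventually_happens' sequentially_bot)
  have "(\<integral>\<^sup>+p. norm ((\<Sum>N. f N p) - (\<Sum>N<K. f N p)) \<partial>M) \<le> ennreal e" if M: "M \<in> strips l" for M
  proof -
    have "(\<integral>\<^sup>+p. norm ((\<Sum>N. f N p) - (\<Sum>N<K. f N p)) \<partial>M) \<le> ennreal (\<Sum>N. c (N + K))"
      by (rule nn_integral_suminf_tail(2)) (simp_all add: le M c strips_measurable[OF M])
    also have "\<dots> \<le> ennreal e" using K by (intro ennreal_leI) simp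
    finally show ?thesis .
  qed
  moreover have "approximable l (\<lambda>p. \<Sum>N<K. f N p)"
    by (rule approximable_sum) (rule f)
  ultimately show "\<exists>h. approximable l h \<and>
      (\<forall>M\<in>strips l. (\<integral>\<^sup>+p. norm ((\<Sum>N. f N p) - h p) \<partial>M) \<le> ennreal e)"
    by blast
qed

section \<open>Volterra operators along characteristics\<close>

lemma borel_measurable_fst_snd [measurable]:
  "fst \<in> borel_measurable (borel :: (real \<times> real) measure)"
  "snd \<in> borel_measurable (borel :: (real \<times> real) measure)"
  by (intro borel_measurable_continuous_onI continuous_intros)+

text \<open>The points (s, u - R x + R s) with 0 \<le> s \<le> x form the characteristic with
  primitive R that ends in (x, u); the operator adds up the source q f along it.\<close>

definition volt :: "(real \<Rightarrow> complex) \<Rightarrow> (real \<Rightarrow> real) \<Rightarrow> (real \<times> real \<Rightarrow> complex) \<Rightarrow> real \<times> real \<Rightarrow> complex" where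
  "volt q R f p = (LBINT s:{0..fst p}. q s * f (s, snd p - R (fst p) + R s))"

text \<open>A majorant of \<open>volt\<close> with values in [0, \<infinity>], to which Tonelli
  applies whether or not the integral in \<open>volt\<close> converges.\<close>

definition voltn :: "(real \<Rightarrow> complex) \<Rightarrow> (real \<Rightarrow> real) \<Rightarrow> (real \<times> real \<Rightarrow> ennreal) \<Rightarrow> real \<times> real \<Rightarrow> ennreal" where
  "voltn q R h p = (\<integral>\<^sup>+s. indicator {0..fst p} s * (ennreal (norm (q s)) * h (s, snd p - R (fst p) + R s)) \<partial>lborel)"

lemma volt_measurable [measurable]:
  assumes [measurable]: "q \<in> borel_measurable borel" "R \<in> borel_measurable borel" "f \<in> borel_measurable borel"
  shows "volt q R f \<in> borel_measurable borel"
proof -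
  have "(\<lambda>p. LBINT s. if 0 \<le> s \<and> s \<le> fst p then q s * f (s, snd p - R (fst p) + R s) else 0)
      \<in> borel_measurable borel"
    by measurable
  moreover have "indicator {0..a} s *\<^sub>R c = (if 0 \<le> s \<and> s \<le> a then c else 0)" for a s :: real and c :: complex
    by simp
  ultimately show ?thesis
    unfolding volt_def[abs_def] set_lebesgue_integral_def by presburger
qed

lemma indicator_Icc_measurable [measurable]:
  fixes f g :: "'a \<Rightarrow> real"
  assumes [measurable]: "f \<in> borel_measurable M" "g \<in> borel_measurable M"
  shows "(\<lambda>x. indicator {0..f x} (g x) :: ennreal) \<in> borel_measurable M"
proof -
  have "(\<lambda>x. if 0 \<le> g x \<and> g x \<le> f x then 1 else 0 :: ennreal) \<in> borel_measurable M"
    by measurable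
  then show ?thesis by (simp add: indicator_def of_bool_def)
qed

lemma indicator_mult_mono:
  fixes c :: ennreal
  assumes "x \<in> A \<Longrightarrow> y \<le> z"
  shows "indicator A x * (c * y) \<le> indicator A x * (c * z)"
  using assms by (cases "x \<in> A") (simp_all add: mult_left_mono)

text \<open>Tonelli, then translation invariance in u: shifting along characteristics preserves the
  integral over a vertical line.\<close>

lemma voltn_vertical:
  assumes [measurable]: "q \<in> borel_measurable borel" "R \<in> borel_measurable borel" "h \<in> borel_measurable borel"
  shows "(\<integral>\<^sup>+u. voltn q R h (x, u) \<partial>lborel)
    = (\<integral>\<^sup>+s. indicator {0..x} s * (ennreal (norm (q s)) * (\<integral>\<^sup>+u. h (s, u) \<partial>lborel)) \<partial>lborel)"
proof -
  have shift: "(\<integral>\<^sup>+u. h (s, u - R x + R s) \<partial>lborel) = (\<integral>\<^sup>+u. h (s, u) \<partial>lborel)" for s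
    using nn_integral_real_affine[of "\<lambda>u. h (s, u)" 1 "- R x + R s"] by (simp add: algebra_simps)
  have "(\<integral>\<^sup>+u. voltn q R h (x, u) \<partial>lborel)
     = (\<integral>\<^sup>+s. \<integral>\<^sup>+u. indicator {0..x} s * (ennreal (norm (q s)) * h (s, u - R x + R s)) \<partial>lborel \<partial>lborel)"
    unfolding voltn_def fst_conv snd_conv by (rule lborel_pair.Fubini') measurable
  also have "\<dots> = (\<integral>\<^sup>+s. indicator {0..x} s * (ennreal (norm (q s)) * (\<integral>\<^sup>+u. h (s, u) \<partial>lborel)) \<partial>lborel)"
    by (simp add: nn_integral_cmult shift)
  finally show ?thesis .
qed

text \<open>For fixed s and u the point u - R x + R s sweeps the line with speed at least \<theta>
  as x varies. Hence an integral in the x direction is controlled by vertical integrals of h alone,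
  and this is how one norm of the input controls both norms of the output.\<close>

lemma voltn_horizontal:
  assumes "speed b \<theta>"
    and [measurable]: "q \<in> borel_measurable borel" "h \<in> borel_measurable borel"
  shows "(\<integral>\<^sup>+x. indicator {0..l} x * voltn q (prim b) h (x, u) \<partial>lborel)
    \<le> ennreal (1 / \<theta>) * (\<integral>\<^sup>+s. indicator {0..l} s * (ennreal (norm (q s)) * (\<integral>\<^sup>+u. h (s, u) \<partial>lborel)) \<partial>lborel)"
proof -
  interpret speed b \<theta> by fact
  have slice: "(\<integral>\<^sup>+x. h (s, u - prim b x + prim b s) \<partial>lborel) \<le> ennreal (1 / \<theta>) * (\<integral>\<^sup>+u. h (s, u) \<partial>lborel)" for s
    using nn_integral_prim_le[of "\<lambda>w. h (s, u - w + prim b s)"]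
      nn_integral_real_affine[of "\<lambda>u. h (s, u)" "-1" "u + prim b s"] by (simp add: algebra_simps)
  have "(\<integral>\<^sup>+x. indicator {0..l} x * voltn q (prim b) h (x, u) \<partial>lborel)
     = (\<integral>\<^sup>+x. \<integral>\<^sup>+s. indicator {0..l} x * (indicator {0..x} s * (ennreal (norm (q s)) * h (s, u - prim b x + prim b s))) \<partial>lborel \<partial>lborel)"
    unfolding voltn_def fst_conv snd_conv by (intro nn_integral_cong nn_integral_cmult[symmetric]) measurable
  also have "\<dots> = (\<integral>\<^sup>+s. \<integral>\<^sup>+x. indicator {0..l} x * (indicator {0..x} s * (ennreal (norm (q s)) * h (s, u - prim b x + prim b s))) \<partial>lborel \<partial>lborel)"
    by (rule lborel_pair.Fubini') measurable
  also have "\<dots> \<le> (\<integral>\<^sup>+s. \<integral>\<^sup>+x. (indicator {0..l} s * ennreal (norm (q s))) * h (s, u - prim b x + prim b s) \<partial>lborel \<partial>lborel)"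
    by (intro nn_integral_mono) (auto split: split_indicator)
  also have "\<dots> = (\<integral>\<^sup>+s. (indicator {0..l} s * ennreal (norm (q s))) * (\<integral>\<^sup>+x. h (s, u - prim b x + prim b s) \<partial>lborel) \<partial>lborel)"
    by (intro nn_integral_cong nn_integral_cmult) measurable
  also have "\<dots> \<le> (\<integral>\<^sup>+s. (indicator {0..l} s * ennreal (norm (q s))) * (ennreal (1 / \<theta>) * (\<integral>\<^sup>+u. h (s, u) \<partial>lborel)) \<partial>lborel)"
    by (intro nn_integral_mono mult_left_mono slice) simp
  also have "\<dots> = (\<integral>\<^sup>+s. ennreal (1 / \<theta>) * (indicator {0..l} s * (ennreal (norm (q s)) * (\<integral>\<^sup>+u. h (s, u) \<partial>lborel))) \<partial>lborel)"
    by (simp add: ac_simps)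
  also have "\<dots> = ennreal (1 / \<theta>) * (\<integral>\<^sup>+s. indicator {0..l} s * (ennreal (norm (q s)) * (\<integral>\<^sup>+u. h (s, u) \<partial>lborel)) \<partial>lborel)"
    by (rule nn_integral_cmult) measurable
  finally show ?thesis .
qed

text \<open>If f is not integrable, its integral has the junk value 0, but then the right-hand side is infinite.\<close>

lemma norm_integral_diff_le:
  fixes f g :: "'a \<Rightarrow> complex"
  assumes g: "integrable M g" and f: "f \<in> borel_measurable M"
  shows "ennreal (norm ((LINT x|M. f x) - (LINT x|M. g x))) \<le> (\<integral>\<^sup>+x. norm (f x - g x) \<partial>M)"
proof (cases "integrable M f")
  case True
  then have "(LINT x|M. f x) - (LINT x|M. g x) = (LINT x|M. f x - g x)"
    using g by simp
  then show ?thesis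
    using integral_norm_bound_ennreal[of M "\<lambda>x. f x - g x"] g True by simp
next
  case False
  have "\<not> integrable M (\<lambda>x. f x - g x)"
  proof
    assume "integrable M (\<lambda>x. f x - g x)"
    from Bochner_Integration.integrable_add[OF this g] False show False by simp
  qed
  then have "(\<integral>\<^sup>+x. norm (f x - g x) \<partial>M) = \<infinity>"
    using f g unfolding integrable_iff_bounded by (auto simp: less_top[symmetric])
  then show ?thesis by simp
qed

text \<open>g is meant to be the bounded continuous approximant, integrable along the
  characteristic; f is only a limit of such functions and may fail to be integrable on single
  characteristics.\<close>

lemma norm_volt_diff_le:
  assumes [measurable]: "q \<in> borel_measurable borel" "R \<in> borel_measurable borel" "f \<in> borel_measurable borel"
    and g: "set_integrable lborel {0..fst p} (\<lambda>s. q s * g (s, snd p - R (fst p) + R s))"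
  shows "ennreal (norm (volt q R f p - volt q R g p)) \<le> voltn q R (\<lambda>p. ennreal (norm (f p - g p))) p"
proof -
  have "ennreal (norm (volt q R f p - volt q R g p))
    \<le> (\<integral>\<^sup>+s. norm (indicator {0..fst p} s *\<^sub>R (q s * f (s, snd p - R (fst p) + R s))
          - indicator {0..fst p} s *\<^sub>R (q s * g (s, snd p - R (fst p) + R s))) \<partial>lborel)"
    unfolding volt_def set_lebesgue_integral_def
    by (rule norm_integral_diff_le) (use g in \<open>simp_all add: set_integrable_def\<close>)
  also have "\<dots> = voltn q R (\<lambda>p. ennreal (norm (f p - g p))) p"
    unfolding voltn_def
    by (intro nn_integral_cong)
      (simp add: indicator_def norm_mult ennreal_mult right_diff_distrib[symmetric])
  finally show ?thesis .
qed

lemma norm_volt_le: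
  assumes "q \<in> borel_measurable borel" "R \<in> borel_measurable borel" "f \<in> borel_measurable borel"
  shows "ennreal (norm (volt q R f p)) \<le> voltn q R (\<lambda>p. ennreal (norm (f p))) p"
  using norm_volt_diff_le[OF assms, of p "\<lambda>_. 0"] by (simp add: volt_def set_integrable_def)

text \<open>The bound on h is local because h will contain e^{i lambda u}, which is bounded only in
  the range of positions that occur.\<close>

lemma set_integrable_mult_bounded:
  fixes q h :: "real \<Rightarrow> complex"
  assumes q: "set_integrable lborel A q" and [measurable]: "h \<in> borel_measurable borel"
    and M: "\<And>s. s \<in> A \<Longrightarrow> norm (h s) \<le> M"
  shows "set_integrable lborel A (\<lambda>s. q s * h s)"
  unfolding set_integrable_def
proof (rule Bochner_Integration.integrable_bound)
  have [measurable]: "(\<lambda>s. indicator A s *\<^sub>R q s) \<in> borel_measurable borel"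
    using q by (simp add: set_integrable_def borel_measurable_integrable)
  show "integrable lborel (\<lambda>s. M * norm (indicator A s *\<^sub>R q s))"
    using q unfolding set_integrable_def by (intro integrable_mult_right integrable_norm)
  have "(\<lambda>s. (indicator A s *\<^sub>R q s) * h s) \<in> borel_measurable lborel" by measurable
  then show "(\<lambda>s. indicator A s *\<^sub>R (q s * h s)) \<in> borel_measurable lborel" by simp
  show "AE s in lborel. norm (indicator A s *\<^sub>R (q s * h s)) \<le> norm (M * norm (indicator A s *\<^sub>R q s))"
  proof (rule AE_I2)
    fix s
    show "norm (indicator A s *\<^sub>R (q s * h s)) \<le> norm (M * norm (indicator A s *\<^sub>R q s))"
    proof (cases "s \<in> A")
      case True
      then have "norm (q s) * norm (h s) \<le> norm (q s) * \<bar>M\<bar>"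
        using M[of s] by (intro mult_left_mono) simp_all
      then show ?thesis using True by (simp add: norm_mult abs_mult mult.commute)
    qed simp
  qed
qed

text \<open>Dominated convergence with the dominating function B |q|. The only obstruction is the
  indicator of [0, x] at its moving end s = x, a single point.\<close>

lemma volt_bounded_continuous:
  assumes q: "integrable lborel q" and R: "continuous_on UNIV R"
    and g: "continuous_on UNIV g" and B: "\<And>p. norm (g p) \<le> B"
  shows "\<And>A v. A \<in> sets borel \<Longrightarrow> set_integrable lborel A (\<lambda>s. q s * g (s, v + R s))"
    and "continuous_on UNIV (volt q R g)"
    and "bounded (range (volt q R g))"
proof -
  have [measurable]: "q \<in> borel_measurable borel" "R \<in> borel_measurable borel" "g \<in> borel_measurable borel"
    using q R g by (simp_all add: borel_measurable_integrable borel_measurable_continuous_onI)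
  have dom: "integrable lborel (\<lambda>s. B * norm (q s))"
    using q by simp
  have "0 \<le> B" using order_trans[OF norm_ge_zero B] .
  then have le: "norm (indicator A s *\<^sub>R (q s * g (s, w))) \<le> B * norm (q s)" for A s w
    using mult_right_mono[OF B[of "(s, w)"] norm_ge_zero[of "q s"]]
    by (auto simp: indicator_def norm_mult mult.commute)
  show int: "set_integrable lborel A (\<lambda>s. q s * g (s, v + R s))" if "A \<in> sets borel" for A v
  proof (rule set_integrable_mult_bounded)
    show "set_integrable lborel A q"
      unfolding set_integrable_def using that q by (intro integrable_mult_indicator) simp_all
  qed (use B in simp_all)
  show "bounded (range (volt q R g))"
  proof (rule boundedI)
    fix y assume "y \<in> range (volt q R g)"
    then obtain p where p: "y = volt q R g p" by auto
    have "norm (LBINT s. indicator {0..fst p} s *\<^sub>R (q s * g (s, snd p - R (fst p) + R s)))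
        \<le> (LBINT s. B * norm (q s))"
    proof (rule Bochner_Integration.integral_norm_bound_integral[OF _ dom le])
      show "integrable lborel (\<lambda>s. indicator {0..fst p} s *\<^sub>R (q s * g (s, snd p - R (fst p) + R s)))"
        using int[of "{0..fst p}" "snd p - R (fst p)"] by (simp add: set_integrable_def)
    qed
    then show "norm y \<le> (LBINT s. B * norm (q s))"
      by (simp add: p volt_def set_lebesgue_integral_def)
  qed
  have R': "isCont R x" for x
    using R by (simp add: continuous_on_eq_continuous_at)
  have g': "isCont g p" for p
    by (rule continuous_on_interior[OF g]) simp
  have "isCont (volt q R g) p" for p
    unfolding continuous_at_sequentially
  proof (intro allI impI)
    fix X assume X: "X \<longlonglongrightarrow> p"
    have X1: "(\<lambda>n. fst (X n)) \<longlonglongrightarrow> fst p" and X2: "(\<lambda>n. snd (X n)) \<longlonglongrightarrow> snd p"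
      using X by (auto intro: tendsto_intros)
    have RX: "(\<lambda>n. R (fst (X n))) \<longlonglongrightarrow> R (fst p)"
      using X1 R' by (metis isCont_tendsto_compose)
    have "(\<lambda>n. LBINT s. indicator {0..fst (X n)} s *\<^sub>R (q s * g (s, snd (X n) - R (fst (X n)) + R s)))
       \<longlonglongrightarrow> (LBINT s. indicator {0..fst p} s *\<^sub>R (q s * g (s, snd p - R (fst p) + R s)))"
    proof (rule integral_dominated_convergence[OF _ _ dom])
      have "(\<lambda>n. indicator {0..fst (X n)} s *\<^sub>R (q s * g (s, snd (X n) - R (fst (X n)) + R s)))
          \<longlonglongrightarrow> indicator {0..fst p} s *\<^sub>R (q s * g (s, snd p - R (fst p) + R s))" if "s \<noteq> fst p" for s
      proof (intro tendsto_scaleR tendsto_mult tendsto_const)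
        have "(\<lambda>n. (s, snd (X n) - R (fst (X n)) + R s)) \<longlonglongrightarrow> (s, snd p - R (fst p) + R s)"
          by (intro tendsto_intros X2 RX)
        then show "(\<lambda>n. g (s, snd (X n) - R (fst (X n)) + R s)) \<longlonglongrightarrow> g (s, snd p - R (fst p) + R s)"
          by (rule isCont_tendsto_compose[OF g'])
        have "\<forall>\<^sub>F n in sequentially. indicator {0..fst (X n)} s = (indicator {0..fst p} s :: real)"
        proof (cases "s < fst p")
          case True
          from order_tendstoD(1)[OF X1 True] show ?thesis
            by eventually_elim (use True in \<open>auto simp: indicator_def\<close>)
        next
          case False
          then have "fst p < s" using that by simp
          from order_tendstoD(2)[OF X1 this] show ?thesis
            by eventually_elim (use \<open>fst p < s\<close> in \<open>auto simp: indicator_def\<close>)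
        qed
        then show "(\<lambda>n. indicator {0..fst (X n)} s) \<longlonglongrightarrow> (indicator {0..fst p} s :: real)"
          by (rule tendsto_eventually)
      qed
      then show "AE s in lborel. (\<lambda>n. indicator {0..fst (X n)} s *\<^sub>R (q s * g (s, snd (X n) - R (fst (X n)) + R s)))
          \<longlonglongrightarrow> indicator {0..fst p} s *\<^sub>R (q s * g (s, snd p - R (fst p) + R s))"
        using AE_lborel_singleton[of "fst p"] by (auto elim: eventually_mono)
    qed (use le in auto)
    then show "((volt q R g) \<circ> X) \<longlonglongrightarrow> volt q R g p"
      by (simp add: volt_def set_lebesgue_integral_def comp_def)
  qed
  then show "continuous_on UNIV (volt q R g)"
    by (simp add: continuous_at_imp_continuous_on)
qed

text \<open>If g approximates f, then \<open>volt\<close> of g is bounded and continuous and differs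
  from \<open>volt\<close> of f by at most \<open>voltn\<close> of |f - g|. Both directions of that
  majorant are bounded by vertical integrals of |f - g|.\<close>

lemma approximable_volt:
  assumes f: "approximable l f" and q: "integrable lborel q" and b: "speed b \<theta>"
  shows "approximable l (volt q (prim b) f)"
  unfolding approximable_def
proof (intro conjI allI impI)
  interpret speed b \<theta> by fact
  have [measurable]: "f \<in> borel_measurable borel" "q \<in> borel_measurable borel"
    using f q by (simp_all add: approximable_def borel_measurable_integrable)
  show "volt q (prim b) f \<in> borel_measurable borel" by simp
  fix e :: real assume e: "0 < e"
  \<comment> \<open>The vertical bound has the factor \<integral>|q|, the horizontal one
    \<integral>|q| / \<theta>. C exceeds both, and the final 1 keeps it positive.\<close>
  define C where "C = (1 + 1 / \<theta>) * (LBINT s. norm (q s)) + 1"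
  have Q0: "0 \<le> (LBINT s. norm (q s))" by simp
  have C: "0 < C" using Q0 pos unfolding C_def by (intro add_nonneg_pos mult_nonneg_nonneg) simp_all
  have Q: "(\<integral>\<^sup>+s. norm (q s) \<partial>lborel) = ennreal (LBINT s. norm (q s))"
    using q by (intro nn_integral_eq_integral) simp_all
  have eC: "0 < e / C" using e C by simp
  obtain g where g: "continuous_on UNIV g" "bounded (range g)"
    "\<And>M. M \<in> strips l \<Longrightarrow> (\<integral>\<^sup>+p. norm (f p - g p) \<partial>M) \<le> ennreal (e / C)"
    using approximableD[OF f eC] by blast
  obtain B where B: "\<And>p. norm (g p) \<le> B"
    using g(2) unfolding bounded_iff by auto
  have [measurable]: "g \<in> borel_measurable borel"
    using g by (simp add: borel_measurable_continuous_onI)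
  note vbc = volt_bounded_continuous[OF q cont g(1) B]
  define h where "h = (\<lambda>p. ennreal (norm (f p - g p)))"
  have [measurable]: "h \<in> borel_measurable borel" unfolding h_def by simp
  have hs: "(\<integral>\<^sup>+u. h (s, u) \<partial>lborel) \<le> ennreal (e / C)" if "s \<in> {0..l}" for s
    using g(3) strips_all[of h l "ennreal (e / C)"] that by (auto simp: h_def)
  have diff: "ennreal (norm (volt q (prim b) f p - volt q (prim b) g p)) \<le> voltn q (prim b) h p" for p
    unfolding h_def by (intro norm_volt_diff_le vbc(1)) simp_all
  have line: "(\<integral>\<^sup>+s. indicator {0..x} s * (ennreal (norm (q s)) * (\<integral>\<^sup>+u. h (s, u) \<partial>lborel)) \<partial>lborel)
      \<le> ennreal ((LBINT s. norm (q s)) * (e / C))" if "x \<le> l" for x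
  proof -
    have "(\<integral>\<^sup>+s. indicator {0..x} s * (ennreal (norm (q s)) * (\<integral>\<^sup>+u. h (s, u) \<partial>lborel)) \<partial>lborel)
       \<le> (\<integral>\<^sup>+s. ennreal (norm (q s)) * ennreal (e / C) \<partial>lborel)"
      using hs that by (intro nn_integral_mono) (auto simp: indicator_def intro!: mult_left_mono)
    also have "\<dots> = (\<integral>\<^sup>+s. norm (q s) \<partial>lborel) * ennreal (e / C)"
      by (rule nn_integral_multc) simp
    also have "\<dots> = ennreal ((LBINT s. norm (q s)) * (e / C))"
      unfolding Q using eC by (intro ennreal_mult[symmetric]) simp_all
    finally show ?thesis .
  qed
  have bound: "t * (LBINT s. norm (q s)) * (e / C) \<le> e" if "0 \<le> t" "t \<le> 1 + 1 / \<theta>" for t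
  proof -
    have "t * (LBINT s. norm (q s)) \<le> C"
      using mult_right_mono[OF that(2) Q0] unfolding C_def by simp
    then have "t * (LBINT s. norm (q s)) * (e / C) \<le> C * (e / C)"
      using eC by (intro mult_right_mono) simp_all
    then show ?thesis using C by simp
  qed
  have "(\<forall>M\<in>strips l. (\<integral>\<^sup>+p. voltn q (prim b) h p \<partial>M) \<le> ennreal e)"
  proof (subst strips_all, goal_cases)
    case 1
    show ?case unfolding voltn_def[abs_def] by measurable
  next
    case 2
    have "(\<integral>\<^sup>+u. voltn q (prim b) h (x, u) \<partial>lborel) \<le> ennreal e" if "x \<in> {0..l}" for x
    proof -
      have "(\<integral>\<^sup>+u. voltn q (prim b) h (x, u) \<partial>lborel) \<le> ennreal ((LBINT s. norm (q s)) * (e / C))"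
        using that line by (simp add: voltn_vertical)
      also have "\<dots> \<le> ennreal e"
        using bound[of 1] pos by (intro ennreal_leI) simp
      finally show ?thesis .
    qed
    moreover have "(\<integral>\<^sup>+x. indicator {0..l} x * voltn q (prim b) h (x, u) \<partial>lborel) \<le> ennreal e" for u
    proof -
      have "(\<integral>\<^sup>+x. indicator {0..l} x * voltn q (prim b) h (x, u) \<partial>lborel)
        \<le> ennreal (1 / \<theta>) * ennreal ((LBINT s. norm (q s)) * (e / C))"
        by (rule order_trans[OF voltn_horizontal[OF b] mult_left_mono[OF line]]) simp_all
      also have "\<dots> = ennreal (1 / \<theta> * (LBINT s. norm (q s)) * (e / C))"
        unfolding mult.assoc using pos by (intro ennreal_mult'[symmetric]) simp
      also have "\<dots> \<le> ennreal e"
        using bound[of "1 / \<theta>"] pos by (intro ennreal_leI) simp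
      finally show ?thesis .
    qed
    ultimately show ?case by blast
  qed
  then have "\<forall>M\<in>strips l. (\<integral>\<^sup>+p. norm (volt q (prim b) f p - volt q (prim b) g p) \<partial>M) \<le> ennreal e"
    using diff by (meson nn_integral_mono order_trans)
  then show "\<exists>g. continuous_on UNIV g \<and> bounded (range g) \<and>
      (\<forall>M\<in>strips l. (\<integral>\<^sup>+p. norm (volt q (prim b) f p - g p) \<partial>M) \<le> ennreal e)"
    using vbc(2,3) by blast
qed

lemma volt_vertical:
  assumes [measurable]: "q \<in> borel_measurable borel" "R \<in> borel_measurable borel" "f \<in> borel_measurable borel"
    and n: "\<And>s. 0 \<le> s \<Longrightarrow> s \<le> x \<Longrightarrow> (\<integral>\<^sup>+u. norm (f (s, u)) \<partial>lborel) \<le> ennreal (n s)"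
  shows "(\<integral>\<^sup>+u. norm (volt q R f (x, u)) \<partial>lborel)
    \<le> (\<integral>\<^sup>+s. indicator {0..x} s * (ennreal (norm (q s)) * ennreal (n s)) \<partial>lborel)"
proof -
  have "(\<integral>\<^sup>+u. norm (volt q R f (x, u)) \<partial>lborel)
    \<le> (\<integral>\<^sup>+u. voltn q R (\<lambda>p. ennreal (norm (f p))) (x, u) \<partial>lborel)"
    by (intro nn_integral_mono norm_volt_le) simp_all
  also have "\<dots> \<le> (\<integral>\<^sup>+s. indicator {0..x} s * (ennreal (norm (q s)) * ennreal (n s)) \<partial>lborel)"
    by (subst voltn_vertical) (auto intro!: nn_integral_mono indicator_mult_mono n)
  finally show ?thesis .
qed

lemma volt_horizontal:
  assumes b: "speed b \<theta>"
    and [measurable]: "q \<in> borel_measurable borel" "f \<in> borel_measurable borel"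
    and n: "\<And>s. 0 \<le> s \<Longrightarrow> s \<le> l \<Longrightarrow> (\<integral>\<^sup>+u. norm (f (s, u)) \<partial>lborel) \<le> ennreal (n s)"
  shows "(\<integral>\<^sup>+x. indicator {0..l} x * ennreal (norm (volt q (prim b) f (x, u))) \<partial>lborel)
    \<le> ennreal (1 / \<theta>) * (\<integral>\<^sup>+s. indicator {0..l} s * (ennreal (norm (q s)) * ennreal (n s)) \<partial>lborel)"
proof -
  interpret speed b \<theta> by fact
  have "(\<integral>\<^sup>+x. indicator {0..l} x * ennreal (norm (volt q (prim b) f (x, u))) \<partial>lborel)
    \<le> (\<integral>\<^sup>+x. indicator {0..l} x * voltn q (prim b) (\<lambda>p. ennreal (norm (f p))) (x, u) \<partial>lborel)"
    by (intro nn_integral_mono mult_left_mono norm_volt_le) simp_all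
  also have "\<dots> \<le> ennreal (1 / \<theta>) * (\<integral>\<^sup>+s. indicator {0..l} s * (ennreal (norm (q s)) * (\<integral>\<^sup>+u. norm (f (s, u)) \<partial>lborel)) \<partial>lborel)"
    by (rule voltn_horizontal[OF b]) simp_all
  also have "\<dots> \<le> ennreal (1 / \<theta>) * (\<integral>\<^sup>+s. indicator {0..l} s * (ennreal (norm (q s)) * ennreal (n s)) \<partial>lborel)"
    by (auto intro!: mult_left_mono nn_integral_mono indicator_mult_mono n)
  finally show ?thesis .
qed

text \<open>Fubini, then a translation in u. \<phi> stands for e^{i lambda u}, unbounded on the line
  for nonreal lambda; so the bound E is asked for only at those u where f does not vanish somewhere
  on the characteristic.\<close>

lemma volt_moment:
  assumes [measurable]: "q \<in> borel_measurable borel" "R \<in> borel_measurable borel" "f \<in> borel_measurable borel"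
      "\<phi> \<in> borel_measurable borel"
    and fin: "(\<integral>\<^sup>+s. indicator {0..x} s * (ennreal (norm (q s)) * (\<integral>\<^sup>+u. norm (f (s, u)) \<partial>lborel)) \<partial>lborel) < \<infinity>"
    and \<phi>: "\<And>s u. 0 \<le> s \<Longrightarrow> s \<le> x \<Longrightarrow> f (s, u - R x + R s) \<noteq> 0 \<Longrightarrow> norm (\<phi> u) \<le> E"
  shows "(LBINT u. \<phi> u * volt q R f (x, u))
      = (LBINT s:{0..x}. q s * (LBINT u. \<phi> (u + R x - R s) * f (s, u)))"
    and "integrable lborel (\<lambda>u. \<phi> u * volt q R f (x, u))"
proof -
  define G where "G = (\<lambda>u s. indicator {0..x} s *\<^sub>R (\<phi> u * (q s * f (s, u - R x + R s))))"
  have [measurable]: "case_prod G \<in> borel_measurable (lborel \<Otimes>\<^sub>M lborel)"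
  proof -
    have "(\<lambda>(u, s). if 0 \<le> s \<and> s \<le> x then \<phi> u * (q s * f (s, u - R x + R s)) else 0)
        \<in> borel_measurable (lborel \<Otimes>\<^sub>M lborel)" by measurable
    then show ?thesis by (simp add: G_def indicator_scaleR_eq_if)
  qed
  have "(\<integral>\<^sup>+p. norm (case_prod G p) \<partial>(lborel \<Otimes>\<^sub>M lborel)) = (\<integral>\<^sup>+u. \<integral>\<^sup>+s. norm (G u s) \<partial>lborel \<partial>lborel)"
    by (subst lborel.nn_integral_fst[symmetric]) simp_all
  also have "\<dots> \<le> (\<integral>\<^sup>+u. \<integral>\<^sup>+s. ennreal \<bar>E\<bar> * (indicator {0..x} s * (ennreal (norm (q s)) * ennreal (norm (f (s, u - R x + R s))))) \<partial>lborel \<partial>lborel)"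
  proof (intro nn_integral_mono)
    fix u s
    show "ennreal (norm (G u s)) \<le> ennreal \<bar>E\<bar> * (indicator {0..x} s * (ennreal (norm (q s)) * ennreal (norm (f (s, u - R x + R s)))))"
    proof (cases "s \<in> {0..x} \<and> f (s, u - R x + R s) \<noteq> 0")
      case True
      then have "norm (\<phi> u) \<le> \<bar>E\<bar>" using \<phi>[of s u] by auto
      then have "norm (G u s) \<le> \<bar>E\<bar> * (norm (q s) * norm (f (s, u - R x + R s)))"
        using True by (simp add: G_def norm_mult mult_right_mono)
      then show ?thesis using True by (simp add: ennreal_mult[symmetric] ennreal_leI)
    qed (auto simp: G_def)
  qed
  also have "\<dots> = ennreal \<bar>E\<bar> * (\<integral>\<^sup>+u. voltn q R (\<lambda>p. ennreal (norm (f p))) (x, u) \<partial>lborel)"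
    by (simp add: voltn_def nn_integral_cmult)
  also have "\<dots> < \<infinity>"
    using fin by (simp add: voltn_vertical ennreal_mult_less_top)
  finally have int: "integrable (lborel \<Otimes>\<^sub>M lborel) (case_prod G)"
    by (intro integrableI_bounded) simp_all
  have inner: "\<phi> u * volt q R f (x, u) = (LBINT s. G u s)" for u
    by (simp add: volt_def set_lebesgue_integral_def G_def integral_mult_right_zero[symmetric] del: integral_mult_right_zero integral_mult_right)
  have outer: "(LBINT u. G u s) = indicator {0..x} s *\<^sub>R (q s * (LBINT u. \<phi> (u + R x - R s) * f (s, u)))" for s
  proof -
    have "(LBINT u. \<phi> u * (q s * f (s, u - R x + R s))) = (LBINT u. q s * (\<phi> (u + R x - R s) * f (s, u)))"
      using lborel_integral_real_affine[of 1 "\<lambda>u. \<phi> u * (q s * f (s, u - R x + R s))" "R x - R s"]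
      by (simp add: algebra_simps)
    then show ?thesis by (simp add: G_def)
  qed
  have "(LBINT u. LBINT s. G u s) = (LBINT s. LBINT u. G u s)"
    using lborel_pair.Fubini_integral[of G] int by (simp add: case_prod_beta')
  then show "(LBINT u. \<phi> u * volt q R f (x, u))
      = (LBINT s:{0..x}. q s * (LBINT u. \<phi> (u + R x - R s) * f (s, u)))"
    by (simp add: inner outer set_lebesgue_integral_def)
  show "integrable lborel (\<lambda>u. \<phi> u * volt q R f (x, u))"
    using lborel_pair.integrable_fst[OF int] by (simp add: inner)
qed

section \<open>The density created by a single reflection\<close>

context speed
begin

text \<open>The density in u of the image of q(s) ds, restricted to [0, x], under the map s to R x + prim b s.\<close>

definition ray :: "(real \<Rightarrow> complex) \<Rightarrow> (real \<Rightarrow> real) \<Rightarrow> real \<times> real \<Rightarrow> complex" where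
  "ray q R p = (let s = clock (snd p - R (fst p)) in
     if 0 \<le> s \<and> s \<le> fst p then q s / complex_of_real \<bar>b s\<bar> else 0)"

lemma ray_measurable [measurable]:
  assumes [measurable]: "q \<in> borel_measurable borel" "R \<in> borel_measurable borel"
  shows "ray q R \<in> borel_measurable borel"
  unfolding ray_def[abs_def] Let_def by measurable

lemma abs_pos: "0 < \<bar>b x\<bar>"
  using abs_ge[of x] pos by linarith

lemma ray_prim:
  "ray q R (x, prim b s + R x) = indicator {0..x} s *\<^sub>R (q s / complex_of_real \<bar>b s\<bar>)"
  by (simp add: ray_def indicator_def)

text \<open>The weight 1 / |b| in \<open>ray\<close> cancels the Jacobian of u = R x +
  \<open>prim b s\<close>.\<close>

lemma ray_moment:
  fixes \<phi> :: "real \<Rightarrow> complex"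
  assumes [measurable]: "q \<in> borel_measurable borel" "R \<in> borel_measurable borel" "\<phi> \<in> borel_measurable borel"
  shows "(LBINT u. \<phi> u * ray q R (x, u)) = (LBINT s:{0..x}. q s * \<phi> (R x + prim b s))"
proof -
  have pull: "\<bar>b s\<bar> *\<^sub>R (\<phi> (R x + prim b s) * ray q R (x, R x + prim b s))
      = indicator {0..x} s *\<^sub>R (q s * \<phi> (R x + prim b s))" for s
    using abs_pos[of s] ray_prim[of q R x s] by (simp add: add.commute scaleR_conv_of_real)
  have m: "(\<lambda>v. \<phi> (R x + v) * ray q R (x, R x + v)) \<in> borel_measurable borel"
    by measurable
  show "(LBINT u. \<phi> u * ray q R (x, u)) = (LBINT s:{0..x}. q s * \<phi> (R x + prim b s))"
    using lborel_integral_real_affine[of 1 "\<lambda>u. \<phi> u * ray q R (x, u)" "R x"] integral_prim(1)[OF m]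
    by (simp add: pull set_lebesgue_integral_def)
qed

lemma ray_vertical:
  assumes [measurable]: "q \<in> borel_measurable borel" "R \<in> borel_measurable borel"
  shows "(\<integral>\<^sup>+u. norm (ray q R (x, u)) \<partial>lborel) \<le> (\<integral>\<^sup>+s. norm (q s) \<partial>lborel)"
proof -
  have "(\<integral>\<^sup>+u. norm (ray q R (x, u)) \<partial>lborel) = (\<integral>\<^sup>+v. norm (ray q R (x, R x + v)) \<partial>lborel)"
    using nn_integral_real_affine[of "\<lambda>u. ennreal (norm (ray q R (x, u)))" 1 "R x"] by simp
  also have "\<dots> = (\<integral>\<^sup>+s. ennreal \<bar>b s\<bar> * ennreal (norm (ray q R (x, R x + prim b s))) \<partial>lborel)"
    by (rule nn_integral_prim[symmetric]) measurable
  also have "\<dots> \<le> (\<integral>\<^sup>+s. norm (q s) \<partial>lborel)"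
  proof (rule nn_integral_mono)
    fix s
    show "ennreal \<bar>b s\<bar> * ennreal (norm (ray q R (x, R x + prim b s))) \<le> ennreal (norm (q s))"
      using abs_pos[of s] ray_prim[of q R x s]
      by (simp add: add.commute ennreal_mult[symmetric] norm_divide indicator_def)
  qed
  finally show ?thesis .
qed

text \<open>The inverse substitution s = \<open>clock v\<close>, which undoes the weight in
  \<open>ray\<close>.\<close>

lemma nn_integral_clock:
  assumes [measurable]: "f \<in> borel_measurable borel"
  shows "(\<integral>\<^sup>+v. f (clock v) / ennreal \<bar>b (clock v)\<bar> \<partial>lborel) = (\<integral>\<^sup>+s. f s \<partial>lborel)"
proof -
  have "(\<integral>\<^sup>+v. f (clock v) / ennreal \<bar>b (clock v)\<bar> \<partial>lborel)
      = (\<integral>\<^sup>+s. ennreal \<bar>b s\<bar> * (f (clock (prim b s)) / ennreal \<bar>b (clock (prim b s))\<bar>) \<partial>lborel)"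
    by (rule nn_integral_prim[symmetric]) measurable
  also have "\<dots> = (\<integral>\<^sup>+s. f s \<partial>lborel)"
  proof (rule nn_integral_cong)
    fix s
    have "ennreal \<bar>b s\<bar> \<noteq> 0" using abs_pos[of s] by (metis ennreal_eq_0_iff not_less)
    then show "ennreal \<bar>b s\<bar> * (f (clock (prim b s)) / ennreal \<bar>b (clock (prim b s))\<bar>) = f s"
      by (simp add: ennreal_times_divide mult.commute[of "ennreal \<bar>b s\<bar>"] ennreal_mult_divide_eq)
  qed
  finally show ?thesis .
qed

end

lemma (in speed) nn_integral_shift_prim_le:
  assumes [measurable]: "k \<in> borel_measurable borel"
  shows "(\<integral>\<^sup>+x. k (u - prim b x) \<partial>lborel) \<le> ennreal (1 / \<theta>) * (\<integral>\<^sup>+v. k v \<partial>lborel)"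
  using nn_integral_prim_le[of "\<lambda>w. k (u - w)"] nn_integral_real_affine[of k "-1" u] by simp

text \<open>The ramp t / \<delta> clipped to [0, 1] agrees with the indicator of t \<ge> 0 outside
  [-\<delta>, \<delta>]. So the continuous replacement of the cut-off errs only near its two edges,
  and there by at most 1.\<close>

lemma clip_error:
  fixes a b \<delta> :: real
  assumes "0 < \<delta>"
  shows "\<bar>of_bool (0 \<le> a \<and> 0 \<le> b) - max 0 (min 1 (a / \<delta>)) * max 0 (min 1 (b / \<delta>))\<bar>
    \<le> of_bool (\<bar>a\<bar> \<le> \<delta>) + of_bool (\<bar>b\<bar> \<le> \<delta>)"
proof -
  define c where "c = (\<lambda>t::real. max 0 (min 1 (t / \<delta>)))"
  have c: "0 \<le> c t" "c t \<le> 1" "\<delta> < t \<Longrightarrow> c t = 1" "t < - \<delta> \<Longrightarrow> c t = 0" for t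
  proof -
    show "0 \<le> c t" "c t \<le> 1" by (simp_all add: c_def)
    show "\<delta> < t \<Longrightarrow> c t = 1" using assms by (simp add: c_def)
    assume "t < - \<delta>"
    then have "t / \<delta> \<le> 0" using assms by (simp add: divide_le_0_iff)
    then show "c t = 0" by (simp add: c_def)
  qed
  have m: "0 \<le> c a * c b" "c a * c b \<le> 1"
    using c(1,2)[of a] c(1,2)[of b] by (simp_all add: mult_le_one)
  show ?thesis
  proof (cases "\<bar>a\<bar> \<le> \<delta> \<or> \<bar>b\<bar> \<le> \<delta>")
    case True
    have "\<bar>of_bool (0 \<le> a \<and> 0 \<le> b) - c a * c b\<bar> \<le> 1"
      using m by (cases "0 \<le> a \<and> 0 \<le> b") simp_all
    moreover have "1 \<le> of_bool (\<bar>a\<bar> \<le> \<delta>) + (of_bool (\<bar>b\<bar> \<le> \<delta>) :: real)"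
      using True by (elim disjE) simp_all
    ultimately show ?thesis unfolding c_def by (rule order_trans)
  next
    case False
    then have "(\<delta> < a \<or> a < - \<delta>) \<and> (\<delta> < b \<or> b < - \<delta>)" by auto
    then have "of_bool (0 \<le> a \<and> 0 \<le> b) = c a * c b"
      using assms c(3,4)[of a] c(3,4)[of b] by auto
    then show ?thesis by (simp add: c_def)
  qed
qed

lemma nn_integral_near:
  fixes a \<delta> :: real
  assumes "0 \<le> \<delta>"
  shows "(\<integral>\<^sup>+u. ennreal (of_bool (\<bar>u - a\<bar> \<le> \<delta>)) \<partial>lborel) = ennreal (2 * \<delta>)"
proof -
  have "ennreal (of_bool (\<bar>u - a\<bar> \<le> \<delta>)) = indicator {a - \<delta>..a + \<delta>} u" for u
    by (auto simp: indicator_def)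
  then show ?thesis using assms by simp
qed

text \<open>On a horizontal line the zone near an edge is a zone in x, which the edge crosses with
  speed at least \<theta>.\<close>

lemma (in speed) nn_integral_near_prim:
  assumes "0 \<le> \<delta>"
  shows "(\<integral>\<^sup>+x. ennreal (of_bool (\<bar>u - prim b x\<bar> \<le> \<delta>)) \<partial>lborel) \<le> ennreal (1 / \<theta> * (2 * \<delta>))"
proof -
  have "(\<integral>\<^sup>+x. ennreal (of_bool (\<bar>u - prim b x\<bar> \<le> \<delta>)) \<partial>lborel)
    \<le> ennreal (1 / \<theta>) * (\<integral>\<^sup>+v. ennreal (of_bool (\<bar>v\<bar> \<le> \<delta>)) \<partial>lborel)"
    by (rule nn_integral_shift_prim_le[of "\<lambda>v. ennreal (of_bool (\<bar>v\<bar> \<le> \<delta>))"]) measurable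
  also have "\<dots> = ennreal (1 / \<theta> * (2 * \<delta>))"
    using nn_integral_near[OF assms, of 0] pos assms by (simp only: diff_0_right) (intro ennreal_mult'[symmetric], simp)
  finally show ?thesis .
qed

context speed
begin

text \<open>In the coordinate u the condition 0 \<le> s \<le> x says that u lies between the curves
  R x and R x + \<open>prim b x\<close>. For a difference of two speeds these are characteristics,
  along which the indicator can be smoothed.\<close>

lemma ray_eq:
  "ray q R (x, u) = (q (clock (u - R x)) / complex_of_real \<bar>b (clock (u - R x))\<bar>) *
     of_real (of_bool (0 \<le> direction * (u - R x) \<and> 0 \<le> direction * (R x + prim b x - u)))"
proof -
  have "0 \<le> clock (u - R x) \<longleftrightarrow> 0 \<le> direction * (u - R x)"
    using le_iff[of 0 "clock (u - R x)"] by simp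
  moreover have "clock (u - R x) \<le> x \<longleftrightarrow> 0 \<le> direction * (R x + prim b x - u)"
    using le_iff[of "clock (u - R x)" x] by (simp add: algebra_simps)
  ultimately show ?thesis by (simp add: ray_def Let_def)
qed

text \<open>For fixed u the argument u - \<open>prim a x\<close> of the profile sweeps the line with
  speed at least \<theta>'; the quotient by |b| is then undone by the substitution with
  \<open>clock\<close>.\<close>

lemma ray_horizontal:
  assumes a: "speed a \<theta>'" and [measurable]: "q \<in> borel_measurable borel"
  shows "(\<integral>\<^sup>+x. indicator {0..l} x * ennreal (norm (ray q (prim a) (x, u))) \<partial>lborel)
    \<le> ennreal (1 / \<theta>') * (\<integral>\<^sup>+s. norm (q s) \<partial>lborel)"
proof -
  interpret a: speed a \<theta>' by fact
  have "(\<integral>\<^sup>+x. indicator {0..l} x * ennreal (norm (ray q (prim a) (x, u))) \<partial>lborel)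
    \<le> (\<integral>\<^sup>+x. ennreal (norm (q (clock (u - prim a x)))) / ennreal \<bar>b (clock (u - prim a x))\<bar> \<partial>lborel)"
    using abs_pos
    by (intro nn_integral_mono) (auto simp: ray_eq norm_divide divide_ennreal indicator_def)
  also have "\<dots> \<le> ennreal (1 / \<theta>') * (\<integral>\<^sup>+v. ennreal (norm (q (clock v))) / ennreal \<bar>b (clock v)\<bar> \<partial>lborel)"
    by (rule a.nn_integral_shift_prim_le[of "\<lambda>v. ennreal (norm (q (clock v))) / ennreal \<bar>b (clock v)\<bar>"]) measurable
  also have "(\<integral>\<^sup>+v. ennreal (norm (q (clock v))) / ennreal \<bar>b (clock v)\<bar> \<partial>lborel) = (\<integral>\<^sup>+s. norm (q s) \<partial>lborel)"
    by (rule nn_integral_clock[of "\<lambda>s. ennreal (norm (q s))"]) measurable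
  finally show ?thesis .
qed

text \<open>\<open>ray\<close> is a profile q / |b| in the variable v = u - \<open>prim a x\<close>,
  cut off at the edges \<open>prim a\<close> and \<open>prim c\<close>. The profile is replaced by a
  continuous function, the cut-off by ramps. Both edges move with speed at least \<theta>', so the
  zones around them are thin on vertical and on horizontal lines.\<close>

lemma approximable_ray:
  assumes a: "speed a \<theta>'" and c: "speed c \<theta>'" and ac: "\<And>x. prim c x = prim a x + prim b x"
    and q: "integrable lborel q"
  shows "approximable l (ray q (prim a))"
  unfolding approximable_def
proof (intro conjI allI impI)
  interpret a: speed a \<theta>' by fact
  interpret c: speed c \<theta>' by fact
  have [measurable]: "q \<in> borel_measurable borel"
    using q by (simp add: borel_measurable_integrable)
  show ray_m: "ray q (prim a) \<in> borel_measurable borel" by measurable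
  fix e :: real assume e: "0 < e"
  \<comment> \<open>W bounds the cost of both directions: 1 on vertical lines, 1 / \<theta>' on
    horizontal ones.\<close>
  define W where "W = 1 + 1 / \<theta>'"
  have W: "1 \<le> W" "1 / \<theta>' \<le> W" using a.pos by (simp_all add: W_def)
  define h where "h = (\<lambda>v. q (clock v) / complex_of_real \<bar>b (clock v)\<bar>)"
  have h_m [measurable]: "h \<in> borel_measurable borel" unfolding h_def by measurable
  have "\<bar>b s\<bar> *\<^sub>R h (prim b s) = q s" for s
    using abs_pos[of s] by (simp add: h_def scaleR_conv_of_real)
  then have "integrable lborel h"
    using integral_prim(2)[OF h_m] q by simp
  moreover have eW: "0 < e / (2 * W)" using e W by simp
  ultimately obtain h' where h': "continuous_on UNIV h'" "bounded (range h')"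
    "(\<integral>\<^sup>+v. norm (h v - h' v) \<partial>lborel) \<le> ennreal (e / (2 * W))"
    using L1_approx_continuous by blast
  have h'_m [measurable]: "h' \<in> borel_measurable borel"
    using h' by (simp add: borel_measurable_continuous_onI)
  obtain B where B: "0 < B" "\<And>v. norm (h' v) \<le> B"
    using h'(2) by (auto simp: bounded_pos)
  \<comment> \<open>The profile takes e / 2 of the error. Each of the two edge zones has length at
    most 2 \<delta> W on a line and carries an error of at most B; together they take 4 B \<delta> W
    = e / 2.\<close>
  define \<delta> where "\<delta> = e / (8 * B * W)"
  have \<delta>: "0 < \<delta>" using e B W by (simp add: \<delta>_def)
  define clip where "clip = (\<lambda>t::real. max 0 (min 1 (t / \<delta>)))"
  define \<eta> where "\<eta> = (\<lambda>p. clip (direction * (snd p - prim a (fst p))) * clip (direction * (prim c (fst p) - snd p)))"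
  define g where "g = (\<lambda>p. h' (snd p - prim a (fst p)) * complex_of_real (\<eta> p))"
  have cont_a: "continuous_on UNIV (\<lambda>p::real \<times> real. prim a (fst p))"
    by (rule continuous_on_compose2[OF a.cont[of UNIV]]) (auto intro: continuous_intros)
  have cont_c: "continuous_on UNIV (\<lambda>p::real \<times> real. prim c (fst p))"
    by (rule continuous_on_compose2[OF c.cont[of UNIV]]) (auto intro: continuous_intros)
  have "continuous_on UNIV \<eta>"
    unfolding \<eta>_def clip_def using \<delta> by (intro continuous_intros cont_a cont_c) simp_all
  moreover have "continuous_on UNIV (\<lambda>p::real \<times> real. h' (snd p - prim a (fst p)))"
    by (rule continuous_on_compose2[OF h'(1) continuous_on_diff[OF continuous_on_snd[OF continuous_on_id] cont_a]]) simp
  ultimately have g_cont: "continuous_on UNIV g"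
    unfolding g_def by (intro continuous_intros)
  then have [measurable]: "g \<in> borel_measurable borel"
    by (rule borel_measurable_continuous_onI)
  have clip: "0 \<le> clip t" "clip t \<le> 1" for t by (simp_all add: clip_def)
  have \<eta>: "0 \<le> \<eta> p" "\<eta> p \<le> 1" for p
    using clip by (simp_all add: \<eta>_def mult_le_one)
  have "norm (g p) \<le> B" for p
    using mult_mono[OF B(2)[of "snd p - prim a (fst p)"] \<eta>(2)[of p]] \<eta>(1)[of p] B(1) by (simp add: g_def norm_mult)
  then have g_bdd: "bounded (range g)" by (intro boundedI) auto
  define near where "near = (\<lambda>x u. of_bool (\<bar>u - prim a x\<bar> \<le> \<delta>) + (of_bool (\<bar>u - prim c x\<bar> \<le> \<delta>) :: real))"
  have ptw: "norm (ray q (prim a) (x, u) - g (x, u)) \<le> norm (h (u - prim a x) - h' (u - prim a x)) + B * near x u" for x u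
  proof -
    define v where "v = u - prim a x"
    define J where "J = (of_bool (0 \<le> direction * v \<and> 0 \<le> direction * (prim c x - u)) :: real)"
    have J: "0 \<le> J" "J \<le> 1" by (simp_all add: J_def)
    have "\<bar>J - \<eta> (x, u)\<bar> \<le> of_bool (\<bar>direction * v\<bar> \<le> \<delta>) + of_bool (\<bar>direction * (prim c x - u)\<bar> \<le> \<delta>)"
      unfolding J_def \<eta>_def clip_def v_def fst_conv snd_conv by (rule clip_error[OF \<delta>])
    also have "\<dots> = near x u"
    proof -
      have "\<bar>direction * t\<bar> = \<bar>t\<bar>" for t by (simp add: direction_def abs_mult)
      then show ?thesis by (simp only: near_def v_def abs_minus_commute[of "prim c x"])
    qed
    finally have J\<eta>: "\<bar>J - \<eta> (x, u)\<bar> \<le> near x u" .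
    have "ray q (prim a) (x, u) = h v * of_real J"
      by (simp add: ray_eq h_def v_def J_def ac)
    then have "ray q (prim a) (x, u) - g (x, u) = (h v - h' v) * of_real J + h' v * of_real (J - \<eta> (x, u))"
      by (simp add: g_def v_def algebra_simps)
    then have "norm (ray q (prim a) (x, u) - g (x, u)) \<le> norm (h v - h' v) * J + norm (h' v) * \<bar>J - \<eta> (x, u)\<bar>"
      using J(1) norm_triangle_ineq[of "(h v - h' v) * of_real J" "h' v * of_real (J - \<eta> (x, u))"]
      by (simp add: norm_mult del: of_real_diff)
    also have "\<dots> \<le> norm (h v - h' v) * 1 + B * near x u"
      using J J\<eta> B by (intro add_mono mult_mono) auto
    finally show ?thesis by (simp add: v_def)
  qed
  let ?gap = "\<lambda>v. ennreal (norm (h v - h' v))"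
  let ?edge = "\<lambda>a x u. ennreal (of_bool (\<bar>u - prim a x\<bar> \<le> \<delta>))"
  \<comment> \<open>t is the cost of the direction, 1 or 1 / \<theta>'.\<close>
  have total: "ennreal t * ennreal (e / (2 * W)) + ennreal B * (ennreal (t * (2 * \<delta>)) + ennreal (t * (2 * \<delta>))) \<le> ennreal e"
    if t: "0 \<le> t" "t \<le> W" for t
  proof -
    have "ennreal t * ennreal (e / (2 * W)) + ennreal B * (ennreal (t * (2 * \<delta>)) + ennreal (t * (2 * \<delta>)))
       = ennreal (t * (e / (2 * W)) + B * (t * (2 * \<delta>) + t * (2 * \<delta>)))"
    proof -
      have "ennreal (X * Y + B * (Z + Z)) = ennreal X * ennreal Y + ennreal B * (ennreal Z + ennreal Z)"
        if "0 \<le> X" "0 \<le> Y" "0 \<le> Z" for X Y Z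
        using that B(1)
        by (simp only: ennreal_plus ennreal_mult mult_nonneg_nonneg add_nonneg_nonneg less_imp_le)
      from this[of t "e / (2 * W)" "t * (2 * \<delta>)"] show ?thesis
        using t eW \<delta> by (simp del: times_divide_eq_right)
    qed
    also have "t * (e / (2 * W)) + B * (t * (2 * \<delta>) + t * (2 * \<delta>)) = t * (e / W)"
      using B(1) W by (simp add: \<delta>_def field_simps)
    also have "t * (e / W) \<le> W * (e / W)"
      using t e W by (intro mult_right_mono) simp_all
    also have "W * (e / W) = e" using W by simp
    finally show ?thesis by (simp add: ennreal_leI)
  qed
  have "(\<forall>M\<in>strips l. (\<integral>\<^sup>+p. norm (ray q (prim a) p - g p) \<partial>M) \<le> ennreal e)"
  proof (subst strips_all, goal_cases)
    case 1
    show ?case using ray_m by measurable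
  next
    case 2
    have "(\<integral>\<^sup>+u. norm (ray q (prim a) (x, u) - g (x, u)) \<partial>lborel) \<le> ennreal e" for x
    proof -
      have "(\<integral>\<^sup>+u. norm (ray q (prim a) (x, u) - g (x, u)) \<partial>lborel)
        \<le> (\<integral>\<^sup>+u. ?gap (u - prim a x) + ennreal B * (?edge a x u + ?edge c x u) \<partial>lborel)"
        using ptw B(1)
        by (intro nn_integral_mono)
          (simp add: near_def ennreal_mult[symmetric] ennreal_plus[symmetric] ennreal_leI del: ennreal_plus)
      also have "\<dots> = (\<integral>\<^sup>+u. ?gap (u - prim a x) \<partial>lborel) + ennreal B *
              ((\<integral>\<^sup>+u. ?edge a x u \<partial>lborel) + (\<integral>\<^sup>+u. ?edge c x u \<partial>lborel))"
        by (simp add: nn_integral_add nn_integral_cmult)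
      also have "(\<integral>\<^sup>+u. ?gap (u - prim a x) \<partial>lborel) = (\<integral>\<^sup>+v. norm (h v - h' v) \<partial>lborel)"
        using nn_integral_real_affine[of "\<lambda>v. ennreal (norm (h v - h' v))" 1 "- prim a x"] by simp
      also have "(\<integral>\<^sup>+v. norm (h v - h' v) \<partial>lborel) + ennreal B *
              ((\<integral>\<^sup>+u. ?edge a x u \<partial>lborel) + (\<integral>\<^sup>+u. ?edge c x u \<partial>lborel))
          \<le> ennreal 1 * ennreal (e / (2 * W)) + ennreal B * (ennreal (1 * (2 * \<delta>)) + ennreal (1 * (2 * \<delta>)))"
        using h'(3) \<delta> by (simp only: nn_integral_near[OF less_imp_le[OF \<delta>]] ennreal_1 mult_1 add_right_mono)
      also have "\<dots> \<le> ennreal e" by (rule total) (use W in simp_all)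
      finally show ?thesis .
    qed
    moreover have "(\<integral>\<^sup>+x. indicator {0..l} x * ennreal (norm (ray q (prim a) (x, u) - g (x, u))) \<partial>lborel) \<le> ennreal e" for u
    proof -
      have "(\<integral>\<^sup>+x. indicator {0..l} x * ennreal (norm (ray q (prim a) (x, u) - g (x, u))) \<partial>lborel)
        \<le> (\<integral>\<^sup>+x. ennreal (norm (ray q (prim a) (x, u) - g (x, u))) \<partial>lborel)"
        by (intro nn_integral_mono) (simp add: indicator_def)
      also have "\<dots>
        \<le> (\<integral>\<^sup>+x. ?gap (u - prim a x) + ennreal B * (?edge a x u + ?edge c x u) \<partial>lborel)"
        using ptw B(1)
        by (intro nn_integral_mono)
          (simp add: near_def ennreal_mult[symmetric] ennreal_plus[symmetric] ennreal_leI del: ennreal_plus)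
      also have "\<dots> = (\<integral>\<^sup>+x. ?gap (u - prim a x) \<partial>lborel) + ennreal B *
              ((\<integral>\<^sup>+x. ?edge a x u \<partial>lborel) + (\<integral>\<^sup>+x. ?edge c x u \<partial>lborel))"
        by (simp add: nn_integral_add nn_integral_cmult)
      also have "\<dots> \<le> ennreal (1 / \<theta>') * ennreal (e / (2 * W)) + ennreal B * (ennreal (1 / \<theta>' * (2 * \<delta>)) + ennreal (1 / \<theta>' * (2 * \<delta>)))"
      proof (intro add_mono mult_left_mono)
        have "(\<integral>\<^sup>+x. ?gap (u - prim a x) \<partial>lborel)
            \<le> ennreal (1 / \<theta>') * (\<integral>\<^sup>+v. norm (h v - h' v) \<partial>lborel)"
          by (rule a.nn_integral_shift_prim_le[of "\<lambda>v. ennreal (norm (h v - h' v))"]) measurable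
        also have "\<dots> \<le> ennreal (1 / \<theta>') * ennreal (e / (2 * W))"
          using h'(3) by (rule mult_left_mono) simp
        finally show "(\<integral>\<^sup>+x. ?gap (u - prim a x) \<partial>lborel)
            \<le> ennreal (1 / \<theta>') * ennreal (e / (2 * W))" .
      qed (use \<delta> in \<open>simp_all add: a.nn_integral_near_prim c.nn_integral_near_prim del: times_divide_eq_left\<close>)
      also have "\<dots> \<le> ennreal e" by (rule total) (use W a.pos in simp_all)
      finally show ?thesis .
    qed
    ultimately show ?case by blast
  qed
  then show "\<exists>g. continuous_on UNIV g \<and> bounded (range g) \<and>
      (\<forall>M\<in>strips l. (\<integral>\<^sup>+p. norm (ray q (prim a) p - g p) \<partial>M) \<le> ennreal e)"
    using g_cont g_bdd by blast
qed

end

section \<open>Picard iteration of densities\<close>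

text \<open>Substituting u = \<open>prim b s\<close> leaves the integral of u^N / N!. Repeated use
  of this rule is the source of the factorials.\<close>

lemma (in speed) nn_integral_power_prim:
  assumes lower: "\<forall>x. \<theta> \<le> b x" and x: "0 \<le> x" and c: "0 \<le> c"
  shows "(\<integral>\<^sup>+s. indicator {0..x} s * (ennreal (b s) * ennreal (c * (prim b s ^ N / fact N))) \<partial>lborel)
    = ennreal (c * (prim b x ^ Suc N / fact (Suc N)))"
proof -
  have mono: "prim b s \<le> prim b t \<longleftrightarrow> s \<le> t" for s t
    using le_iff[of s t] lower by (simp add: direction_def)
  have b: "\<bar>b s\<bar> = b s" for s using abs_eq[of s] lower by (simp add: direction_def)
  have y: "0 \<le> prim b x" using mono[of 0 x] x by simp
  have "(\<integral>\<^sup>+s. indicator {0..x} s * (ennreal (b s) * ennreal (c * (prim b s ^ N / fact N))) \<partial>lborel)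
      = (\<integral>\<^sup>+s. ennreal \<bar>b s\<bar> * (ennreal (c * (prim b s ^ N / fact N)) * indicator {0..prim b x} (prim b s)) \<partial>lborel)"
    using mono[of 0] mono[of _ x] by (intro nn_integral_cong) (simp add: b indicator_def)
  also have "\<dots> = (\<integral>\<^sup>+u. ennreal (c * (u ^ N / fact N)) * indicator {0..prim b x} u \<partial>lborel)"
    by (rule nn_integral_prim[of "\<lambda>u. ennreal (c * (u ^ N / fact N)) * indicator {0..prim b x} u"]) simp
  also have "\<dots> = ennreal (c * (prim b x ^ Suc N / fact (Suc N)) - c * (0 ^ Suc N / fact (Suc N)))"
  proof (rule nn_integral_FTC_Icc)
    show "(\<lambda>u. c * (u ^ N / fact N)) \<in> borel_measurable borel" by simp
    show "0 \<le> prim b x" by (rule y)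
  next
    fix u :: real assume "u \<in> {0..prim b x}"
    then show "0 \<le> c * (u ^ N / fact N)" using c by simp
    have "((\<lambda>u. c * (u ^ Suc N / fact (Suc N))) has_real_derivative c * (of_nat (Suc N) * u ^ N / fact (Suc N))) (at u)"
      using DERIV_pow[of "Suc N" u] by (intro DERIV_cmult DERIV_cdivide) simp
    moreover have "of_nat (Suc N) * u ^ N / fact (Suc N) = u ^ N / fact N"
      by (simp add: fact_Suc del: of_nat_Suc)
    ultimately show "((\<lambda>u. c * (u ^ Suc N / fact (Suc N))) has_real_derivative c * (u ^ N / fact N)) (at u)"
      by simp
  qed
  finally show ?thesis by simp
qed

abbreviation wave :: "complex \<Rightarrow> real \<Rightarrow> complex" where
  "wave lam u \<equiv> exp (\<i> * lam * complex_of_real u)"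

text \<open>One column of the matrix problem, with initial vector \<open>a\<close>. The block
  structure is condensed into \<open>sep\<close>: components of one block are uncoupled, components
  of different blocks have speeds at least \<theta> apart.\<close>

locale transport =
  fixes n :: nat and l \<theta> :: real and b :: "nat \<Rightarrow> real \<Rightarrow> real"
    and q :: "nat \<Rightarrow> nat \<Rightarrow> real \<Rightarrow> complex" and lo up :: "real \<Rightarrow> real"
    and a :: "nat \<Rightarrow> complex"
  assumes l_pos: "0 < l" and \<theta>_pos: "0 < \<theta>"
    and speed_b: "\<And>i. i < n \<Longrightarrow> speed (b i) \<theta>"
    and q_int: "\<And>i k. i < n \<Longrightarrow> k < n \<Longrightarrow> integrable lborel (q i k)"
    and sep: "\<And>i k. i < n \<Longrightarrow> k < n \<Longrightarrow> (\<forall>x. q i k x = 0) \<or> speed (\<lambda>x. b k x - b i x) \<theta>"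
    \<comment> \<open>lo and up bound the cone swept by broken characteristics issuing from (0, 0)\<close>
    and cone_0: "lo 0 = 0" "up 0 = 0"
    and cone_mono: "\<And>x y. 0 \<le> x \<Longrightarrow> x \<le> y \<Longrightarrow> up x \<le> up y" "\<And>x y. 0 \<le> x \<Longrightarrow> x \<le> y \<Longrightarrow> lo y \<le> lo x"
    and cone: "\<And>i x y. i < n \<Longrightarrow> 0 \<le> x \<Longrightarrow> x \<le> y \<Longrightarrow> prim (b i) y - prim (b i) x \<le> up y - up x"
      "\<And>i x y. i < n \<Longrightarrow> 0 \<le> x \<Longrightarrow> x \<le> y \<Longrightarrow> lo y - lo x \<le> prim (b i) y - prim (b i) x"
begin

abbreviation R :: "nat \<Rightarrow> real \<Rightarrow> real" where "R i \<equiv> prim (b i)"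

text \<open>The summand 1 makes \<open>weight\<close> a speed even where all coefficients vanish, so
  that \<open>age\<close> is an invertible clock and \<open>nn_integral_power_prim\<close> applies
  to it.\<close>

definition weight :: "real \<Rightarrow> real" where
  "weight x = 1 + (\<Sum>i<n. \<Sum>k<n. norm (q i k x))"

abbreviation age :: "real \<Rightarrow> real" where "age \<equiv> prim weight"

text \<open>The density that the unit wave of component k creates in component i. Where the coupling
  vanishes the two speeds may coincide and \<open>ray\<close> would have no meaning, hence the case
  distinction.\<close>

definition kick :: "nat \<Rightarrow> nat \<Rightarrow> real \<times> real \<Rightarrow> complex" where
  "kick i k = (if \<forall>x. q i k x = 0 then (\<lambda>_. 0) else speed.ray (\<lambda>x. b k x - b i x) (q i k) (R i))"

text \<open>The zeroth Picard iterate consists of delta masses and has no density, so the count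
  starts one later: \<open>level N\<close> belongs to \<open>iter lam (Suc N)\<close>.\<close>

primrec level :: "nat \<Rightarrow> nat \<Rightarrow> real \<times> real \<Rightarrow> complex" where
  "level 0 i = (\<lambda>p. - (\<Sum>k<n. a k * kick i k p))"
| "level (Suc N) i = (\<lambda>p. - (\<Sum>k<n. volt (q i k) (R i) (level N k) p))"

definition density :: "nat \<Rightarrow> real \<times> real \<Rightarrow> complex" where
  "density i p = (\<Sum>N. level N i p)"

text \<open>The term with lambda B is solved exactly by an exponential; only the coupling Q is left
  to be iterated.\<close>

definition duhamel :: "complex \<Rightarrow> nat \<Rightarrow> nat \<Rightarrow> (real \<Rightarrow> complex) \<Rightarrow> real \<Rightarrow> complex" where
  "duhamel lam i k y x = (LBINT s:{0..x}. q i k s * (wave lam (R i x - R i s) * y s))"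

primrec iter :: "complex \<Rightarrow> nat \<Rightarrow> nat \<Rightarrow> real \<Rightarrow> complex" where
  "iter lam 0 i = (\<lambda>x. wave lam (R i x) * a i)"
| "iter lam (Suc N) i = (\<lambda>x. - (\<Sum>k<n. duhamel lam i k (iter lam N k) x))"

text \<open>A bound for |u| in the cone up to time l, and thereby for e^{i lambda u} on it.\<close>

definition reach :: real where "reach = max (up l) (- lo l)"

section \<open>Bounds, approximability and support of the levels\<close>

lemma q_measurable [measurable]: "i < n \<Longrightarrow> k < n \<Longrightarrow> q i k \<in> borel_measurable borel"
  using q_int by (simp add: borel_measurable_integrable)

lemma R_measurable [measurable]: "i < n \<Longrightarrow> R i \<in> borel_measurable borel"
  by (rule speed.prim_measurable[OF speed_b])

lemma speed_weight: "speed weight 1"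
proof
  have "weight \<in> borel_measurable borel"
    unfolding weight_def[abs_def] by (intro borel_measurable_add borel_measurable_sum borel_measurable_norm) auto
  then show "weight \<in> borel_measurable borel" .
  show "set_integrable lborel {x..y} weight" for x y
  proof -
    have "integrable lborel (\<lambda>s. \<Sum>i<n. \<Sum>k<n. norm (q i k s))"
      using q_int by (intro Bochner_Integration.integrable_sum) auto
    then have "set_integrable lborel {x..y} (\<lambda>s. \<Sum>i<n. \<Sum>k<n. norm (q i k s))"
      unfolding set_integrable_def by (rule integrable_mult_indicator[rotated]) simp
    moreover have "set_integrable lborel {x..y} (\<lambda>_. 1 :: real)"
      using integrable_real_indicator[of "{x..y}" lborel] by (simp add: set_integrable_def emeasure_lborel_Icc_eq)
    ultimately show ?thesis unfolding weight_def[abs_def] by (intro set_integral_add)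
  qed
  have "1 \<le> weight x" for x
    unfolding weight_def by (simp add: sum_nonneg)
  then show "(\<forall>x. 1 \<le> weight x) \<or> (\<forall>x. weight x \<le> - 1)" by blast
qed simp

sublocale weight: speed weight 1
  by (rule speed_weight)

lemma weight_ge: "\<forall>x. 1 \<le> weight x"
  unfolding weight_def by (simp add: sum_nonneg)

lemma age_mono: "x \<le> y \<Longrightarrow> age x \<le> age y"
  using weight.increase[OF weight_ge, of x y] by simp

lemma age_nonneg: "0 \<le> x \<Longrightarrow> 0 \<le> age x"
  using age_mono[of 0 x] by simp

lemma sum_le_weight:
  assumes "i < n"
  shows "(\<Sum>k<n. norm (q i k s)) \<le> weight s"
proof -
  have "(\<Sum>k<n. norm (q i k s)) \<le> (\<Sum>i<n. \<Sum>k<n. norm (q i k s))"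
    using assms by (intro member_le_sum[of i "{..<n}" "\<lambda>i. \<Sum>k<n. norm (q i k s)"]) (auto intro: sum_nonneg)
  then show ?thesis by (simp add: weight_def)
qed

text \<open>A row of coefficients is dominated by \<open>weight\<close>, so one step raises the
  power of \<open>age\<close> by one together with its factorial.\<close>

lemma gronwall_step:
  assumes i: "i < n" and x: "0 \<le> x" and c: "0 \<le> c"
  shows "(\<Sum>k<n. \<integral>\<^sup>+s. indicator {0..x} s * (ennreal (norm (q i k s)) * ennreal (c * (age s ^ N / fact N))) \<partial>lborel)
    \<le> ennreal (c * (age x ^ Suc N / fact (Suc N)))"
proof -
  have "(\<Sum>k<n. \<integral>\<^sup>+s. indicator {0..x} s * (ennreal (norm (q i k s)) * ennreal (c * (age s ^ N / fact N))) \<partial>lborel)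
     = (\<integral>\<^sup>+s. (\<Sum>k<n. indicator {0..x} s * (ennreal (norm (q i k s)) * ennreal (c * (age s ^ N / fact N)))) \<partial>lborel)"
  proof (rule nn_integral_sum[symmetric])
    fix k assume "k \<in> {..<n}"
    then have [measurable]: "q i k \<in> borel_measurable borel" using i by simp
    show "(\<lambda>s. indicator {0..x} s * (ennreal (norm (q i k s)) * ennreal (c * (age s ^ N / fact N)))) \<in> borel_measurable lborel"
      by measurable
  qed
  also have "\<dots> = (\<integral>\<^sup>+s. indicator {0..x} s * (ennreal (\<Sum>k<n. norm (q i k s)) * ennreal (c * (age s ^ N / fact N))) \<partial>lborel)"
    by (simp add: sum_distrib_left[symmetric] sum_distrib_right[symmetric])
  also have "\<dots> \<le> (\<integral>\<^sup>+s. indicator {0..x} s * (ennreal (weight s) * ennreal (c * (age s ^ N / fact N))) \<partial>lborel)"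
    by (intro nn_integral_mono mult_left_mono mult_right_mono ennreal_leI sum_le_weight i) simp_all
  also have "\<dots> = ennreal (c * (age x ^ Suc N / fact (Suc N)))"
    by (rule weight.nn_integral_power_prim[OF weight_ge x c])
  finally show ?thesis .
qed

text \<open>R i plus the primitive of b k - b i is R k, so both edges of the density are
  characteristics, with speeds bounded away from 0.\<close>

lemma approximable_kick:
  assumes "i < n" "k < n"
  shows "approximable l (kick i k)"
proof (cases "\<forall>x. q i k x = 0")
  case True
  then show ?thesis by (simp add: kick_def approximable_0)
next
  case False
  then interpret d: speed "\<lambda>x. b k x - b i x" \<theta> using sep[OF assms] by blast
  have "prim (b k) x = R i x + prim (\<lambda>x. b k x - b i x) x" for x
    by (subst prim_sub) (simp_all add: speed.loc[OF speed_b] assms)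
  then have "approximable l (d.ray (q i k) (R i))"
    using d.approximable_ray[OF speed_b speed_b _ q_int] assms by blast
  moreover have "kick i k = d.ray (q i k) (R i)"
    using False unfolding kick_def by (rule if_not_P)
  ultimately show ?thesis by simp
qed

lemma approximable_level:
  "i < n \<Longrightarrow> approximable l (level N i)"
proof (induction N arbitrary: i)
  case 0
  have "approximable l (\<lambda>p. (- 1) * (\<Sum>k<n. a k * kick i k p))"
    using 0 by (intro approximable_cmult approximable_sum approximable_kick) simp_all
  then show ?case by simp
next
  case (Suc N)
  have "approximable l (\<lambda>p. (- 1) * (\<Sum>k<n. volt (q i k) (R i) (level N k) p))"
    using Suc q_int speed_b by (intro approximable_cmult approximable_sum approximable_volt) auto
  then show ?case by simp
qed

lemma level_measurable [measurable]: "i < n \<Longrightarrow> level N i \<in> borel_measurable borel"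
  using approximable_level by (simp add: approximable_def)

lemma kick_measurable [measurable]: "i < n \<Longrightarrow> k < n \<Longrightarrow> kick i k \<in> borel_measurable borel"
  using approximable_kick by (simp add: approximable_def)

lemma nn_integral_q: "i < n \<Longrightarrow> k < n \<Longrightarrow> (\<integral>\<^sup>+s. norm (q i k s) \<partial>lborel) = ennreal (LBINT s. norm (q i k s))"
  using q_int by (intro nn_integral_eq_integral) auto

text \<open>Bounds the integral of \<open>level 0\<close> over a vertical line. It is summed over
  all components so that the induction over levels runs with one constant.\<close>

definition mass :: real where
  "mass = (\<Sum>i<n. \<Sum>k<n. norm (a k) * (LBINT s. norm (q i k s)))"

lemma mass_nonneg: "0 \<le> mass"
  unfolding mass_def by (intro sum_nonneg mult_nonneg_nonneg) simp_all

lemma sum_le_mass: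
  assumes "i < n"
  shows "(\<Sum>k<n. norm (a k) * (LBINT s. norm (q i k s))) \<le> mass"
  unfolding mass_def
  using assms by (intro member_le_sum[of i "{..<n}" "\<lambda>i. \<Sum>k<n. norm (a k) * (LBINT s. norm (q i k s))"])
    (auto intro!: sum_nonneg mult_nonneg_nonneg)

lemma kick_vertical:
  assumes "i < n" "k < n"
  shows "(\<integral>\<^sup>+u. norm (kick i k (x, u)) \<partial>lborel) \<le> ennreal (LBINT s. norm (q i k s))"
proof (cases "\<forall>x. q i k x = 0")
  case False
  then interpret d: speed "\<lambda>x. b k x - b i x" \<theta> using sep[OF assms] by blast
  show ?thesis
    using d.ray_vertical[of "q i k" "R i" x] assms
    unfolding kick_def if_not_P[OF False] by (simp add: nn_integral_q)
qed (simp add: kick_def)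

lemma kick_horizontal:
  assumes "i < n" "k < n"
  shows "(\<integral>\<^sup>+x. indicator {0..l} x * ennreal (norm (kick i k (x, u))) \<partial>lborel)
    \<le> ennreal (1 / \<theta>) * ennreal (LBINT s. norm (q i k s))"
proof (cases "\<forall>x. q i k x = 0")
  case False
  then interpret d: speed "\<lambda>x. b k x - b i x" \<theta> using sep[OF assms] by blast
  show ?thesis
    using d.ray_horizontal[OF speed_b[OF assms(1)], of "q i k" l u] assms
    unfolding kick_def if_not_P[OF False] by (simp add: nn_integral_q)
qed (simp add: kick_def)

lemma ennreal_norm_sum_le:
  fixes f :: "nat \<Rightarrow> complex"
  shows "ennreal (norm (- (\<Sum>k<n. f k))) \<le> (\<Sum>k<n. ennreal (norm (f k)))"
  by (simp add: norm_sum ennreal_leI)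

text \<open>w is 1 for vertical lines and the indicator of [0, l] for horizontal ones.\<close>

lemma nn_integral_norm_sum_le:
  fixes f :: "nat \<Rightarrow> real \<Rightarrow> complex"
  assumes [measurable]: "w \<in> borel_measurable borel" and f: "\<And>k. k < n \<Longrightarrow> f k \<in> borel_measurable borel"
    and le: "\<And>k. k < n \<Longrightarrow> (\<integral>\<^sup>+x. w x * ennreal (norm (f k x)) \<partial>lborel) \<le> c k"
  shows "(\<integral>\<^sup>+x. w x * ennreal (norm (- (\<Sum>k<n. f k x))) \<partial>lborel) \<le> (\<Sum>k<n. c k)"
proof -
  have "(\<integral>\<^sup>+x. w x * ennreal (norm (- (\<Sum>k<n. f k x))) \<partial>lborel)
      \<le> (\<integral>\<^sup>+x. (\<Sum>k<n. w x * ennreal (norm (f k x))) \<partial>lborel)"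
    unfolding sum_distrib_left[symmetric] by (intro nn_integral_mono mult_left_mono ennreal_norm_sum_le) simp
  also have "\<dots> = (\<Sum>k<n. \<integral>\<^sup>+x. w x * ennreal (norm (f k x)) \<partial>lborel)"
  proof (rule nn_integral_sum)
    fix k assume "k \<in> {..<n}"
    then have [measurable]: "f k \<in> borel_measurable borel" using f by simp
    show "(\<lambda>x. w x * ennreal (norm (f k x))) \<in> borel_measurable lborel" by measurable
  qed
  also have "\<dots> \<le> (\<Sum>k<n. c k)" by (intro sum_mono le) simp
  finally show ?thesis .
qed

lemma nn_integral_cmult_norm:
  fixes f :: "real \<Rightarrow> complex"
  assumes [measurable]: "w \<in> borel_measurable borel" "f \<in> borel_measurable borel"
  shows "(\<integral>\<^sup>+x. w x * ennreal (norm (z * f x)) \<partial>lborel) = ennreal (norm z) * (\<integral>\<^sup>+x. w x * ennreal (norm (f x)) \<partial>lborel)"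
proof -
  have "(\<integral>\<^sup>+x. w x * ennreal (norm (z * f x)) \<partial>lborel) = (\<integral>\<^sup>+x. ennreal (norm z) * (w x * ennreal (norm (f x))) \<partial>lborel)"
    by (simp add: norm_mult ennreal_mult ac_simps)
  also have "\<dots> = ennreal (norm z) * (\<integral>\<^sup>+x. w x * ennreal (norm (f x)) \<partial>lborel)"
    by (rule nn_integral_cmult) measurable
  finally show ?thesis .
qed

lemma slice_measurable:
  assumes [measurable]: "f \<in> borel_measurable borel"
  shows "(\<lambda>u. f (x :: real, u :: real)) \<in> borel_measurable borel" "(\<lambda>x. f (x, u)) \<in> borel_measurable borel"
  by measurable

text \<open>Transport preserves vertical integrals, so only the coefficients count, and these are
  measured by the clock \<open>age\<close>.\<close>

lemma level_vertical:
  assumes "i < n" "0 \<le> x"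
  shows "(\<integral>\<^sup>+u. norm (level N i (x, u)) \<partial>lborel) \<le> ennreal (mass * (age x ^ N / fact N))"
  using assms
proof (induction N arbitrary: i x)
  case 0
  have "(\<integral>\<^sup>+u. 1 * ennreal (norm (level 0 i (x, u))) \<partial>lborel) \<le> (\<Sum>k<n. ennreal (norm (a k) * (LBINT s. norm (q i k s))))"
    unfolding level.simps
  proof (rule nn_integral_norm_sum_le)
    fix k assume k: "k < n"
    then have [measurable]: "kick i k \<in> borel_measurable borel" using 0 by simp
    show "(\<lambda>u. a k * kick i k (x, u)) \<in> borel_measurable borel" by measurable
    show "(\<integral>\<^sup>+u. 1 * ennreal (norm (a k * kick i k (x, u))) \<partial>lborel) \<le> ennreal (norm (a k) * (LBINT s. norm (q i k s)))"
      using 0 k kick_vertical[of i k x]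
      by (simp add: nn_integral_cmult_norm[of "\<lambda>_. 1", simplified] slice_measurable ennreal_mult mult_left_mono)
  qed simp
  also have "\<dots> = ennreal (\<Sum>k<n. norm (a k) * (LBINT s. norm (q i k s)))"
    by (intro sum_ennreal mult_nonneg_nonneg) simp_all
  also have "\<dots> \<le> ennreal mass"
    by (intro ennreal_leI sum_le_mass 0)
  finally show ?case by simp
next
  case (Suc N)
  have "(\<integral>\<^sup>+u. 1 * ennreal (norm (level (Suc N) i (x, u))) \<partial>lborel)
      \<le> (\<Sum>k<n. \<integral>\<^sup>+s. indicator {0..x} s * (ennreal (norm (q i k s)) * ennreal (mass * (age s ^ N / fact N))) \<partial>lborel)"
    unfolding level.simps mult_1
    by (rule nn_integral_norm_sum_le[where w = "\<lambda>_. 1", unfolded mult_1])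
      (use Suc in \<open>simp_all add: slice_measurable volt_vertical\<close>)
  also have "\<dots> \<le> ennreal (mass * (age x ^ Suc N / fact (Suc N)))"
    by (rule gronwall_step[OF Suc.prems mass_nonneg])
  finally show ?case by simp
qed

text \<open>No induction is made in this direction: the horizontal integral of a level is bounded
  through vertical integrals of the preceding level, at the cost 1 / \<theta>, and that of the first
  one through the bound for \<open>ray\<close>.\<close>

lemma level_horizontal:
  assumes i: "i < n"
  shows "(\<integral>\<^sup>+x. indicator {0..l} x * ennreal (norm (level N i (x, u))) \<partial>lborel)
    \<le> ennreal (1 / \<theta>) * ennreal (mass * (age l ^ N / fact N))"
proof (cases N)
  case 0
  have "(\<integral>\<^sup>+x. indicator {0..l} x * ennreal (norm (level 0 i (x, u))) \<partial>lborel)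
     \<le> (\<Sum>k<n. ennreal (1 / \<theta>) * ennreal (norm (a k) * (LBINT s. norm (q i k s))))"
    unfolding level.simps
  proof (rule nn_integral_norm_sum_le)
    fix k assume k: "k < n"
    then have [measurable]: "kick i k \<in> borel_measurable borel" using i by simp
    show "(\<lambda>x. a k * kick i k (x, u)) \<in> borel_measurable borel" by measurable
    have "ennreal (norm (a k)) * (\<integral>\<^sup>+x. indicator {0..l} x * ennreal (norm (kick i k (x, u))) \<partial>lborel)
        \<le> ennreal (norm (a k)) * (ennreal (1 / \<theta>) * ennreal (LBINT s. norm (q i k s)))"
      by (intro mult_left_mono kick_horizontal i k) simp
    then show "(\<integral>\<^sup>+x. indicator {0..l} x * ennreal (norm (a k * kick i k (x, u))) \<partial>lborel)
        \<le> ennreal (1 / \<theta>) * ennreal (norm (a k) * (LBINT s. norm (q i k s)))"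
      by (simp add: nn_integral_cmult_norm slice_measurable ennreal_mult ac_simps)
  qed simp
  also have "\<dots> = ennreal (1 / \<theta>) * ennreal (\<Sum>k<n. norm (a k) * (LBINT s. norm (q i k s)))"
    by (simp add: sum_distrib_left[symmetric])
  also have "\<dots> \<le> ennreal (1 / \<theta>) * ennreal mass"
    by (intro mult_left_mono ennreal_leI sum_le_mass i) simp
  finally show ?thesis using 0 by simp
next
  case (Suc N')
  have "(\<integral>\<^sup>+x. indicator {0..l} x * ennreal (norm (level (Suc N') i (x, u))) \<partial>lborel)
     \<le> (\<Sum>k<n. ennreal (1 / \<theta>) *
      (\<integral>\<^sup>+s. indicator {0..l} s * (ennreal (norm (q i k s)) * ennreal (mass * (age s ^ N' / fact N'))) \<partial>lborel))"
    unfolding level.simps using i speed_b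
    by (intro nn_integral_norm_sum_le volt_horizontal level_vertical slice_measurable(2)) simp_all
  also have "\<dots> \<le> ennreal (1 / \<theta>) * ennreal (mass * (age l ^ Suc N' / fact (Suc N')))"
    unfolding sum_distrib_left[symmetric] using l_pos
    by (intro mult_left_mono gronwall_step i mass_nonneg) simp_all
  finally show ?thesis using Suc by simp
qed

text \<open>A common bound for both directions; its factor is at least 1 and at least 1 /
  \<theta>.\<close>

definition budget :: "nat \<Rightarrow> real" where
  "budget N = (1 + 1 / \<theta>) * (mass * (age l ^ N / fact N))"

lemma budget_nonneg: "0 \<le> budget N"
  unfolding budget_def using \<theta>_pos mass_nonneg age_nonneg[of l] l_pos
  by (intro mult_nonneg_nonneg divide_nonneg_nonneg zero_le_power) simp_all

lemma budget_summable: "summable budget"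
  unfolding budget_def[abs_def]
  using summable_exp[of "age l"] by (intro summable_mult) (simp add: field_simps)

lemma level_budget:
  assumes i: "i < n" and M: "M \<in> strips l"
  shows "(\<integral>\<^sup>+p. norm (level N i p) \<partial>M) \<le> ennreal (budget N)"
proof -
  define t where "t = mass * (age l ^ N / fact N)"
  have t: "0 \<le> t"
    unfolding t_def using mass_nonneg age_nonneg[of l] l_pos by simp
  have "\<forall>M\<in>strips l. (\<integral>\<^sup>+p. norm (level N i p) \<partial>M) \<le> ennreal (budget N)"
  proof (subst strips_all, goal_cases)
    case 1
    show ?case using level_measurable[OF i] by measurable
  next
    case 2
    have "(\<integral>\<^sup>+u. norm (level N i (x, u)) \<partial>lborel) \<le> ennreal (budget N)" if x: "x \<in> {0..l}" for x
    proof -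
      have "mass * (age x ^ N / fact N) \<le> t"
        unfolding t_def using x age_mono[of x l] age_nonneg[of x] mass_nonneg
        by (intro mult_left_mono divide_right_mono power_mono) simp_all
      also have "\<dots> \<le> budget N"
        using mult_right_mono[OF _ t, of 1 "1 + 1 / \<theta>"] \<theta>_pos by (simp add: budget_def t_def)
      finally show ?thesis
        using level_vertical[OF i, of x N] x by (meson atLeastAtMost_iff ennreal_leI order_trans)
    qed
    moreover have "(\<integral>\<^sup>+x. indicator {0..l} x * ennreal (norm (level N i (x, u))) \<partial>lborel) \<le> ennreal (budget N)" for u
    proof -
      have "ennreal (1 / \<theta>) * ennreal t = ennreal (1 / \<theta> * t)"
        using \<theta>_pos by (intro ennreal_mult'[symmetric]) simp
      also have "\<dots> \<le> ennreal (budget N)"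
        using mult_right_mono[OF _ t, of "1 / \<theta>" "1 + 1 / \<theta>"] by (intro ennreal_leI) (simp add: budget_def t_def)
      finally show ?thesis
        using level_horizontal[OF i, where N = N and u = u] unfolding t_def by (rule order_trans[rotated])
    qed
    ultimately show ?case by blast
  qed
  then show ?thesis using M by blast
qed

lemma approximable_density:
  assumes "i < n"
  shows "approximable l (density i)"
  unfolding density_def[abs_def]
  by (rule approximable_suminf[OF approximable_level level_budget budget_nonneg budget_summable]) (rule assms | assumption)+

text \<open>u is the end of a broken path that follows component k up to time s and component i from
  s to x; the cone conditions add up over the two pieces.\<close>

lemma kick_support:
  assumes ik: "i < n" "k < n" and x: "kick i k (x, u) \<noteq> 0"
  shows "lo x \<le> u \<and> u \<le> up x"
proof -
  have "\<not> (\<forall>x. q i k x = 0)"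
  proof
    assume "\<forall>x. q i k x = 0"
    then have "kick i k = (\<lambda>_. 0)" unfolding kick_def by (rule if_P)
    then show False using x by simp
  qed
  then interpret d: speed "\<lambda>x. b k x - b i x" \<theta> using sep[OF ik] by blast
  have "kick i k = d.ray (q i k) (R i)"
    using \<open>\<not> (\<forall>x. q i k x = 0)\<close> unfolding kick_def by (rule if_not_P)
  then have "d.ray (q i k) (R i) (x, u) \<noteq> 0"
    using x by simp
  moreover define s where "s = d.clock (u - R i x)"
  ultimately have s: "0 \<le> s" "s \<le> x"
    by (auto simp: d.ray_def Let_def split: if_splits)
  have "u = R i x + prim (\<lambda>x. b k x - b i x) s"
    by (simp add: s_def)
  also have "\<dots> = R i x + (R k s - R i s)"
    by (subst prim_sub) (simp_all add: speed.loc[OF speed_b] ik)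
  finally have u: "u = R i x + (R k s - R i s)" .
  show ?thesis
    using cone(1)[of i s x] cone(2)[of i s x] cone(1)[of k 0 s] cone(2)[of k 0 s] s ik
    by (simp add: u cone_0)
qed

text \<open>This holds at every point: going back along a characteristic from outside the cone never
  enters it, so there the integrand of each Volterra integral vanishes identically.\<close>

lemma level_support:
  assumes "i < n" "0 \<le> x" "level N i (x, u) \<noteq> 0"
  shows "lo x \<le> u \<and> u \<le> up x"
  using assms
proof (induction N arbitrary: i x u)
  case 0
  then have "(\<Sum>k<n. a k * kick i k (x, u)) \<noteq> 0" by simp
  then obtain k where "k < n" "kick i k (x, u) \<noteq> 0"
    by (rule sum.not_neutral_contains_not_neutral) simp
  then show ?case using kick_support 0 by blast
next
  case (Suc N)
  then have "(\<Sum>k<n. volt (q i k) (R i) (level N k) (x, u)) \<noteq> 0" by simp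
  then obtain k where k: "k < n" "volt (q i k) (R i) (level N k) (x, u) \<noteq> 0"
    by (rule sum.not_neutral_contains_not_neutral) simp
  have "\<exists>s\<in>{0..x}. level N k (s, u - R i x + R i s) \<noteq> 0"
  proof (rule ccontr)
    assume "\<not> ?thesis"
    then have zero: "indicator {0..x} s *\<^sub>R (q i k s * level N k (s, u - R i x + R i s)) = 0" for s
      by (auto simp: indicator_def)
    have "volt (q i k) (R i) (level N k) (x, u) = 0"
      unfolding volt_def set_lebesgue_integral_def fst_conv snd_conv zero by simp
    with k show False by simp
  qed
  then obtain s where s: "0 \<le> s" "s \<le> x" "level N k (s, u - R i x + R i s) \<noteq> 0" by auto
  then show ?case
    using Suc.IH[OF k(1) s(1,3)] cone(1)[of i s x] cone(2)[of i s x] Suc.prems by simp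
qed

lemma density_support:
  assumes "i < n" "0 \<le> x" "density i (x, u) \<noteq> 0"
  shows "lo x \<le> u \<and> u \<le> up x"
proof (rule ccontr)
  assume "\<not> ?thesis"
  then have "level N i (x, u) = 0" for N using level_support assms by blast
  then show False using assms(3) by (simp add: density_def)
qed

end

section \<open>Fourier moments: from densities in u to Picard iterates in x\<close>

context transport
begin

lemma reach_bounds:
  assumes "0 \<le> x" "x \<le> l" "lo x \<le> u" "u \<le> up x"
  shows "\<bar>u\<bar> \<le> reach"
  using cone_mono(1)[of x l] cone_mono(2)[of x l] assms by (auto simp: reach_def)

text \<open>Since lo s \<le> 0 \<le> up s, the increment of a characteristic over [s, x] obeys the
  same bounds as a position in the cone at time x.\<close>

lemma R_diff_reach:
  assumes "i < n" "0 \<le> s" "s \<le> x" "x \<le> l"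
  shows "\<bar>R i x - R i s\<bar> \<le> reach"
proof -
  have "up s \<ge> 0" "lo s \<le> 0"
    using cone_mono(1)[of 0 s] cone_mono(2)[of 0 s] assms cone_0 by auto
  then have "lo x \<le> R i x - R i s" "R i x - R i s \<le> up x"
    using cone[of i s x] assms by auto
  then show ?thesis using reach_bounds[of x] assms by auto
qed

definition amp :: "complex \<Rightarrow> real" where "amp lam = exp (norm lam * reach)"

lemma amp_nonneg: "0 \<le> amp lam" by (simp add: amp_def)

lemma norm_exp_le_amp:
  assumes "\<bar>u\<bar> \<le> reach"
  shows "norm (wave lam u) \<le> amp lam"
proof -
  have "Re (\<i> * lam * complex_of_real u) \<le> norm (\<i> * lam * complex_of_real u)"
    by (rule complex_Re_le_cmod)
  also have "\<dots> = norm lam * \<bar>u\<bar>"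
    by (simp add: norm_mult)
  also have "\<dots> \<le> norm lam * reach"
    using assms by (intro mult_left_mono) simp_all
  finally show ?thesis by (simp add: amp_def)
qed

lemma norm_exp_mult_density_le:
  assumes "0 \<le> x" "x \<le> l" "z \<noteq> 0 \<Longrightarrow> lo x \<le> u \<and> u \<le> up x"
  shows "norm (wave lam u * z) \<le> amp lam * norm z"
proof (cases "z = 0")
  case False
  then have "norm (wave lam u) \<le> amp lam"
    using assms by (intro norm_exp_le_amp reach_bounds[of x]) auto
  then show ?thesis by (simp add: norm_mult mult_right_mono)
qed simp

text \<open>The phase R i x + R k s - R i s at the end of the broken path splits into the Duhamel
  factor and the free wave of component k.\<close>

lemma kick_moment:
  assumes ik: "i < n" "k < n" and x: "0 \<le> x" "x \<le> l"
  shows "(LBINT u. wave lam u * kick i k (x, u))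
      = duhamel lam i k (\<lambda>s. wave lam (R k s)) x"
proof (cases "\<forall>x. q i k x = 0")
  case True
  then have "kick i k = (\<lambda>_. 0)" unfolding kick_def by (rule if_P)
  with True show ?thesis by (simp add: duhamel_def)
next
  case False
  then interpret d: speed "\<lambda>x. b k x - b i x" \<theta> using sep[OF ik] by blast
  have d: "prim (\<lambda>x. b k x - b i x) s = R k s - R i s" for s
    by (subst prim_sub) (simp_all add: speed.loc[OF speed_b] ik)
  have "(LBINT u. wave lam u * kick i k (x, u))
      = (LBINT s:{0..x}. q i k s * wave lam (R i x + (R k s - R i s)))"
    using ik unfolding kick_def if_not_P[OF False] by (subst d.ray_moment) (simp_all add: d)
  also have "\<dots> = duhamel lam i k (\<lambda>s. wave lam (R k s)) x"
    unfolding duhamel_def by (simp add: exp_add[symmetric] algebra_simps)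
  finally show ?thesis .
qed

lemma integrable_exp_mult:
  assumes [measurable]: "f \<in> borel_measurable borel" and x: "0 \<le> x" "x \<le> l"
    and supp: "\<And>u. f (x, u) \<noteq> 0 \<Longrightarrow> lo x \<le> u \<and> u \<le> up x"
    and fin: "(\<integral>\<^sup>+u. norm (f (x, u)) \<partial>lborel) < \<infinity>"
  shows "integrable lborel (\<lambda>u. wave lam u * f (x, u))"
proof (rule Bochner_Integration.integrable_bound)
  show "integrable lborel (\<lambda>u. amp lam * norm (f (x, u)))"
    using fin by (intro integrable_mult_right integrable_norm integrableI_bounded) simp_all
  show "AE u in lborel. norm (wave lam u * f (x, u)) \<le> norm (amp lam * norm (f (x, u)))"
  proof (rule AE_I2)
    fix u
    have "norm (wave lam u * f (x, u)) \<le> amp lam * norm (f (x, u))"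
      by (rule norm_exp_mult_density_le[OF x supp])
    also have "\<dots> \<le> norm (amp lam * norm (f (x, u)))" by simp
    finally show "norm (wave lam u * f (x, u)) \<le> norm (amp lam * norm (f (x, u)))" .
  qed
qed simp

lemma level_finite:
  assumes "i < n" "0 \<le> x"
  shows "(\<integral>\<^sup>+u. norm (level N i (x, u)) \<partial>lborel) < \<infinity>"
  using level_vertical[OF assms, of N] by (rule le_less_trans) simp

lemma integrable_level:
  assumes "i < n" "0 \<le> x" "x \<le> l"
  shows "integrable lborel (\<lambda>u. wave lam u * level N i (x, u))"
  using assms by (intro integrable_exp_mult level_support level_finite) auto

text \<open>The Fourier transform in u turns the shift along a characteristic into the factor
  \<open>wave lam (R i x - R i s)\<close>, hence a Volterra step for densities into a Duhamel step
  for functions of x.\<close>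

lemma level_moment:
  assumes "i < n" "0 \<le> x" "x \<le> l"
  shows "(LBINT u. wave lam u * level N i (x, u)) = iter lam (Suc N) i x"
  using assms
proof (induction N arbitrary: i x)
  case 0
  have int: "integrable lborel (\<lambda>u. wave lam u * kick i k (x, u))" if k: "k < n" for k
  proof (rule integrable_exp_mult)
    show "(\<integral>\<^sup>+u. norm (kick i k (x, u)) \<partial>lborel) < \<infinity>"
      using kick_vertical[OF 0(1) k, of x] by (rule le_less_trans) simp
  qed (use 0 k kick_support in auto)
  have "wave lam u * level 0 i (x, u)
      = - (\<Sum>k<n. a k * (wave lam u * kick i k (x, u)))" for u
    by (simp add: sum_distrib_left ac_simps)
  then have "(LBINT u. wave lam u * level 0 i (x, u))
      = - (LBINT u. (\<Sum>k<n. a k * (wave lam u * kick i k (x, u))))"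
    by (simp del: level.simps)
  also have "(LBINT u. (\<Sum>k<n. a k * (wave lam u * kick i k (x, u))))
      = (\<Sum>k<n. LBINT u. a k * (wave lam u * kick i k (x, u)))"
    using int by (intro Bochner_Integration.integral_sum integrable_mult_right) simp
  also have "\<dots> = (\<Sum>k<n. a k * duhamel lam i k (\<lambda>s. wave lam (R k s)) x)"
    using 0 by (intro sum.cong refl) (simp add: kick_moment)
  also have "\<dots> = (\<Sum>k<n. duhamel lam i k (iter lam 0 k) x)"
  proof (intro sum.cong refl)
    fix k
    have "duhamel lam i k (iter lam 0 k) x
        = (LBINT s:{0..x}. a k * (q i k s * (wave lam (R i x - R i s) * wave lam (R k s))))"
      unfolding duhamel_def iter.simps by (intro set_lebesgue_integral_cong) simp_all
    then show "a k * duhamel lam i k (\<lambda>s. wave lam (R k s)) x = duhamel lam i k (iter lam 0 k) x"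
      by (simp only: duhamel_def set_integral_mult_right)
  qed
  finally show ?case by simp
next
  case (Suc N)
  have 1: "(LBINT u. wave lam u * volt (q i k) (R i) (level N k) (x, u)) = duhamel lam i k (iter lam (Suc N) k) x"
    and 2: "integrable lborel (\<lambda>u. wave lam u * volt (q i k) (R i) (level N k) (x, u))"
    if k: "k < n" for k
  proof -
    have fin: "(\<integral>\<^sup>+s. indicator {0..x} s * (ennreal (norm (q i k s)) * (\<integral>\<^sup>+u. norm (level N k (s, u)) \<partial>lborel)) \<partial>lborel) < \<infinity>"
    proof -
      have "(\<integral>\<^sup>+s. indicator {0..x} s * (ennreal (norm (q i k s)) * (\<integral>\<^sup>+u. norm (level N k (s, u)) \<partial>lborel)) \<partial>lborel)
         \<le> (\<integral>\<^sup>+s. indicator {0..x} s * (ennreal (norm (q i k s)) * ennreal (mass * (age s ^ N / fact N))) \<partial>lborel)"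
        using k by (intro nn_integral_mono indicator_mult_mono level_vertical) auto
      also have "\<dots> \<le> (\<Sum>k<n. \<integral>\<^sup>+s. indicator {0..x} s * (ennreal (norm (q i k s)) * ennreal (mass * (age s ^ N / fact N))) \<partial>lborel)"
        using k by (intro member_le_sum) simp_all
      also have "\<dots> \<le> ennreal (mass * (age x ^ Suc N / fact (Suc N)))"
        by (rule gronwall_step[OF Suc.prems(1,2) mass_nonneg])
      finally show ?thesis by (rule le_less_trans) simp
    qed
    \<comment> \<open>Following a characteristic forward from a point of the cone one stays in the
      cone, where the exponential is at most \<open>amp lam\<close>.\<close>
    have \<phi>: "norm (wave lam u) \<le> amp lam"
      if "0 \<le> s" "s \<le> x" "level N k (s, u - R i x + R i s) \<noteq> 0" for s u
    proof (rule norm_exp_le_amp, rule reach_bounds[of x])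
      have "lo s \<le> u - R i x + R i s \<and> u - R i x + R i s \<le> up s"
        using level_support[OF k that(1,3)] .
      then show "lo x \<le> u" "u \<le> up x"
        using cone[of i s x] Suc.prems that by auto
    qed (use Suc.prems in auto)
    note vm = volt_moment[where q = "q i k" and R = "R i" and f = "level N k" and x = x
        and \<phi> = "\<lambda>u. wave lam u" and E = "amp lam", OF _ _ _ _ fin \<phi>]
    show "integrable lborel (\<lambda>u. wave lam u * volt (q i k) (R i) (level N k) (x, u))"
      using Suc.prems k by (intro vm(2)) simp_all
    have "(LBINT u. wave lam u * volt (q i k) (R i) (level N k) (x, u))
       = (LBINT s:{0..x}. q i k s * (LBINT u. wave lam (u + R i x - R i s) * level N k (s, u)))"
      using Suc.prems k by (intro vm(1)) simp_all
    also have "\<dots> = duhamel lam i k (iter lam (Suc N) k) x"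
      unfolding duhamel_def
    proof (intro set_lebesgue_integral_cong)
      show "\<forall>s. s \<in> {0..x} \<longrightarrow> q i k s * (LBINT u. wave lam (u + R i x - R i s) * level N k (s, u))
          = q i k s * (wave lam (R i x - R i s) * iter lam (Suc N) k s)"
      proof (intro allI impI)
        fix s assume s: "s \<in> {0..x}"
        have "(LBINT u. wave lam (u + R i x - R i s) * level N k (s, u))
            = (LBINT u. wave lam (R i x - R i s) * (wave lam u * level N k (s, u)))"
        proof (intro Bochner_Integration.integral_cong refl)
          fix u
          have "\<i> * lam * of_real (u + R i x - R i s) = \<i> * lam * of_real (R i x - R i s) + \<i> * lam * of_real u"
            by (simp add: algebra_simps)
          then show "wave lam (u + R i x - R i s) * level N k (s, u)
              = wave lam (R i x - R i s) * (wave lam u * level N k (s, u))"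
            by (simp only: exp_add mult.assoc)
        qed
        also have "\<dots> = wave lam (R i x - R i s) * iter lam (Suc N) k s"
          using Suc.IH[OF k, of s] s Suc.prems by (simp only: integral_mult_right_zero) auto
        finally show "q i k s * (LBINT u. wave lam (u + R i x - R i s) * level N k (s, u))
            = q i k s * (wave lam (R i x - R i s) * iter lam (Suc N) k s)"
          by (simp only:)
      qed
    qed simp
    finally show "(LBINT u. wave lam u * volt (q i k) (R i) (level N k) (x, u)) = duhamel lam i k (iter lam (Suc N) k) x" .
  qed
  have "wave lam u * level (Suc N) i (x, u)
      = - (\<Sum>k<n. wave lam u * volt (q i k) (R i) (level N k) (x, u))" for u
    by (simp add: sum_distrib_left)
  then have "(LBINT u. wave lam u * level (Suc N) i (x, u))
      = - (LBINT u. (\<Sum>k<n. wave lam u * volt (q i k) (R i) (level N k) (x, u)))"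
    by (simp del: level.simps)
  also have "(LBINT u. (\<Sum>k<n. wave lam u * volt (q i k) (R i) (level N k) (x, u)))
      = (\<Sum>k<n. LBINT u. wave lam u * volt (q i k) (R i) (level N k) (x, u))"
    using 2 by (intro Bochner_Integration.integral_sum) simp
  also have "\<dots> = (\<Sum>k<n. duhamel lam i k (iter lam (Suc N) k) x)"
    using 1 by (intro sum.cong refl) (simp del: iter.simps)
  finally show ?case by (simp only: iter.simps)
qed

text \<open>Termwise integration: on the common support the exponential is at most
  \<open>amp lam\<close>, so the L1 norms of the terms are dominated by a multiple of the summable
  \<open>budget\<close>.\<close>

lemma density_moment:
  assumes i: "i < n" and x: "0 \<le> x" "x \<le> l"
  shows "integrable lborel (\<lambda>u. wave lam u * density i (x, u))"
    and "(\<lambda>N. iter lam (Suc N) i x) sums (LBINT u. wave lam u * density i (x, u))"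
proof -
  define f where "f = (\<lambda>N u. wave lam u * level N i (x, u))"
  have strip: "distr lborel borel (\<lambda>u. (x, u)) \<in> strips l"
    using x by (simp add: strips_def)
  have [measurable]: "level N i \<in> borel_measurable borel" for N using i by simp
  have le: "(\<integral>\<^sup>+u. norm (level N i (x, u)) \<partial>lborel) \<le> ennreal (budget N)" for N
    using level_budget[OF i strip, of N] by (simp add: nn_integral_vertical)
  have "AE u in lborel. summable (\<lambda>N. norm (level N i (x, u)))"
    by (rule nn_integral_suminf_tail(1)[OF _ le budget_nonneg budget_summable]) simp
  then have ae: "AE u in lborel. summable (\<lambda>N. norm (f N u))"
    by eventually_elim (simp add: f_def norm_mult summable_mult)
  have int: "integrable lborel (f N)" for N
    unfolding f_def by (rule integrable_level[OF i x])
  have norm_le: "(LBINT u. norm (f N u)) \<le> amp lam * budget N" for N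
  proof -
    have "integrable lborel (\<lambda>u. level N i (x, u))"
      using level_finite[OF i x(1), of N] by (intro integrableI_bounded) simp_all
    then have lint: "integrable lborel (\<lambda>u. norm (level N i (x, u)))" by simp
    have "(LBINT u. norm (f N u)) \<le> (LBINT u. amp lam * norm (level N i (x, u)))"
    proof (rule integral_mono)
      show "norm (f N u) \<le> amp lam * norm (level N i (x, u))" for u
        unfolding f_def by (rule norm_exp_mult_density_le[OF x level_support[OF i x(1)]])
    qed (use int lint in simp_all)
    also have "\<dots> = amp lam * (LBINT u. norm (level N i (x, u)))" by simp
    also have "\<dots> \<le> amp lam * budget N"
    proof (rule mult_left_mono[OF _ amp_nonneg])
      have "ennreal (LBINT u. norm (level N i (x, u))) \<le> ennreal (budget N)"
        using le[of N] nn_integral_eq_integral[OF lint] by simp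
      then show "(LBINT u. norm (level N i (x, u))) \<le> budget N"
        using budget_nonneg by simp
    qed
    finally show ?thesis .
  qed
  have sm: "summable (\<lambda>N. LBINT u. norm (f N u))"
  proof (rule summable_comparison_test')
    show "summable (\<lambda>N. amp lam * budget N)" by (intro summable_mult budget_summable)
    show "norm (LBINT u. norm (f N u)) \<le> amp lam * budget N" if "0 \<le> N" for N
      using norm_le[of N] by simp
  qed
  have eq: "AE u in lborel. (\<Sum>N. f N u) = wave lam u * density i (x, u)"
    using ae
  proof eventually_elim
    case (elim u)
    have "summable (\<lambda>N. wave lam u * level N i (x, u))"
      using summable_norm_cancel[OF elim] by (simp add: f_def)
    then have "summable (\<lambda>N. level N i (x, u))"
      by (simp add: summable_cmult_iff)
    then show ?case
      unfolding f_def density_def by (rule suminf_mult)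
  qed
  have meas: "(\<lambda>u. wave lam u * density i (x, u)) \<in> borel_measurable lborel"
    unfolding density_def by measurable
  have meas': "(\<lambda>u. \<Sum>N. f N u) \<in> borel_measurable lborel"
    using int by (intro borel_measurable_suminf) (simp add: borel_measurable_integrable)
  show "integrable lborel (\<lambda>u. wave lam u * density i (x, u))"
    using integrable_suminf[OF int ae sm] integrable_cong_AE[OF meas' meas eq] by simp
  have "(\<lambda>N. LBINT u. f N u) sums (LBINT u. \<Sum>N. f N u)"
    by (rule sums_integral[OF int ae sm])
  also have "(LBINT u. \<Sum>N. f N u) = (LBINT u. wave lam u * density i (x, u))"
    by (rule integral_cong_AE[OF meas' meas eq])
  also have "(\<lambda>N. LBINT u. f N u) = (\<lambda>N. iter lam (Suc N) i x)"
    unfolding f_def by (intro ext level_moment i x)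
  finally show "(\<lambda>N. iter lam (Suc N) i x) sums (LBINT u. wave lam u * density i (x, u))" .
qed

section \<open>The Picard remainder of a bounded solution\<close>

lemma duhamel_measurable [measurable]:
  assumes ik: "i < n" "k < n" and [measurable]: "y \<in> borel_measurable borel"
  shows "duhamel lam i k y \<in> borel_measurable borel"
proof -
  have [measurable]: "q i k \<in> borel_measurable borel" "R i \<in> borel_measurable borel" using ik by simp_all
  have "(\<lambda>x. LBINT s. if 0 \<le> s \<and> s \<le> x then q i k s * (wave lam (R i x - R i s) * y s) else 0)
      \<in> borel_measurable borel"
    by measurable
  moreover have "indicator {0..x} s *\<^sub>R c = (if 0 \<le> s \<and> s \<le> x then c else 0)" for x s :: real and c :: complex
    by simp
  ultimately show ?thesis
    unfolding duhamel_def[abs_def] set_lebesgue_integral_def by presburger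
qed

lemma iter_measurable: "i < n \<Longrightarrow> iter lam N i \<in> borel_measurable borel"
proof (induction N arbitrary: i)
  case (Suc N)
  then show ?case
    unfolding iter.simps
    by (intro borel_measurable_uminus borel_measurable_sum duhamel_measurable) auto
qed simp

lemma duhamel_integrand_le:
  assumes "i < n" "0 \<le> s" "s \<le> x" "x \<le> l" "norm (y s) \<le> M"
  shows "norm (q i k s * (wave lam (R i x - R i s) * y s)) \<le> norm (q i k s) * (amp lam * M)"
  unfolding norm_mult using assms
  by (intro mult_left_mono mult_mono norm_exp_le_amp R_diff_reach amp_nonneg) simp_all

lemma duhamel_integrable:
  assumes ik: "i < n" "k < n" and x: "x \<le> l" and [measurable]: "y \<in> borel_measurable borel"
    and M: "\<And>s. 0 \<le> s \<Longrightarrow> s \<le> x \<Longrightarrow> norm (y s) \<le> M"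
  shows "set_integrable lborel {0..x} (\<lambda>s. q i k s * (wave lam (R i x - R i s) * y s))"
proof (rule set_integrable_mult_bounded)
  have [measurable]: "R i \<in> borel_measurable borel" using ik by simp
  show "set_integrable lborel {0..x} (q i k)"
    unfolding set_integrable_def using q_int[OF ik] by (intro integrable_mult_indicator) simp_all
  show "(\<lambda>s. wave lam (R i x - R i s) * y s) \<in> borel_measurable borel" by measurable
  show "norm (wave lam (R i x - R i s) * y s) \<le> amp lam * M" if "s \<in> {0..x}" for s
    unfolding norm_mult using that M[of s] x ik
    by (intro mult_mono norm_exp_le_amp R_diff_reach amp_nonneg) simp_all
qed

text \<open>The counterpart of the vertical bound for functions of x: each step costs a factor
  \<open>amp lam\<close> for the exponential and gains a factorial through the clock.\<close>

lemma duhamel_step: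
  assumes i: "i < n" and x: "0 \<le> x" "x \<le> l" and M: "0 \<le> M"
    and y: "\<And>k. k < n \<Longrightarrow> y k \<in> borel_measurable borel"
    and le: "\<And>k s. k < n \<Longrightarrow> 0 \<le> s \<Longrightarrow> s \<le> l \<Longrightarrow> norm (y k s) \<le> M * (age s ^ N / fact N)"
  shows "norm (\<Sum>k<n. duhamel lam i k (y k) x) \<le> amp lam * M * (age x ^ Suc N / fact (Suc N))"
proof -
  have "ennreal (norm (duhamel lam i k (y k) x))
     \<le> (\<integral>\<^sup>+s. indicator {0..x} s * (ennreal (norm (q i k s)) * ennreal (amp lam * M * (age s ^ N / fact N))) \<partial>lborel)"
    if k: "k < n" for k
  proof -
    \<comment> \<open>A bound that is constant in s, from which integrability of the integrand
      follows.\<close>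
    have M': "norm (y k s) \<le> M * (age l ^ N / fact N)" if "0 \<le> s" "s \<le> x" for s
    proof -
      have "M * (age s ^ N / fact N) \<le> M * (age l ^ N / fact N)"
        using that x age_mono[of s l] age_nonneg[of s] M
        by (intro mult_left_mono divide_right_mono power_mono) simp_all
      then show ?thesis using le[OF k that(1)] that x by simp
    qed
    have "ennreal (norm (duhamel lam i k (y k) x))
      \<le> (\<integral>\<^sup>+s. norm (indicator {0..x} s *\<^sub>R (q i k s * (wave lam (R i x - R i s) * y k s))) \<partial>lborel)"
      unfolding duhamel_def set_lebesgue_integral_def
      using duhamel_integrable[OF i k x(2) y[OF k] M'] unfolding set_integrable_def
      by (intro integral_norm_bound_ennreal) simp
    also have "\<dots> \<le> (\<integral>\<^sup>+s. indicator {0..x} s * (ennreal (norm (q i k s)) * ennreal (amp lam * M * (age s ^ N / fact N))) \<partial>lborel)"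
    proof (rule nn_integral_mono)
      fix s
      show "ennreal (norm (indicator {0..x} s *\<^sub>R (q i k s * (wave lam (R i x - R i s) * y k s))))
        \<le> indicator {0..x} s * (ennreal (norm (q i k s)) * ennreal (amp lam * M * (age s ^ N / fact N)))"
      proof (cases "s \<in> {0..x}")
        case True
        have "norm (q i k s * (wave lam (R i x - R i s) * y k s))
            \<le> norm (q i k s) * (amp lam * (M * (age s ^ N / fact N)))"
          using True x i k by (intro duhamel_integrand_le le) simp_all
        then show ?thesis using True by (simp add: ennreal_mult'[symmetric] ennreal_leI mult.assoc)
      qed simp
    qed
    finally show ?thesis .
  qed
  then have "(\<Sum>k<n. ennreal (norm (duhamel lam i k (y k) x)))
     \<le> (\<Sum>k<n. \<integral>\<^sup>+s. indicator {0..x} s * (ennreal (norm (q i k s)) * ennreal (amp lam * M * (age s ^ N / fact N))) \<partial>lborel)"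
    by (intro sum_mono) simp
  also have "\<dots> \<le> ennreal (amp lam * M * (age x ^ Suc N / fact (Suc N)))"
    using i x M amp_nonneg by (intro gronwall_step mult_nonneg_nonneg) simp_all
  finally have "ennreal (norm (\<Sum>k<n. duhamel lam i k (y k) x)) \<le> ennreal (amp lam * M * (age x ^ Suc N / fact (Suc N)))"
    using ennreal_norm_sum_le[of "\<lambda>k. duhamel lam i k (y k) x"] by simp
  moreover have "0 \<le> amp lam * M * (age x ^ Suc N / fact (Suc N))"
    using M amp_nonneg age_nonneg[OF x(1)]
    by (intro mult_nonneg_nonneg divide_nonneg_nonneg zero_le_power) simp_all
  ultimately show ?thesis by (simp only: ennreal_le_iff)
qed

lemma iter_bound:
  assumes "i < n" "0 \<le> x" "x \<le> l"
  shows "norm (iter lam N i x) \<le> amp lam ^ Suc N * (\<Sum>k<n. norm (a k)) * (age x ^ N / fact N)"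
  using assms
proof (induction N arbitrary: i x)
  case 0
  have "norm (wave lam (R i x)) \<le> amp lam"
    using R_diff_reach[of i 0 x] 0 by (intro norm_exp_le_amp) simp
  moreover have "norm (a i) \<le> (\<Sum>k<n. norm (a k))"
    using 0 by (intro member_le_sum) simp_all
  ultimately show ?case
    by (simp add: norm_mult mult_mono amp_nonneg)
next
  case (Suc N)
  have "norm (\<Sum>k<n. duhamel lam i k (iter lam N k) x)
      \<le> amp lam * (amp lam ^ Suc N * (\<Sum>k<n. norm (a k))) * (age x ^ Suc N / fact (Suc N))"
    using Suc amp_nonneg by (intro duhamel_step iter_measurable mult_nonneg_nonneg sum_nonneg) simp_all
  then show ?case
    by (simp only: iter.simps norm_minus_cancel power_Suc mult.assoc)
qed

text \<open>The remainder after N iterates obeys the Duhamel recursion, started from the bound M.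
  The factorial beats the powers of \<open>amp lam\<close>, so every bounded solution is the sum of
  the iterates; uniqueness and representation come from one estimate.\<close>

lemma duhamel_unique:
  assumes Y: "\<And>i. i < n \<Longrightarrow> Y i \<in> borel_measurable borel"
    and M: "\<And>i x. i < n \<Longrightarrow> 0 \<le> x \<Longrightarrow> x \<le> l \<Longrightarrow> norm (Y i x) \<le> M"
    and eq: "\<And>i x. i < n \<Longrightarrow> 0 \<le> x \<Longrightarrow> x \<le> l \<Longrightarrow>
      Y i x = wave lam (R i x) * a i - (\<Sum>k<n. duhamel lam i k (Y k) x)"
    and i: "i < n" and x: "0 \<le> x" "x \<le> l"
  shows "Y i x = wave lam (R i x) * a i
    + (LBINT u. wave lam u * density i (x, u))"
proof -
  have M0: "0 \<le> M" using M[OF i x] norm_ge_zero order_trans by blast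
  have rem: "norm (Y i x - (\<Sum>m<N. iter lam m i x)) \<le> (amp lam ^ N * M) * (age x ^ N / fact N)"
    if "i < n" "0 \<le> x" "x \<le> l" for N i x
    using that
  proof (induction N arbitrary: i x)
    case 0
    then show ?case using M by simp
  next
    case (Suc N)
    define r where "r = (\<lambda>k s. Y k s - (\<Sum>m<N. iter lam m k s))"
    have split: "duhamel lam i k (r k) x = duhamel lam i k (Y k) x - (\<Sum>m<N. duhamel lam i k (iter lam m k) x)"
      if k: "k < n" for k
    proof -
      have int_Y: "set_integrable lborel {0..x} (\<lambda>s. q i k s * (wave lam (R i x - R i s) * Y k s))"
        using Suc.prems k M by (intro duhamel_integrable[where M = M] Y) auto
      have int_it: "set_integrable lborel {0..x} (\<lambda>s. q i k s * (wave lam (R i x - R i s) * iter lam m k s))" for m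
      proof (rule duhamel_integrable)
        fix s assume s: "0 \<le> s" "s \<le> x"
        have "norm (iter lam m k s) \<le> amp lam ^ Suc m * (\<Sum>k<n. norm (a k)) * (age s ^ m / fact m)"
          using s Suc.prems k by (intro iter_bound) auto
        also have "\<dots> \<le> amp lam ^ Suc m * (\<Sum>k<n. norm (a k)) * (age l ^ m / fact m)"
          using s Suc.prems age_mono[of s l] age_nonneg[of s] amp_nonneg
          by (intro mult_left_mono divide_right_mono power_mono mult_nonneg_nonneg sum_nonneg) simp_all
        finally show "norm (iter lam m k s) \<le> amp lam ^ Suc m * (\<Sum>k<n. norm (a k)) * (age l ^ m / fact m)" .
      qed (use Suc.prems k in \<open>simp_all add: iter_measurable\<close>)
      have "duhamel lam i k (r k) x = (LBINT s:{0..x}. q i k s * (wave lam (R i x - R i s) * Y k s)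
          - (\<Sum>m<N. q i k s * (wave lam (R i x - R i s) * iter lam m k s)))"
        unfolding duhamel_def r_def by (simp add: right_diff_distrib sum_distrib_left)
      also have "\<dots> = (LBINT s:{0..x}. q i k s * (wave lam (R i x - R i s) * Y k s))
          - (LBINT s:{0..x}. (\<Sum>m<N. q i k s * (wave lam (R i x - R i s) * iter lam m k s)))"
      proof (rule set_integral_diff(2)[OF int_Y])
        show "set_integrable lborel {0..x} (\<lambda>s. \<Sum>m<N. q i k s * (wave lam (R i x - R i s) * iter lam m k s))"
          using int_it unfolding set_integrable_def scaleR_sum_right by (intro Bochner_Integration.integrable_sum)
      qed
      also have "(LBINT s:{0..x}. (\<Sum>m<N. q i k s * (wave lam (R i x - R i s) * iter lam m k s)))
          = (\<Sum>m<N. duhamel lam i k (iter lam m k) x)"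
        using int_it unfolding duhamel_def set_lebesgue_integral_def set_integrable_def scaleR_sum_right
        by (intro Bochner_Integration.integral_sum) simp
      finally show ?thesis by (simp only: duhamel_def)
    qed
    \<comment> \<open>The zeroth iterate cancels the free wave of Y, and the shifted iterates
      recombine with the Duhamel terms of Y into those of the preceding remainder.\<close>
    have "Y i x - (\<Sum>m<Suc N. iter lam m i x)
        = - (\<Sum>k<n. duhamel lam i k (Y k) x) - (\<Sum>m<N. iter lam (Suc m) i x)"
      using eq[OF Suc.prems] by (subst sum.lessThan_Suc_shift) (simp del: iter.simps(2))
    also have "(\<Sum>m<N. iter lam (Suc m) i x) = - (\<Sum>k<n. \<Sum>m<N. duhamel lam i k (iter lam m k) x)"
      by (simp add: sum_negf) (rule sum.swap)
    also have "- (\<Sum>k<n. duhamel lam i k (Y k) x) - - (\<Sum>k<n. \<Sum>m<N. duhamel lam i k (iter lam m k) x)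
        = - (\<Sum>k<n. duhamel lam i k (r k) x)"
      by (simp add: split sum_subtractf)
    finally have "norm (Y i x - (\<Sum>m<Suc N. iter lam m i x)) = norm (\<Sum>k<n. duhamel lam i k (r k) x)"
      by (simp only: norm_minus_cancel)
    also have "\<dots> \<le> amp lam * (amp lam ^ N * M) * (age x ^ Suc N / fact (Suc N))"
    proof (rule duhamel_step)
      show "r k \<in> borel_measurable borel" if "k < n" for k
        unfolding r_def using that Y by (intro borel_measurable_diff borel_measurable_sum iter_measurable) auto
      show "norm (r k s) \<le> amp lam ^ N * M * (age s ^ N / fact N)" if "k < n" "0 \<le> s" "s \<le> l" for k s
        unfolding r_def by (rule Suc.IH[OF that])
    qed (use Suc.prems M0 amp_nonneg in simp_all)
    finally show ?case by (simp only: power_Suc mult.assoc)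
  qed
  \<comment> \<open>Up to the factor M these are the terms of the exponential series at
    \<open>amp lam * age x\<close>.\<close>
  have lim: "(\<lambda>N. (amp lam ^ N * M) * (age x ^ N / fact N)) \<longlonglongrightarrow> 0"
  proof -
    have "(\<lambda>N. M * ((amp lam * age x) ^ N /\<^sub>R fact N)) \<longlonglongrightarrow> M * 0"
      by (intro tendsto_mult tendsto_const summable_LIMSEQ_zero summable_exp_generic)
    then show ?thesis by (simp add: power_mult_distrib field_simps)
  qed
  have "(\<lambda>N. Y i x - (\<Sum>m<N. iter lam m i x)) \<longlonglongrightarrow> 0"
    by (rule tendsto_norm_zero_cancel, rule tendsto_sandwich[OF _ _ tendsto_const lim]) (use rem[OF i x] in auto)
  then have "(\<lambda>N. Y i x - (Y i x - (\<Sum>m<N. iter lam m i x))) \<longlonglongrightarrow> Y i x - 0"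
    by (intro tendsto_diff tendsto_const)
  then have "(\<lambda>m. iter lam m i x) sums Y i x" by (simp add: sums_def)
  moreover have "(\<lambda>m. iter lam m i x) sums ((LBINT u. wave lam u * density i (x, u)) + iter lam 0 i x)"
    using density_moment(2)[OF i x] by (rule sums_Suc)
  ultimately have "Y i x = (LBINT u. wave lam u * density i (x, u)) + iter lam 0 i x"
    by (rule sums_unique2)
  then show ?thesis by simp
qed

end

section \<open>Left inverses and variation of constants\<close>

text \<open>Linear independence concerns the set of columns, which cannot see a repeated column. A
  repetition would leave fewer than nc vectors from which to choose an independent set.\<close>

lemma (in vec_space) full_rank_distinct_cols:
  assumes A: "A \<in> carrier_mat n nc" and rank: "rank A = nc"
  shows "distinct (cols A)"
proof (rule ccontr)
  assume nd: "\<not> distinct (cols A)"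
  obtain S where S: "maximal S (\<lambda>T. T \<subseteq> set (cols A) \<and> lin_indpt T)"
    using maximal_exists[of "(\<lambda>T. T \<subseteq> set (cols A) \<and> lin_indpt T)" "card (set (cols A))" "{}"]
    by (meson List.finite_set card_mono empty_iff empty_subsetI finite_lin_indpt2 rev_finite_subset)
  then have "card S \<le> card (set (cols A))" by (simp add: card_mono maximal_def)
  also have "\<dots> < nc"
    using nd A card_length[of "cols A"] card_distinct[of "cols A"] by (auto simp: le_less)
  finally show False
    using rank_card_indpt[OF A S] rank by simp
qed

text \<open>The left inverse is G^{-1} A^H with the Gram matrix G = A^H A. G is invertible because
  v^H G v is the squared length of A v and the columns of A are independent.\<close>

lemma full_rank_left_inverse:
  fixes A :: "nat \<Rightarrow> nat \<Rightarrow> complex"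
  assumes rank: "vec_space.rank d (mat d c (\<lambda>(i, m). A i m)) = c"
  shows "\<exists>L. \<forall>m<c. \<forall>m'<c. (\<Sum>i<d. L m i * A i m') = (if m = m' then 1 else 0)"
proof -
  interpret vec_space "TYPE(complex)" d .
  define M where "M = mat d c (\<lambda>(i, m). A i m)"
  have M: "M \<in> carrier_mat d c" by (simp add: M_def)
  have dist: "distinct (cols M)"
    using full_rank_distinct_cols[OF M] rank by (simp add: M_def)
  have indpt: "lin_indpt (set (cols M))"
    using full_rank_lin_indpt[OF M _ dist] rank by (simp add: M_def)
  define G where "G = mat c c (\<lambda>(m, m'). \<Sum>i<d. cnj (A i m) * A i m')"
  have G: "G \<in> carrier_mat c c" by (simp add: G_def)
  have "det G \<noteq> 0"
  proof
    assume "det G = 0"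
    then obtain v where v: "v \<in> carrier_vec c" "v \<noteq> 0\<^sub>v c" "G *\<^sub>v v = 0\<^sub>v c"
      using det_0_iff_vec_prod_zero_field[OF G] by blast
    define w where "w = (\<lambda>i. \<Sum>m<c. A i m * v $ m)"
    have Gv: "(\<Sum>m'<c. (\<Sum>i<d. cnj (A i m) * A i m') * v $ m') = 0" if "m < c" for m
    proof -
      have "(G *\<^sub>v v) $ m = 0" using v(3) that by simp
      then show ?thesis
        using that v(1) by (simp add: G_def scalar_prod_def atLeast0LessThan)
    qed
    \<comment> \<open>The squared length of w = A v is regrouped until the entries of G v
      appear.\<close>
    have "(\<Sum>i<d. cnj (w i) * w i) = (\<Sum>i<d. \<Sum>m<c. \<Sum>m'<c. cnj (v $ m) * (cnj (A i m) * A i m' * v $ m'))"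
      by (simp only: w_def cnj_sum sum_product complex_cnj_mult) (simp only: ac_simps)
    also have "\<dots> = (\<Sum>m<c. \<Sum>i<d. \<Sum>m'<c. cnj (v $ m) * (cnj (A i m) * A i m' * v $ m'))"
      by (rule sum.swap)
    also have "\<dots> = (\<Sum>m<c. \<Sum>m'<c. \<Sum>i<d. cnj (v $ m) * (cnj (A i m) * A i m' * v $ m'))"
      by (intro sum.cong refl sum.swap)
    also have "\<dots> = (\<Sum>m<c. cnj (v $ m) * (\<Sum>m'<c. (\<Sum>i<d. cnj (A i m) * A i m') * v $ m'))"
      by (simp add: sum_distrib_left sum_distrib_right)
    also have "\<dots> = 0" by (simp add: Gv)
    finally have "(\<Sum>i<d. cnj (w i) * w i) = 0" .
    moreover have "(\<Sum>i<d. cnj (w i) * w i) = of_real (\<Sum>i<d. (norm (w i))\<^sup>2)"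
      by (simp add: complex_norm_square mult.commute del: of_real_power)
    ultimately have "(\<Sum>i<d. (norm (w i))\<^sup>2) = 0"
      by (simp only: of_real_eq_0_iff)
    then have w0: "w i = 0" if "i < d" for i
      using that by (simp add: sum_nonneg_eq_0_iff)
    have "M *\<^sub>v v = 0\<^sub>v d"
    proof (rule eq_vecI)
      fix i assume "i < dim_vec (0\<^sub>v d :: complex vec)"
      then have i: "i < d" by simp
      then have "(M *\<^sub>v v) $ i = w i"
        using v(1) by (simp add: M_def w_def scalar_prod_def atLeast0LessThan)
      then show "(M *\<^sub>v v) $ i = 0\<^sub>v d $ i" using w0[OF i] i by simp
    qed (simp add: M_def)
    then show False using lin_depI[OF M v(1,2) _ dist] indpt by blast
  qed
  \<comment> \<open>The adjugate over the determinant is the inverse of G.\<close>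
  define L where "L = (\<lambda>m i. \<Sum>j<c. adj_mat G $$ (m, j) / det G * cnj (A i j))"
  have "(\<Sum>i<d. L m i * A i m') = (if m = m' then 1 else 0)" if m: "m < c" "m' < c" for m m'
  proof -
    have adj: "adj_mat G \<in> carrier_mat c c" by (rule adj_mat(1)[OF G])
    have "(adj_mat G * G) $$ (m, m') = (det G \<cdot>\<^sub>m 1\<^sub>m c) $$ (m, m')"
      using adj_mat(3)[OF G] by simp
    then have *: "(\<Sum>j<c. adj_mat G $$ (m, j) * (\<Sum>i<d. cnj (A i j) * A i m')) = (if m = m' then det G else 0)"
      using m adj carrier_matD[OF adj] by (simp add: scalar_prod_def atLeast0LessThan G_def)
    have "(\<Sum>i<d. L m i * A i m') = (\<Sum>i<d. \<Sum>j<c. adj_mat G $$ (m, j) * (cnj (A i j) * A i m') / det G)"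
      by (simp add: L_def sum_distrib_right mult.assoc)
    also have "\<dots> = (\<Sum>j<c. \<Sum>i<d. adj_mat G $$ (m, j) * (cnj (A i j) * A i m') / det G)"
      by (rule sum.swap)
    also have "\<dots> = (\<Sum>j<c. adj_mat G $$ (m, j) * (\<Sum>i<d. cnj (A i j) * A i m')) / det G"
      by (simp add: sum_distrib_left sum_divide_distrib)
    finally show ?thesis using * \<open>det G \<noteq> 0\<close> by simp
  qed
  then show ?thesis by blast
qed

text \<open>The product rule for absolutely continuous functions, in integral form. The product of
  the integrals of both derivatives is an integral over a square, whose two triangles give the two
  terms of the rule.\<close>

lemma integral_product_rule:
  fixes f f' g g' :: "real \<Rightarrow> complex"
  assumes f': "set_integrable lborel {0..x} f'" and g': "set_integrable lborel {0..x} g'"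
    and f: "\<And>t. 0 \<le> t \<Longrightarrow> t \<le> x \<Longrightarrow> f t = f0 + (LBINT s:{0..t}. f' s)"
    and g: "\<And>t. 0 \<le> t \<Longrightarrow> t \<le> x \<Longrightarrow> g t = g0 + (LBINT s:{0..t}. g' s)"
    and x: "0 \<le> x"
  shows "f x * g x = f0 * g0 + (LBINT t:{0..x}. f' t * g t + f t * g' t)"
proof -
  define F where "F = (\<lambda>t. indicator {0..x} t *\<^sub>R f' t)"
  define G where "G = (\<lambda>t. indicator {0..x} t *\<^sub>R g' t)"
  have F: "integrable lborel F" and G: "integrable lborel G"
    using f' g' by (simp_all add: F_def G_def set_integrable_def)
  have [measurable]: "F \<in> borel_measurable borel" "G \<in> borel_measurable borel"
    using F G by (simp_all add: borel_measurable_integrable)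
  \<comment> \<open>Both triangles contain the diagonal, which meets each line in a null
    set.\<close>
  define H where "H = (\<lambda>t s. if t \<le> s then F t * G s else 0)"
  define K where "K = (\<lambda>t s. if s \<le> t then F t * G s else 0)"
  have FG: "integrable (lborel \<Otimes>\<^sub>M lborel) (\<lambda>(t, s). F t * G s)"
    using lborel_pair.integrable_product_swap_iff F G
    by (intro lborel_pair.Fubini_integrable) (simp_all add: norm_mult)
  have H: "integrable (lborel \<Otimes>\<^sub>M lborel) (case_prod H)" and K: "integrable (lborel \<Otimes>\<^sub>M lborel) (case_prod K)"
    by (rule Bochner_Integration.integrable_bound[OF FG]; auto simp: H_def K_def)+
  define P where "P = (\<lambda>t. LBINT s. if s \<le> t then G s else 0)"
  define Q where "Q = (\<lambda>s. LBINT t. if t \<le> s then F t else 0)"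
  have iK: "(LBINT s. K t s) = F t * P t" for t
  proof -
    have "K t s = F t * (if s \<le> t then G s else 0)" for s by (simp add: K_def)
    then show ?thesis by (simp add: P_def)
  qed
  have iH: "(LBINT t. H t s) = Q s * G s" for s
  proof -
    have "H t s = (if t \<le> s then F t else 0) * G s" for t by (simp add: H_def)
    then show ?thesis by (simp add: Q_def)
  qed
  have intFP: "integrable lborel (\<lambda>t. F t * P t)"
    using lborel_pair.integrable_fst[OF K] by (simp add: iK)
  have intQG: "integrable lborel (\<lambda>s. Q s * G s)"
    using lborel_pair.integrable_snd[OF H] by (simp add: iH)
  have KH: "(LBINT s. K t s) + (LBINT s. H t s) = F t * (LBINT s. G s)" for t
  proof -
    have Gi: "integrable lborel (\<lambda>s. if s \<le> t then G s else 0)" "integrable lborel (\<lambda>s. if t \<le> s then G s else 0)"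
      by (rule Bochner_Integration.integrable_bound[OF G]; simp)+
    have KHt: "K t = (\<lambda>s. F t * (if s \<le> t then G s else 0))" "H t = (\<lambda>s. F t * (if t \<le> s then G s else 0))"
      by (auto simp: K_def H_def)
    have i: "integrable lborel (K t)" "integrable lborel (H t)"
      unfolding KHt by (intro integrable_mult_right Gi)+
    have "(LBINT s. K t s) + (LBINT s. H t s) = (LBINT s. K t s + H t s)"
      using i by simp
    also have "\<dots> = (LBINT s. F t * G s)"
    proof (rule integral_cong_AE)
      show "AE s in lborel. K t s + H t s = F t * G s"
        using AE_lborel_singleton[of t] by eventually_elim (auto simp: K_def H_def)
    qed (use i in \<open>auto intro: borel_measurable_integrable\<close>)
    finally show ?thesis by simp
  qed
  have "(LBINT t. F t * P t) + (LBINT s. Q s * G s) = (LBINT t. LBINT s. K t s) + (LBINT s. LBINT t. H t s)"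
    by (simp add: iK iH)
  also have "(LBINT s. LBINT t. H t s) = (LBINT t. LBINT s. H t s)"
    by (rule lborel_pair.Fubini_integral[OF H])
  also have "(LBINT t. LBINT s. K t s) + (LBINT t. LBINT s. H t s) = (LBINT t. (LBINT s. K t s) + (LBINT s. H t s))"
    using lborel_pair.integrable_fst[OF K] lborel_pair.integrable_fst[OF H] by simp
  also have "\<dots> = (LBINT t. F t) * (LBINT s. G s)"
    by (simp add: KH)
  finally have key: "(LBINT t. F t * P t) + (LBINT s. Q s * G s) = (LBINT t. F t) * (LBINT s. G s)" .
  have gP: "g t = g0 + P t" and fQ: "f t = f0 + Q t" if "0 \<le> t" "t \<le> x" for t
  proof -
    have "(LBINT s:{0..t}. g' s) = P t" "(LBINT s:{0..t}. f' s) = Q t"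
      unfolding set_lebesgue_integral_def P_def Q_def G_def F_def
      using that by (auto intro!: Bochner_Integration.integral_cong simp: indicator_def)
    then show "g t = g0 + P t" "f t = f0 + Q t" using f g that by simp_all
  qed
  have "(LBINT t:{0..x}. f' t * g t + f t * g' t) = (LBINT t. (F t * g0 + F t * P t) + (f0 * G t + Q t * G t))"
    unfolding set_lebesgue_integral_def
    by (intro Bochner_Integration.integral_cong refl) (auto simp: F_def G_def indicator_def gP fQ algebra_simps)
  also have "\<dots> = (LBINT t. F t) * g0 + (LBINT t. F t * P t) + (f0 * (LBINT t. G t) + (LBINT t. Q t * G t))"
    using F G intFP intQG by simp
  also have "\<dots> = (LBINT t. F t) * g0 + f0 * (LBINT t. G t) + (LBINT t. F t) * (LBINT t. G t)"
    using key by (simp add: algebra_simps)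
  finally have "f0 * g0 + (LBINT t:{0..x}. f' t * g t + f t * g' t) = (f0 + (LBINT t. F t)) * (g0 + (LBINT t. G t))"
    by (simp add: algebra_simps)
  also have "\<dots> = f x * g x"
    using f[of x] g[of x] x by (simp add: F_def G_def set_lebesgue_integral_def)
  finally show ?thesis ..
qed

text \<open>\<open>b\<close> is only locally integrable, so the substitution u =
  \<open>prim b s\<close> takes the place of the chain rule; afterwards the fundamental theorem is
  applied to a smooth exponential.\<close>

lemma (in speed) exp_prim_eq:
  fixes c :: complex
  assumes x: "0 \<le> x"
  shows "exp (c * complex_of_real (prim b x)) = 1 + (LBINT s:{0..x}. c * of_real (b s) * exp (c * of_real (prim b s)))"
proof -
  define z where "z = direction * prim b x"
  have z: "0 \<le> z" using le_iff[of 0 x] x by (simp add: z_def)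
  \<comment> \<open>The substitution produces |b|. The factor \<open>direction\<close> restores
    \<open>b\<close>, and the argument \<open>direction * u\<close> orients the range as
    [0, z].\<close>
  define f where "f = (\<lambda>u. of_real direction * (indicator {0..z} (direction * u) *\<^sub>R (c * exp (c * complex_of_real u))))"
  have [measurable]: "f \<in> borel_measurable borel"
  proof -
    have "f = (\<lambda>u. of_real direction * (if 0 \<le> direction * u \<and> direction * u \<le> z then c * exp (c * complex_of_real u) else 0))"
      by (auto simp: f_def fun_eq_iff indicator_def)
    then show ?thesis by simp
  qed
  have ind: "indicator {0..z} (direction * prim b s) = (indicator {0..x} s :: real)" for s
    using le_iff[of 0 s] le_iff[of s x] by (simp add: indicator_def z_def)
  have dd: "direction * direction = 1" by (simp add: direction_def)
  have dc: "complex_of_real direction * (complex_of_real direction * w) = w" for w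
    by (simp add: mult.assoc[symmetric] of_real_mult[symmetric] dd del: of_real_mult)
  have "(LBINT s:{0..x}. c * of_real (b s) * exp (c * of_real (prim b s))) = (LBINT s. \<bar>b s\<bar> *\<^sub>R f (prim b s))"
    unfolding set_lebesgue_integral_def f_def ind
    by (intro Bochner_Integration.integral_cong refl)
      (simp add: abs_eq scaleR_conv_of_real dc ac_simps)
  also have "\<dots> = (LBINT u. f u)" by (rule integral_prim(1)) simp
  also have "\<dots> = (LBINT u. f (0 + direction * u))"
  proof -
    have "direction \<noteq> 0" "\<bar>direction\<bar> = 1" by (simp_all add: direction_def)
    then show ?thesis using lborel_integral_real_affine[of direction f 0] by simp
  qed
  also have "\<dots> = (LBINT u. indicator {0..z} u *\<^sub>R (c * of_real direction * exp (c * of_real direction * complex_of_real u)))"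
  proof (intro Bochner_Integration.integral_cong refl)
    fix u
    have "direction * (0 + direction * u) = u" by (simp add: mult.assoc[symmetric] dd)
    then have "f (0 + direction * u) = of_real direction * (indicator {0..z} u *\<^sub>R (c * exp (c * complex_of_real (0 + direction * u))))"
      by (simp only: f_def)
    then show "f (0 + direction * u) = indicator {0..z} u *\<^sub>R (c * of_real direction * exp (c * of_real direction * complex_of_real u))"
      by (simp add: ac_simps)
  qed
  also have "\<dots> = exp (c * of_real direction * complex_of_real z) - exp (c * of_real direction * complex_of_real 0)"
  proof (rule integral_FTC_Icc[OF z])
    show "((\<lambda>u. exp (c * of_real direction * complex_of_real u)) has_vector_derivative
        c * of_real direction * exp (c * of_real direction * complex_of_real u)) (at u within {0..z})" for u
    proof (rule has_vector_derivative_real_field)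
      show "((\<lambda>u. exp (c * of_real direction * u)) has_field_derivative
          c * of_real direction * exp (c * of_real direction * complex_of_real u)) (at (of_real u))"
        by (rule DERIV_cong[OF DERIV_chain2[OF DERIV_exp DERIV_cmult_Id]]) (rule mult.commute)
    qed
    show "continuous_on {0..z} (\<lambda>u. c * of_real direction * exp (c * of_real direction * complex_of_real u))"
      by (intro continuous_intros)
  qed
  also have "c * of_real direction * complex_of_real z = c * complex_of_real (direction * z)"
    by simp
  also have "direction * z = prim b x" by (simp add: z_def mult.assoc[symmetric] dd)
  finally show ?thesis by simp
qed

text \<open>Multiplication by the integrating factor e: in the product rule the terms with c b
  cancel.\<close>

lemma (in speed) variation_of_constants:
  fixes c :: complex
  assumes [measurable]: "y \<in> borel_measurable borel"
    and M: "\<And>s. 0 \<le> s \<Longrightarrow> s \<le> l \<Longrightarrow> norm (y s) \<le> M"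
    and w: "set_integrable lborel {0..l} w"
    and eq: "\<And>t. 0 \<le> t \<Longrightarrow> t \<le> l \<Longrightarrow> y t = y0 + (LBINT s:{0..t}. c * of_real (b s) * y s - w s)"
    and x: "0 \<le> x" "x \<le> l"
  shows "y x = exp (c * of_real (prim b x)) * y0
     - (LBINT s:{0..x}. exp (c * of_real (prim b x - prim b s)) * w s)"
proof -
  define e where "e = (\<lambda>t. exp (- c * complex_of_real (prim b t)))"
  have e_cont: "continuous_on {0..x} e"
    unfolding e_def by (intro continuous_intros cont)
  have [measurable]: "e \<in> borel_measurable borel" unfolding e_def by measurable
  have bint: "set_integrable lborel {0..x} (\<lambda>s. c * of_real (b s) * h s)"
    if "h \<in> borel_measurable borel" "\<And>s. 0 \<le> s \<Longrightarrow> s \<le> x \<Longrightarrow> norm (h s) \<le> B" for h B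
  proof (rule set_integrable_mult_bounded[where M = B])
    have "set_integrable lborel {0..x} (\<lambda>s. complex_of_real (b s))"
      using integrable_of_real[where 'a = complex, OF loc[of 0 x, unfolded set_integrable_def]]
      by (simp add: set_integrable_def scaleR_conv_of_real)
    then show "set_integrable lborel {0..x} (\<lambda>s. c * of_real (b s))"
      by (rule set_integrable_mult_right)
  qed (use that in simp_all)
  have "compact (e ` {0..x})" by (rule compact_continuous_image[OF e_cont]) simp
  then obtain B where B: "\<And>s. 0 \<le> s \<Longrightarrow> s \<le> x \<Longrightarrow> norm (e s) \<le> B"
    by (meson atLeastAtMost_iff bounded_iff compact_imp_bounded imageI)
  have w': "set_integrable lborel {0..x} w"
    using x by (intro set_integrable_subset[OF w]) auto
  have yint: "set_integrable lborel {0..x} (\<lambda>s. c * of_real (b s) * y s - w s)"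
    using x M by (intro set_integral_diff(1) w' bint[of y M]) auto
  have eint: "set_integrable lborel {0..x} (\<lambda>s. - c * of_real (b s) * e s)"
    using set_integrable_mult_right[OF bint[of e B], of "-1"] B by simp
  have "y x * e x = y0 * 1 + (LBINT t:{0..x}. (c * of_real (b t) * y t - w t) * e t + y t * (- c * of_real (b t) * e t))"
  proof (rule integral_product_rule[OF yint eint])
    show "e t = 1 + (LBINT s:{0..t}. - c * of_real (b s) * e s)" if "0 \<le> t" for t
      using exp_prim_eq[OF that, of "- c"] by (simp add: e_def)
  qed (use eq x in auto)
  also have "(LBINT t:{0..x}. (c * of_real (b t) * y t - w t) * e t + y t * (- c * of_real (b t) * e t))
      = (LBINT t:{0..x}. - (e t * w t))"
    by (intro set_lebesgue_integral_cong) (simp_all add: algebra_simps)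
  also have "\<dots> = - (LBINT t:{0..x}. e t * w t)"
    by (simp add: set_lebesgue_integral_def)
  finally have ye: "y x * e x = y0 - (LBINT t:{0..x}. e t * w t)" by simp
  have "exp (c * of_real (prim b x)) * e x = 1"
    by (simp add: e_def exp_minus)
  then have "y x = exp (c * of_real (prim b x)) * (y x * e x)"
    by (simp add: ac_simps)
  also have "\<dots> = exp (c * of_real (prim b x)) * y0 - exp (c * of_real (prim b x)) * (LBINT t:{0..x}. e t * w t)"
    by (simp add: ye right_diff_distrib)
  also have "exp (c * of_real (prim b x)) * (LBINT t:{0..x}. e t * w t)
      = (LBINT t:{0..x}. exp (c * of_real (prim b x)) * (e t * w t))"
    by (rule set_integral_mult_right[symmetric])
  also have "\<dots> = (LBINT s:{0..x}. exp (c * of_real (prim b x - prim b s)) * w s)"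
  proof (intro set_lebesgue_integral_cong allI impI)
    fix s
    have "c * of_real (prim b x - prim b s) = c * of_real (prim b x) + - c * of_real (prim b s)"
      by (simp add: right_diff_distrib)
    then show "exp (c * of_real (prim b x)) * (e s * w s) = exp (c * of_real (prim b x - prim b s)) * w s"
      by (simp only: e_def exp_add mult.assoc)
  qed simp
  finally show ?thesis .
qed

section \<open>Blocks, Borel representatives and the function spaces\<close>

lemma sum_take_mono: "j \<le> k \<Longrightarrow> sum_list (take j ns) \<le> sum_list (take k (ns :: nat list))"
  by (metis le_add1 le_add_diff_inverse sum_list_append take_add)

lemma blk_eqI:
  assumes "sum_list (take k ns) \<le> i" "i < sum_list (take (Suc k) ns)"
  shows "blk ns i = k"
  unfolding blk_def
proof (rule Least_equality[where P = "\<lambda>k. i < sum_list (take (Suc k) ns)", OF assms(2)])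
  fix y assume y: "i < sum_list (take (Suc y) ns)"
  show "k \<le> y"
  proof (rule ccontr)
    assume "\<not> k \<le> y"
    then have "sum_list (take (Suc y) ns) \<le> sum_list (take k ns)" by (intro sum_take_mono) simp
    then show False using y assms(1) by simp
  qed
qed

lemma blk_bounds:
  assumes i: "i < sum_list ns"
  shows "blk ns i < length ns" "sum_list (take (blk ns i) ns) \<le> i" "i < sum_list (take (Suc (blk ns i)) ns)"
proof -
  have ne: "0 < length ns" using i by (cases ns) auto
  then have last: "i < sum_list (take (Suc (length ns - 1)) ns)" using i by simp
  then have "blk ns i \<le> length ns - 1" unfolding blk_def by (rule Least_le)
  then show "blk ns i < length ns" using ne by linarith
  show "i < sum_list (take (Suc (blk ns i)) ns)"
    unfolding blk_def by (rule LeastI[of "\<lambda>k. i < sum_list (take (Suc k) ns)", OF last])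
  show "sum_list (take (blk ns i) ns) \<le> i"
  proof (cases "blk ns i")
    case (Suc k)
    then have "\<not> i < sum_list (take (Suc k) ns)"
      unfolding blk_def by (metis lessI not_less_Least)
    then show ?thesis using Suc by simp
  qed simp
qed

text \<open>Matches the global index of the kernel with the index inside a block that the rank
  hypothesis uses.\<close>

lemma sum_blk:
  fixes f :: "nat \<Rightarrow> 'a::comm_monoid_add"
  assumes k: "k < length ns"
  shows "(\<Sum>j<sum_list ns. if blk ns j = k then f j else 0) = (\<Sum>i<ns ! k. f (sum_list (take k ns) + i))"
proof -
  have Suc: "sum_list (take (Suc k) ns) = sum_list (take k ns) + ns ! k"
    using k by (simp add: take_Suc_conv_app_nth)
  have le: "sum_list (take (Suc k) ns) \<le> sum_list ns"
    using sum_take_mono[of "Suc k" "length ns" ns] k by simp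
  have "{j \<in> {..<sum_list ns}. blk ns j = k} = {sum_list (take k ns)..<sum_list (take k ns) + ns ! k}"
  proof (rule Set.set_eqI, rule iffI)
    fix j assume "j \<in> {j \<in> {..<sum_list ns}. blk ns j = k}"
    then show "j \<in> {sum_list (take k ns)..<sum_list (take k ns) + ns ! k}"
      using blk_bounds(2,3)[of j ns] Suc by auto
  next
    fix j assume "j \<in> {sum_list (take k ns)..<sum_list (take k ns) + ns ! k}"
    then show "j \<in> {j \<in> {..<sum_list ns}. blk ns j = k}"
      using blk_eqI[of k ns j] Suc le by auto
  qed
  then have "(\<Sum>j<sum_list ns. if blk ns j = k then f j else 0) = sum f {sum_list (take k ns)..<sum_list (take k ns) + ns ! k}"
    by (simp add: sum.inter_filter[symmetric])
  also have "\<dots> = (\<Sum>i<ns ! k. f (sum_list (take k ns) + i))"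
    by (rule sum.reindex_bij_witness[of _ "\<lambda>i. sum_list (take k ns) + i" "\<lambda>j. j - sum_list (take k ns)"]) auto
  finally show ?thesis .
qed

section \<open>Borel representatives of Lebesgue measurable data\<close>

lemma measurable_lebesgue_AE:
  fixes f g :: "real \<Rightarrow> 'b::topological_space"
  assumes f: "f \<in> borel_measurable borel" and eq: "AE x in lborel. f x = g x"
  shows "g \<in> borel_measurable lebesgue"
proof (rule measurableI)
  fix A :: "'b set" assume A: "A \<in> sets borel"
  obtain N where N: "\<And>x. x \<notin> N \<Longrightarrow> f x = g x" "N \<in> null_sets lborel"
    using AE_E3[OF eq] by auto
  have fA: "f -` A \<in> sets lborel"
    using measurable_sets[OF f A] by simp
  have gN: "g -` A \<inter> N \<in> sets lebesgue"
    by (rule sets_completionI_sub[OF N(2)]) simp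
  have fN: "f -` A - N \<in> sets lebesgue"
    using fA N(2) by (intro sets_completionI_sets sets.Diff) auto
  have "g -` A \<inter> space lebesgue = (f -` A - N) \<union> (g -` A \<inter> N)"
    using N(1) by auto
  then show "g -` A \<inter> space lebesgue \<in> sets lebesgue"
    using sets.Un[OF fN gN] by (simp only:)
qed simp

text \<open>The theorem speaks of Lebesgue integrals, the analysis of Borel functions; this is the
  bridge. Completeness of Lebesgue measure makes the function g measurable.\<close>

lemma lebesgue_set_integral_AE:
  fixes g h :: "real \<Rightarrow> 'b::{banach, second_countable_topology}"
  assumes h [measurable]: "h \<in> borel_measurable borel" and S [measurable]: "S \<in> sets borel"
    and eq: "AE x in lborel. x \<in> S \<longrightarrow> g x = h x"
  shows "set_integrable lebesgue S g \<longleftrightarrow> set_integrable lborel S h"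
    and "(LINT x:S|lebesgue. g x) = (LBINT x:S. h x)"
proof -
  have hm: "(\<lambda>x. indicator S x *\<^sub>R h x) \<in> borel_measurable borel" by measurable
  have ae: "AE x in lborel. indicator S x *\<^sub>R h x = indicator S x *\<^sub>R g x"
    using eq by eventually_elim (auto simp: indicator_def)
  have gm: "(\<lambda>x. indicator S x *\<^sub>R g x) \<in> borel_measurable lebesgue"
    by (rule measurable_lebesgue_AE[OF hm ae])
  have hmL: "(\<lambda>x. indicator S x *\<^sub>R h x) \<in> borel_measurable lborel"
    using hm by simp
  then have hm': "(\<lambda>x. indicator S x *\<^sub>R h x) \<in> borel_measurable lebesgue"
    by (rule measurable_completion)
  from AE_completion[OF ae] have ae': "AE x in lebesgue. indicator S x *\<^sub>R g x = indicator S x *\<^sub>R h x"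
    by eventually_elim (rule sym)
  show "set_integrable lebesgue S g \<longleftrightarrow> set_integrable lborel S h"
    unfolding set_integrable_def
    using integrable_cong_AE[OF gm hm' ae'] integrable_completion[OF hmL] by (rule trans)
  show "(LINT x:S|lebesgue. g x) = (LBINT x:S. h x)"
    unfolding set_lebesgue_integral_def
    using integral_cong_AE[OF gm hm' ae'] integral_completion[OF hmL] by (rule trans)
qed

lemma lebesgue_borel_version_real:
  fixes f :: "real \<Rightarrow> real"
  assumes "f \<in> borel_measurable lebesgue"
  obtains g where "g \<in> borel_measurable borel" "AE x in lborel. f x = g x"
  using completion_ex_borel_measurable_real[OF assms] by auto

text \<open>The representative vanishes almost everywhere off S, hence is integrable on the whole
  line, as the coefficients of the Volterra operators are.\<close>

lemma lebesgue_borel_version_complex: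
  fixes f :: "real \<Rightarrow> complex"
  assumes f: "set_integrable lebesgue S f" and S: "S \<in> sets borel"
  obtains g where "integrable lborel g" "AE x in lborel. x \<in> S \<longrightarrow> g x = f x"
proof -
  have i: "integrable lebesgue (\<lambda>x. indicator S x *\<^sub>R f x)" using f by (simp add: set_integrable_def)
  have "(\<lambda>x. Re (indicator S x *\<^sub>R f x)) \<in> borel_measurable lebesgue"
    by (rule measurable_compose[OF borel_measurable_integrable[OF i]
          borel_measurable_continuous_onI[OF continuous_on_Re[OF continuous_on_id]]])
  then obtain p where [measurable]: "p \<in> borel_measurable borel"
    and p: "AE x in lborel. Re (indicator S x *\<^sub>R f x) = p x"
    by (rule lebesgue_borel_version_real)
  have "(\<lambda>x. Im (indicator S x *\<^sub>R f x)) \<in> borel_measurable lebesgue"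
    by (rule measurable_compose[OF borel_measurable_integrable[OF i]
          borel_measurable_continuous_onI[OF continuous_on_Im[OF continuous_on_id]]])
  then obtain q where [measurable]: "q \<in> borel_measurable borel"
    and q: "AE x in lborel. Im (indicator S x *\<^sub>R f x) = q x"
    by (rule lebesgue_borel_version_real)
  define g where "g = (\<lambda>x. Complex (p x) (q x))"
  have [measurable]: "g \<in> borel_measurable borel"
  proof -
    have "g = (\<lambda>x. complex_of_real (p x) + \<i> * complex_of_real (q x))"
      by (simp add: g_def fun_eq_iff Complex_eq)
    then show ?thesis by simp
  qed
  have eq: "AE x in lborel. indicator S x *\<^sub>R f x = g x"
    using p q by eventually_elim (simp add: g_def complex_eq_iff)
  then have "integrable lborel g"
    using lebesgue_set_integral_AE(1)[of g UNIV "\<lambda>x. indicator S x *\<^sub>R f x"] i by (simp add: set_integrable_def)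
  moreover have "AE x in lborel. x \<in> S \<longrightarrow> g x = f x"
    using eq by eventually_elim (auto simp: indicator_def)
  ultimately show ?thesis by (rule that)
qed

section \<open>From strips in (x, u) to the spaces and integrals in (x, t)\<close>

lemma Omega_pred [measurable]: "Measurable.pred borel (\<lambda>p. p \<in> Omega l)"
  unfolding Omega_def case_prod_beta' mem_Collect_eq by measurable

lemma indicator_Omega_measurable [measurable]:
  "(indicator (Omega l) :: real \<times> real \<Rightarrow> ennreal) \<in> borel_measurable borel"
  by (rule borel_measurable_indicator) (use Omega_pred[of l] in \<open>simp add: pred_def\<close>)

lemma esssup_le:
  fixes f :: "real \<Rightarrow> ennreal"
  assumes "f \<in> borel_measurable borel" and le: "\<And>x. 0 \<le> x \<Longrightarrow> x \<le> l \<Longrightarrow> f x \<le> c"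
  shows "esssup (restrict_space lborel {0..l}) f \<le> c"
proof -
  have m: "f \<in> borel_measurable (restrict_space lborel {0..l})"
    using assms(1) by (intro measurable_restrict_space1) simp
  have "AE x in restrict_space lborel {0..l}. f x \<le> c"
    using le by (intro AE_I2) (simp add: space_restrict_space)
  then show ?thesis
    unfolding esssup_eq_AE[OF m] by (intro Inf_lower) simp
qed

text \<open>The substitution u = \<open>prim b t\<close> maps t = const to u = const, so horizontal
  strips bound the X_1 norm directly; on x = const dropping the Jacobian costs 1 / \<theta>.
  Composition with the continuous \<open>prim b\<close> keeps the approximants continuous.\<close>

lemma approximable_X:
  assumes F: "approximable l F" and b: "speed b \<theta>"
  shows "X1_0 l (\<lambda>p. F (fst p, prim b (snd p)))" "Xinf_0 l (\<lambda>p. F (fst p, prim b (snd p)))"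
proof -
  interpret speed b \<theta> by fact
  have [measurable]: "F \<in> borel_measurable borel" using F by (simp add: approximable_def)
  have m: "(\<lambda>p. F (fst p, prim b (snd p))) \<in> borel_measurable borel" by measurable
  have main: "\<exists>g. continuous_on (Omega l) g \<and> X1_norm l (\<lambda>p. F (fst p, prim b (snd p)) - g p) < ennreal \<epsilon>
      \<and> Xinf_norm l (\<lambda>p. F (fst p, prim b (snd p)) - g p) < ennreal \<epsilon>" if \<epsilon>: "0 < \<epsilon>" for \<epsilon>
  proof -
    define W where "W = 1 + 1 / \<theta>"
    have W: "1 \<le> W" "1 / \<theta> \<le> W" using pos by (simp_all add: W_def)
    define e where "e = \<epsilon> / (2 * W)"
    have e: "0 < e" using \<epsilon> W by (simp add: e_def)
    have eW: "1 / \<theta> * e < \<epsilon>" "e < \<epsilon>"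
    proof -
      have "W * e = \<epsilon> / 2" using W by (simp add: e_def)
      then show "1 / \<theta> * e < \<epsilon>" "e < \<epsilon>"
        using mult_right_mono[OF W(1), of e] mult_right_mono[OF W(2), of e] e \<epsilon> by auto
    qed
    obtain g where g: "continuous_on UNIV g"
      "\<And>M. M \<in> strips l \<Longrightarrow> (\<integral>\<^sup>+p. norm (F p - g p) \<partial>M) \<le> ennreal e"
      using approximableD[OF F e] by blast
    have [measurable]: "g \<in> borel_measurable borel"
      using g by (simp add: borel_measurable_continuous_onI)
    have str: "\<And>x. x \<in> {0..l} \<Longrightarrow> (\<integral>\<^sup>+u. norm (F (x, u) - g (x, u)) \<partial>lborel) \<le> ennreal e"
      "\<And>u. (\<integral>\<^sup>+x. indicator {0..l} x * ennreal (norm (F (x, u) - g (x, u))) \<partial>lborel) \<le> ennreal e"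
      using g(2) strips_all[of "\<lambda>p. ennreal (norm (F p - g p))" l "ennreal e"] by auto
    define G where "G = (\<lambda>p. g (fst p, prim b (snd p)))"
    have "continuous_on UNIV (\<lambda>p::real \<times> real. prim b (snd p))"
      by (rule continuous_on_compose2[OF cont[of UNIV]]) (auto intro: continuous_intros)
    then have Gc: "continuous_on UNIV G"
      unfolding G_def by (intro continuous_on_compose2[OF g(1)] continuous_on_Pair continuous_intros) simp_all
    then have [measurable]: "G \<in> borel_measurable borel" by (rule borel_measurable_continuous_onI)
    have "X1_norm l (\<lambda>p. F (fst p, prim b (snd p)) - G p) \<le> ennreal e"
      unfolding X1_norm_def
    proof (rule esssup_le)
      show "(\<lambda>t. \<integral>\<^sup>+x. indicator (Omega l) (x, t) * ennreal (norm (F (fst (x, t), prim b (snd (x, t))) - G (x, t))) \<partial>lborel) \<in> borel_measurable borel"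
        unfolding fst_conv snd_conv by measurable
      fix t
      have "(\<integral>\<^sup>+x. indicator (Omega l) (x, t) * ennreal (norm (F (fst (x, t), prim b (snd (x, t))) - G (x, t))) \<partial>lborel)
        \<le> (\<integral>\<^sup>+x. indicator {0..l} x * ennreal (norm (F (x, prim b t) - g (x, prim b t))) \<partial>lborel)"
        by (intro nn_integral_mono) (auto simp: G_def Omega_def indicator_def)
      also have "\<dots> \<le> ennreal e" by (rule str)
      finally show "(\<integral>\<^sup>+x. indicator (Omega l) (x, t) * ennreal (norm (F (fst (x, t), prim b (snd (x, t))) - G (x, t))) \<partial>lborel) \<le> ennreal e" .
    qed
    also have "\<dots> < ennreal \<epsilon>" using eW(2) e by (simp add: ennreal_less_iff)
    finally have n1: "X1_norm l (\<lambda>p. F (fst p, prim b (snd p)) - G p) < ennreal \<epsilon>" .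
    have "Xinf_norm l (\<lambda>p. F (fst p, prim b (snd p)) - G p) \<le> ennreal (1 / \<theta> * e)"
      unfolding Xinf_norm_def
    proof (rule esssup_le)
      show "(\<lambda>x. \<integral>\<^sup>+t. indicator (Omega l) (x, t) * ennreal (norm (F (fst (x, t), prim b (snd (x, t))) - G (x, t))) \<partial>lborel) \<in> borel_measurable borel"
        unfolding fst_conv snd_conv by measurable
      fix x assume x: "0 \<le> x" "x \<le> l"
      have "(\<integral>\<^sup>+t. indicator (Omega l) (x, t) * ennreal (norm (F (fst (x, t), prim b (snd (x, t))) - G (x, t))) \<partial>lborel)
        \<le> (\<integral>\<^sup>+t. ennreal (norm (F (x, prim b t) - g (x, prim b t))) \<partial>lborel)"
        by (intro nn_integral_mono) (simp add: G_def indicator_def)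
      also have "\<dots> \<le> ennreal (1 / \<theta>) * (\<integral>\<^sup>+u. ennreal (norm (F (x, u) - g (x, u))) \<partial>lborel)"
        by (rule nn_integral_prim_le[of "\<lambda>u. ennreal (norm (F (x, u) - g (x, u)))"]) measurable
      also have "\<dots> \<le> ennreal (1 / \<theta>) * ennreal e"
        using str(1) x by (intro mult_left_mono) simp_all
      also have "\<dots> = ennreal (1 / \<theta> * e)"
        using pos by (intro ennreal_mult'[symmetric]) simp
      finally show "(\<integral>\<^sup>+t. indicator (Omega l) (x, t) * ennreal (norm (F (fst (x, t), prim b (snd (x, t))) - G (x, t))) \<partial>lborel) \<le> ennreal (1 / \<theta> * e)" .
    qed
    also have "\<dots> < ennreal \<epsilon>" using eW(1) e pos by (intro ennreal_lessI \<epsilon>)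
    finally have "Xinf_norm l (\<lambda>p. F (fst p, prim b (snd p)) - G p) < ennreal \<epsilon>" .
    with n1 Gc show ?thesis using continuous_on_subset by blast
  qed
  show "X1_0 l (\<lambda>p. F (fst p, prim b (snd p)))" "Xinf_0 l (\<lambda>p. F (fst p, prim b (snd p)))"
    unfolding X1_0_def Xinf_0_def using m main by blast+
qed

lemma X_0:
  assumes "0 < l" shows "X1_0 l (\<lambda>_. 0)" "Xinf_0 l (\<lambda>_. 0)"
proof -
  have "speed (\<lambda>_. 1) 1"
    by standard (simp_all add: set_integrable_def integrable_real_indicator emeasure_lborel_Icc_eq)
  from approximable_X[OF approximable_0 this]
  show "X1_0 l (\<lambda>_. 0)" "Xinf_0 l (\<lambda>_. 0)" by simp_all
qed

lemma prim_increment_mono: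
  assumes "\<And>x y. set_integrable lborel {x..y} b" "\<And>x y. set_integrable lborel {x..y} c"
    and "\<And>s. b s \<le> c s" "x \<le> y"
  shows "prim b y - prim b x \<le> prim c y - prim c x"
  using assms set_integral_mono[of lborel "{x..y}" b c] by (simp add: prim_diff)

text \<open>\<open>prim b\<close> is increasing, so the cut-off to [0, x] becomes the cut-off to
  [0, \<open>prim b x\<close>].\<close>

lemma (in speed) pull_back_moment:
  fixes f :: "real \<Rightarrow> complex"
  assumes lower: "\<forall>x. \<theta> \<le> b x" and f: "integrable lborel f" and x: "0 \<le> x"
  shows "set_integrable lborel {0..x} (\<lambda>t. of_real (b t) * f (prim b t))"
    and "(LBINT t:{0..x}. of_real (b t) * f (prim b t)) = (LBINT u:{0..prim b x}. f u)"
proof -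
  have [measurable]: "f \<in> borel_measurable borel" using f by (simp add: borel_measurable_integrable)
  define g where "g = (\<lambda>u. indicator {0..prim b x} u *\<^sub>R f u)"
  have g: "g \<in> borel_measurable borel" unfolding g_def by measurable
  have d: "direction = 1" using lower by (simp add: direction_def)
  have eq: "\<bar>b t\<bar> *\<^sub>R g (prim b t) = indicator {0..x} t *\<^sub>R (of_real (b t) * f (prim b t))" for t
    using le_iff[of 0 t] le_iff[of t x] abs_eq[of t] by (simp add: g_def indicator_def d scaleR_conv_of_real)
  have "integrable lborel g"
    unfolding g_def by (intro integrable_mult_indicator f) simp
  then show "set_integrable lborel {0..x} (\<lambda>t. of_real (b t) * f (prim b t))"
    using integral_prim(2)[OF g] by (simp add: eq set_integrable_def)
  show "(LBINT t:{0..x}. of_real (b t) * f (prim b t)) = (LBINT u:{0..prim b x}. f u)"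
    using integral_prim(1)[OF g, unfolded eq] unfolding set_lebesgue_integral_def g_def .
qed

text \<open>A negative speed runs through u from 0 down to \<open>prim b x\<close>. The reversed
  orientation gives the minus sign that the kernel compensates in its first block.\<close>

lemma (in speed) pull_back_moment_neg:
  fixes f :: "real \<Rightarrow> complex"
  assumes upper: "\<forall>x. b x \<le> - \<theta>" and f: "integrable lborel f" and x: "0 \<le> x"
  shows "set_integrable lborel {0..x} (\<lambda>t. of_real (b t) * f (prim b t))"
    and "(LBINT t:{0..x}. of_real (b t) * f (prim b t)) = - (LBINT u:{prim b x..0}. f u)"
proof -
  interpret m: speed "\<lambda>x. - b x" \<theta> by (rule speed_uminus[OF speed_axioms])
  have lower: "\<forall>x. \<theta> \<le> - b x" using upper by (simp add: le_minus_iff)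
  have f': "integrable lborel (\<lambda>u. f (- u))"
    using lborel_integrable_real_affine[OF f, of "-1" 0] by simp
  note m = m.pull_back_moment[OF lower f' x, unfolded prim_uminus minus_minus of_real_minus mult_minus_left]
  show "set_integrable lborel {0..x} (\<lambda>t. of_real (b t) * f (prim b t))"
    using m(1) by (simp add: set_integrable_def)
  have "(LBINT u. indicator {prim b x..0} u *\<^sub>R f u) = (LBINT u. indicator {0..- prim b x} u *\<^sub>R f (- u))"
    using lborel_integral_real_affine[of "-1" "\<lambda>u. indicator {prim b x..0} u *\<^sub>R f u" 0]
    by (simp add: indicator_def conj_commute le_minus_iff minus_le_iff)
  moreover have "- (LBINT t:{0..x}. of_real (b t) * f (prim b t)) = (LBINT u:{0..- prim b x}. f (- u))"
    using m(2) by (simp add: set_lebesgue_integral_def)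
  ultimately have "- (LBINT t:{0..x}. of_real (b t) * f (prim b t)) = (LBINT u:{prim b x..0}. f u)"
    by (simp only: set_lebesgue_integral_def)
  then show "(LBINT t:{0..x}. of_real (b t) * f (prim b t)) = - (LBINT u:{prim b x..0}. f u)"
    by (simp only: minus_equation_iff[of _ "LBINT u:{prim b x..0}. f u"])
qed

text \<open>Provides both the bound and the Borel measurability of a solution.\<close>

lemma solution_continuous:
  fixes y g :: "real \<Rightarrow> complex"
  assumes g: "set_integrable lebesgue {0..l} g"
    and y: "\<And>x. x \<in> {0..l} \<Longrightarrow> y x = y0 + (LINT t:{0..x}|lebesgue. g t)"
  shows "continuous_on {0..l} y"
proof -
  have "continuous_on {0..l} (\<lambda>x. y0 + integral {0..x} g)"
    by (intro continuous_intros indefinite_integral_continuous_1 set_lebesgue_integral_eq_integral(1) g)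
  then show ?thesis
  proof (rule continuous_on_eq)
    fix x assume x: "x \<in> {0..l}"
    then have "set_integrable lebesgue {0..x} g"
      by (intro set_integrable_subset[OF g]) auto
    then show "y0 + integral {0..x} g = y x"
      using y[OF x] set_lebesgue_integral_eq_integral(2) by metis
  qed
qed

text \<open>One null set serves all speeds: altered at the same points, they stay separated from
  each other.\<close>

lemma borel_speeds:
  fixes \<beta> :: "nat \<Rightarrow> real \<Rightarrow> real"
  assumes Linf: "\<And>k. k < r \<Longrightarrow> Linf_on l (\<beta> k)"
  obtains N bb where "N \<in> null_sets lborel"
    and "\<And>k x. bb k x = (if x \<in> {0..l} - N then \<beta> k x else \<beta> k 0)"
    and "\<And>k. k < r \<Longrightarrow> bb k \<in> borel_measurable borel"
    and "\<And>k x y. k < r \<Longrightarrow> set_integrable lborel {x..y} (bb k)"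
proof -
  have "\<exists>g C. g \<in> borel_measurable borel \<and> (AE x in lborel. x \<in> {0..l} \<longrightarrow> g x = \<beta> k x \<and> \<bar>\<beta> k x\<bar> \<le> C)"
    if k: "k < r" for k
  proof -
    have "\<beta> k \<in> borel_measurable (lebesgue_on {0..l})"
      using Linf[OF k] by (simp add: Linf_on_def)
    then have "(\<lambda>x. if x \<in> {0..l} then \<beta> k x else 0) \<in> borel_measurable lebesgue"
      using borel_measurable_if[of "{0..l}" "\<beta> k"] by simp
    then obtain g where g: "g \<in> borel_measurable borel" "AE x in lborel. (if x \<in> {0..l} then \<beta> k x else 0) = g x"
      by (rule lebesgue_borel_version_real)
    obtain C where "AE x in lebesgue_on {0..l}. \<bar>\<beta> k x\<bar> \<le> C"
      using Linf[OF k] by (auto simp: Linf_on_def)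
    then have "AE x in lebesgue. x \<in> {0..l} \<longrightarrow> \<bar>\<beta> k x\<bar> \<le> C"
      by (subst (asm) AE_restrict_space_iff) auto
    then have "AE x in lborel. x \<in> {0..l} \<longrightarrow> \<bar>\<beta> k x\<bar> \<le> C"
      by (simp only: AE_completion_iff)
    with g(2) have "AE x in lborel. x \<in> {0..l} \<longrightarrow> g x = \<beta> k x \<and> \<bar>\<beta> k x\<bar> \<le> C"
      by eventually_elim auto
    with g(1) show ?thesis by blast
  qed
  then have "\<forall>k. \<exists>gC. k < r \<longrightarrow> fst gC \<in> borel_measurable borel \<and>
      (AE x in lborel. x \<in> {0..l} \<longrightarrow> fst gC x = \<beta> k x \<and> \<bar>\<beta> k x\<bar> \<le> snd gC)"
    by (simp add: split_paired_Ex)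
  from choice[OF this] obtain gC where gC: "\<forall>k. k < r \<longrightarrow> fst (gC k) \<in> borel_measurable borel \<and>
      (AE x in lborel. x \<in> {0..l} \<longrightarrow> fst (gC k) x = \<beta> k x \<and> \<bar>\<beta> k x\<bar> \<le> snd (gC k))"
    by blast
  define g C where "g k = fst (gC k)" and "C k = snd (gC k)" for k
  have g: "g k \<in> borel_measurable borel"
    and ae: "AE x in lborel. x \<in> {0..l} \<longrightarrow> g k x = \<beta> k x \<and> \<bar>\<beta> k x\<bar> \<le> C k" if "k < r" for k
    using gC that unfolding g_def C_def by blast+
  have "AE x in lborel. \<forall>k\<in>{..<r}. x \<in> {0..l} \<longrightarrow> g k x = \<beta> k x \<and> \<bar>\<beta> k x\<bar> \<le> C k"
    by (rule AE_finite_allI) (simp_all add: ae[simplified])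
  then obtain N where
    off: "\<And>x. x \<in> space lborel - N \<Longrightarrow> \<forall>k\<in>{..<r}. x \<in> {0..l} \<longrightarrow> g k x = \<beta> k x \<and> \<bar>\<beta> k x\<bar> \<le> C k"
    and N: "N \<in> null_sets lborel"
    by (rule AE_E3) (rule that)
  \<comment> \<open>the value at 0 stands in off the good set, so every pointwise inequality between speeds survives\<close>
  define bb where "bb = (\<lambda>k x. if x \<in> {0..l} - N then \<beta> k x else \<beta> k 0)"
  have good: "g k x = \<beta> k x" "\<bar>\<beta> k x\<bar> \<le> C k" if "k < r" "x \<in> {0..l}" "x \<notin> N" for k x
    using off[of x] that by auto
  have [measurable]: "{0..l} - N \<in> sets borel"
    using N by auto
  have m: "bb k \<in> borel_measurable borel" if k: "k < r" for k
  proof -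
    have [measurable]: "g k \<in> borel_measurable borel" by (rule g[OF k])
    have "(\<lambda>x. if x \<in> {0..l} - N then g k x else \<beta> k 0) \<in> borel_measurable borel"
      by measurable
    also have "(\<lambda>x. if x \<in> {0..l} - N then g k x else \<beta> k 0) = bb k"
      using good(1)[OF k] by (auto simp: bb_def fun_eq_iff)
    finally show ?thesis .
  qed
  have "set_integrable lborel {x..y} (bb k)" if k: "k < r" for k x y
    unfolding set_integrable_def
  proof (rule Bochner_Integration.integrable_bound)
    have [measurable]: "bb k \<in> borel_measurable borel" by (rule m[OF k])
    show "integrable lborel (\<lambda>s. max (C k) \<bar>\<beta> k 0\<bar> * indicator {x..y} s)"
      by (intro integrable_mult_right integrable_real_indicator) (simp_all add: emeasure_lborel_Icc_eq)
    show "(\<lambda>s. indicator {x..y} s *\<^sub>R bb k s) \<in> borel_measurable lborel" by measurable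
    have "\<bar>bb k s\<bar> \<le> \<bar>max (C k) \<bar>\<beta> k 0\<bar>\<bar>" for s
    proof (cases "s \<in> {0..l} - N")
      case True
      then have "bb k s = \<beta> k s" unfolding bb_def by (rule if_P)
      then show ?thesis using good(2)[of k s] k True by auto
    next
      case False
      then have "bb k s = \<beta> k 0" unfolding bb_def by (rule if_not_P)
      then show ?thesis by linarith
    qed
    then show "AE s in lborel. norm (indicator {x..y} s *\<^sub>R bb k s) \<le> norm (max (C k) \<bar>\<beta> k 0\<bar> * indicator {x..y} s)"
      by (intro AE_I2) (simp add: indicator_def)
  qed
  with N m show ?thesis using that[of N bb] by (simp add: bb_def)
qed

theorem theorem3p7:
  fixes l \<theta> :: real and ns :: "nat list" and rm :: nat
    and \<beta> :: "nat \<Rightarrow> real \<Rightarrow> real"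
    and Q :: "nat \<Rightarrow> nat \<Rightarrow> real \<Rightarrow> complex"
    and A :: "nat \<Rightarrow> nat \<Rightarrow> complex"
  defines "r \<equiv> length ns"
    and "n \<equiv> sum_list ns"
    and "nmin \<equiv> Min (set ns)"
    and "\<rho> \<equiv> (\<lambda>j x. LINT t:{0..x}|lebesgue. \<beta> j t)"
  assumes l_pos: "l > 0"
    and r_pos: "ns \<noteq> []"
    and beta_Linf: "\<And>k. k < r \<Longrightarrow> Linf_on l (\<beta> k)"
    and beta_inv_Linf: "\<And>k. k < r \<Longrightarrow> Linf_on l (\<lambda>x. 1 / \<beta> k x)"
    and beta_sign: "\<And>k. k < r \<Longrightarrow>
          (\<forall>x\<in>{0..l}. \<beta> k x > 0) \<or> (\<forall>x\<in>{0..l}. \<beta> k x < 0)"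
    and theta_pos: "\<theta> > 0"
    and rm_le: "rm \<le> r"
    and beta_neg: "\<And>k x. k < rm \<Longrightarrow> x \<in> {0..l} \<Longrightarrow> \<beta> k x < - \<theta>"
    and beta_posv: "\<And>k x. rm \<le> k \<Longrightarrow> k < r \<Longrightarrow> x \<in> {0..l} \<Longrightarrow> \<theta> < \<beta> k x"
    and beta_gap: "\<And>k x. Suc k < r \<Longrightarrow> x \<in> {0..l} \<Longrightarrow> \<beta> k x + \<theta> < \<beta> (Suc k) x"
    and Q_L1: "\<And>i j. i < n \<Longrightarrow> j < n \<Longrightarrow> set_integrable lebesgue {0..l} (Q i j)"
    and Q_diag: "\<And>i j x. i < n \<Longrightarrow> j < n \<Longrightarrow> blk ns i = blk ns j \<Longrightarrow> x \<in> {0..l}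
          \<Longrightarrow> Q i j x = 0"
    and A_rank: "\<And>j. j < r \<Longrightarrow>
          vec_space.rank (ns ! j)
            (mat (ns ! j) nmin (\<lambda>(i, m). A (sum_list (take j ns) + i) m)) = nmin"
  shows "\<exists>K :: nat \<Rightarrow> nat \<Rightarrow> real \<times> real \<Rightarrow> complex.
     (\<forall>i<n. \<forall>j<n. X1_0 l (K i j) \<and> Xinf_0 l (K i j)) \<and>
     (\<forall>lam :: complex. \<forall>Y. is_solution l n nmin (\<lambda>i. \<beta> (blk ns i)) Q A lam Y \<longrightarrow>
        (\<forall>x\<in>{0..l}. \<forall>i<n. \<forall>m<nmin.
           set_integrable lebesgue {0..x}
             (\<lambda>t. \<Sum>j<n. K i j (x, t) * complex_of_real (\<beta> (blk ns j) t) *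
                   (exp (\<i> * lam * complex_of_real (\<rho> (blk ns j) t)) * A j m)) \<and>
           Y i m x = exp (\<i> * lam * complex_of_real (\<rho> (blk ns i) x)) * A i m +
             (LINT t:{0..x}|lebesgue. \<Sum>j<n. K i j (x, t) * complex_of_real (\<beta> (blk ns j) t) *
                   (exp (\<i> * lam * complex_of_real (\<rho> (blk ns j) t)) * A j m))))"
proof -
  have r0: "0 < r" using r_pos by (simp add: r_def)
  have blk_r: "blk ns i < r" if "i < n" for i
    using blk_bounds(1) that by (simp add: r_def n_def)
  have gap: "\<beta> k x + \<theta> < \<beta> k' x" if "k < k'" "k' < r" "x \<in> {0..l}" for k k' x
    using that
  proof (induction k')
    case (Suc k')
    show ?case
    proof (cases "k = k'")
      case False
      then have "\<beta> k x + \<theta> < \<beta> k' x" using Suc by simp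
      then show ?thesis using beta_gap[of k' x] Suc.prems theta_pos by simp
    qed (use Suc.prems beta_gap in simp)
  qed simp
  obtain N bb where N: "N \<in> null_sets lborel"
    and bb: "\<And>k x. bb k x = (if x \<in> {0..l} - N then \<beta> k x else \<beta> k 0)"
    and bb_m: "\<And>k. k < r \<Longrightarrow> bb k \<in> borel_measurable borel"
    and bb_loc: "\<And>k x y. k < r \<Longrightarrow> set_integrable lborel {x..y} (bb k)"
  proof (rule borel_speeds)
    fix k assume "k < r"
    then show "Linf_on l (\<beta> k)" by (rule beta_Linf)
  qed (rule that)
  have off_N: "AE x in lborel. x \<notin> N" by (rule AE_not_in[OF N])
  \<comment> \<open>At each x all modified speeds are values of the original ones at a single point
    of [0, l], so every pointwise inequality extends to the line.\<close>
  have pick: "\<exists>x0\<in>{0..l}. \<forall>k. bb k x = \<beta> k x0" for x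
  proof (cases "x \<in> {0..l} - N")
    case True
    then show ?thesis using bb by auto
  next
    case False
    have "\<forall>k. bb k x = \<beta> k 0" unfolding bb if_not_P[OF False] by simp
    then show ?thesis using l_pos by (intro bexI[of _ 0]) simp_all
  qed
  have bb_neg: "\<forall>x. bb k x \<le> - \<theta>" if "k < rm" for k
  proof
    fix x
    obtain x0 where "x0 \<in> {0..l}" "bb k x = \<beta> k x0" using pick[of x] by blast
    then show "bb k x \<le> - \<theta>" using beta_neg[OF that, of x0] by simp
  qed
  have bb_pos: "\<forall>x. \<theta> \<le> bb k x" if "rm \<le> k" "k < r" for k
  proof
    fix x
    obtain x0 where "x0 \<in> {0..l}" "bb k x = \<beta> k x0" using pick[of x] by blast
    then show "\<theta> \<le> bb k x" using beta_posv[OF that, of x0] by simp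
  qed
  have bb_gap: "\<forall>x. bb k x + \<theta> \<le> bb k' x" if "k < k'" "k' < r" for k k'
  proof
    fix x
    obtain x0 where "x0 \<in> {0..l}" "bb k x = \<beta> k x0" "bb k' x = \<beta> k' x0" using pick[of x] by blast
    then show "bb k x + \<theta> \<le> bb k' x" using gap[OF that, of x0] by simp
  qed
  have speed_bb: "speed (bb k) \<theta>" if k: "k < r" for k
  proof
    show "(\<forall>x. \<theta> \<le> bb k x) \<or> (\<forall>x. bb k x \<le> - \<theta>)"
      using bb_neg[of k] bb_pos[of k] k by (cases "k < rm") simp_all
  qed (use k bb_m bb_loc theta_pos in auto)
  have speed_diff: "speed (\<lambda>x. bb k' x - bb k x) \<theta>" if k: "k < r" "k' < r" "k \<noteq> k'" for k k'
  proof
    show "(\<lambda>x. bb k' x - bb k x) \<in> borel_measurable borel"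
      using k bb_m by (intro borel_measurable_diff) simp_all
    show "set_integrable lborel {x..y} (\<lambda>x. bb k' x - bb k x)" for x y
      using k bb_loc by (intro set_integral_diff(1)) simp_all
    show "(\<forall>x. \<theta> \<le> bb k' x - bb k x) \<or> (\<forall>x. bb k' x - bb k x \<le> - \<theta>)"
    proof (cases "k < k'")
      case True
      then have "\<theta> \<le> bb k' x - bb k x" for x
        using bb_gap[of k k'] k by (simp add: le_diff_eq add.commute)
      then show ?thesis by blast
    next
      case False
      then have "bb k' x - bb k x \<le> - \<theta>" for x
        using bb_gap[of k' k] k by (simp add: diff_le_eq le_diff_eq add.commute)
      then show ?thesis by blast
    qed
  qed (rule theta_pos)
  \<comment> \<open>Within a block the representative is 0 everywhere, as \<open>transport\<close>
    asks for an identically vanishing coupling or for separated speeds.\<close>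
  have "\<exists>q. integrable lborel q \<and> (AE x in lborel. x \<in> {0..l} \<longrightarrow> q x = Q i k x)
      \<and> (blk ns i = blk ns k \<longrightarrow> (\<forall>x. q x = 0))" if ik: "i < n" "k < n" for i k
  proof (cases "blk ns i = blk ns k")
    case True
    then show ?thesis using Q_diag[OF ik True] by (intro exI[of _ "\<lambda>_. 0"]) simp
  next
    case False
    obtain g where "integrable lborel g" "AE x in lborel. x \<in> {0..l} \<longrightarrow> g x = Q i k x"
      by (rule lebesgue_borel_version_complex[OF Q_L1[OF ik]]) simp
    with False show ?thesis by blast
  qed
  then obtain q where q_int: "\<And>i k. i < n \<Longrightarrow> k < n \<Longrightarrow> integrable lborel (q i k)"
    and q_eq: "\<And>i k. i < n \<Longrightarrow> k < n \<Longrightarrow> AE x in lborel. x \<in> {0..l} \<longrightarrow> q i k x = Q i k x"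
    and q_diag: "\<And>i k x. i < n \<Longrightarrow> k < n \<Longrightarrow> blk ns i = blk ns k \<Longrightarrow> q i k x = 0"
    by metis
  have rho: "\<rho> k x = prim (bb k) x" if k: "k < r" and x: "x \<in> {0..l}" for k x
  proof -
    have ae: "AE t in lborel. t \<in> {0..x} \<longrightarrow> \<beta> k t = bb k t"
      using off_N by eventually_elim (use x in \<open>auto simp: bb\<close>)
    have "\<rho> k x = (LBINT t:{0..x}. bb k t)"
      unfolding \<rho>_def by (rule lebesgue_set_integral_AE(2)[OF bb_m[OF k] _ ae]) simp
    also have "\<dots> = prim (bb k) x"
      using prim_diff[OF bb_loc[OF k], of 0 x] x by simp
    finally show ?thesis .
  qed
  \<comment> \<open>The envelopes of 0 and all speeds. If all speeds have one sign, the envelope on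
    the other side is 0 and the cone ends at the line u = 0.\<close>
  define bu where "bu = (if rm < r then bb (r - 1) else (\<lambda>_. 0))"
  define bl where "bl = (if 0 < rm then bb 0 else (\<lambda>_. 0))"
  have zero_loc: "set_integrable lborel {x..y} (\<lambda>_. 0 :: real)" for x y
    by (simp add: set_integrable_def)
  have bu_loc: "set_integrable lborel {x..y} bu" for x y
  proof (cases "rm < r")
    case True
    then have "bu = bb (r - 1)" unfolding bu_def by (rule if_P)
    then show ?thesis using bb_loc[of "r - 1"] r0 by simp
  next
    case False
    then have "bu = (\<lambda>_. 0)" unfolding bu_def by (rule if_not_P)
    then show ?thesis by (simp only: zero_loc)
  qed
  have bl_loc: "set_integrable lborel {x..y} bl" for x y
  proof (cases "0 < rm")
    case True
    then have "bl = bb 0" unfolding bl_def by (rule if_P)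
    then show ?thesis using bb_loc[OF r0] by simp
  next
    case False
    then have "bl = (\<lambda>_. 0)" unfolding bl_def by (rule if_not_P)
    then show ?thesis by (simp only: zero_loc)
  qed
  have le_last: "bb k s \<le> bb (r - 1) s" and ge_first: "bb 0 s \<le> bb k s" if "k < r" for k s
  proof -
    show "bb k s \<le> bb (r - 1) s"
    proof (cases "k = r - 1")
      case False
      then have "bb k s + \<theta> \<le> bb (r - 1) s" using bb_gap[of k "r - 1"] that by simp
      then show ?thesis using theta_pos by linarith
    qed simp
    show "bb 0 s \<le> bb k s"
    proof (cases "k = 0")
      case False
      then have "bb 0 s + \<theta> \<le> bb k s" using bb_gap[of 0 k] that by simp
      then show ?thesis using theta_pos by linarith
    qed simp
  qed
  have le_bu: "bb k s \<le> bu s" if k: "k < r" for k s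
  proof (cases "rm < r")
    case False
    then have "bb k s \<le> - \<theta>" using bb_neg[of k] rm_le k by simp
    then show ?thesis using theta_pos False by (simp add: bu_def)
  qed (use le_last[OF k] in \<open>simp add: bu_def\<close>)
  have bl_le: "bl s \<le> bb k s" if k: "k < r" for k s
  proof (cases "0 < rm")
    case False
    then have "\<theta> \<le> bb k s" using bb_pos[of k] k by simp
    then show ?thesis using theta_pos False by (simp add: bl_def)
  qed (use ge_first[OF k] in \<open>simp add: bl_def\<close>)
  have bu_nonneg: "0 \<le> bu s" for s
  proof (cases "rm < r")
    case True
    then have "\<theta> \<le> bb (r - 1) s" using bb_pos[of "r - 1"] by simp
    then show ?thesis using theta_pos True by (simp add: bu_def)
  qed (simp add: bu_def)
  have bl_nonpos: "bl s \<le> 0" for s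
  proof (cases "0 < rm")
    case True
    then have "bb 0 s \<le> - \<theta>" using bb_neg[of 0] by simp
    then show ?thesis using theta_pos True by (simp add: bl_def)
  qed (simp add: bl_def)
  have prim_0_fun: "prim (\<lambda>_. 0) x = 0" for x by (simp add: prim_def)
  \<comment> \<open>One instance for each column m of A; only the initial vector changes.\<close>
  interpret T: transport n l \<theta> "\<lambda>i. bb (blk ns i)" q "prim bl" "prim bu" "\<lambda>i. A i m" for m
  proof (rule transport.intro)
    show "(\<forall>x. q i k x = 0) \<or> speed (\<lambda>x. bb (blk ns k) x - bb (blk ns i) x) \<theta>" if "i < n" "k < n" for i k
      using q_diag[OF that] speed_diff[of "blk ns i" "blk ns k"] blk_r that by (cases "blk ns i = blk ns k") auto
    show "prim bu x \<le> prim bu y" if "x \<le> y" for x y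
      using prim_increment_mono[OF zero_loc bu_loc bu_nonneg that] by (simp add: prim_0_fun)
    show "prim bl y \<le> prim bl x" if "x \<le> y" for x y
      using prim_increment_mono[OF bl_loc zero_loc bl_nonpos that] by (simp add: prim_0_fun)
    show "prim (bb (blk ns i)) y - prim (bb (blk ns i)) x \<le> prim bu y - prim bu x" if "i < n" "x \<le> y" for i x y
      using prim_increment_mono[OF bb_loc bu_loc le_bu] blk_r that by simp
    show "prim bl y - prim bl x \<le> prim (bb (blk ns i)) y - prim (bb (blk ns i)) x" if "i < n" "x \<le> y" for i x y
      using prim_increment_mono[OF bl_loc bb_loc bl_le] blk_r that by simp
  qed (use l_pos theta_pos speed_bb blk_r q_int in simp_all)
  \<comment> \<open>A left inverse of the block A_k, written as a sum over all indices with the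
    other blocks masked out.\<close>
  have "\<exists>L. \<forall>m<nmin. \<forall>m'<nmin. (\<Sum>j<n. if blk ns j = k then L m j * A j m' else 0) = (if m = m' then 1 else 0)"
    if k: "k < r" for k
  proof -
    obtain L where L: "\<forall>m<nmin. \<forall>m'<nmin.
        (\<Sum>i<ns ! k. L m i * A (sum_list (take k ns) + i) m') = (if m = m' then 1 else 0)"
      using full_rank_left_inverse[OF A_rank[OF k]] by blast
    have "(\<Sum>j<n. if blk ns j = k then L m (j - sum_list (take k ns)) * A j m' else 0)
        = (\<Sum>i<ns ! k. L m i * A (sum_list (take k ns) + i) m')" for m m'
      using sum_blk[of k ns "\<lambda>j. L m (j - sum_list (take k ns)) * A j m'"] k by (simp add: r_def n_def)
    then show ?thesis
      using L by (intro exI[of _ "\<lambda>m j. L m (j - sum_list (take k ns))"]) simp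
  qed
  then obtain L where L: "\<And>k m m'. k < r \<Longrightarrow> m < nmin \<Longrightarrow> m' < nmin \<Longrightarrow>
      (\<Sum>j<n. if blk ns j = k then L k m j * A j m' else 0) = (if m = m' then 1 else 0)"
    by metis
  \<comment> \<open>The n by nmin matrix of densities times the left inverse of block k;
    multiplication by A_k gives the densities back.\<close>
  define H where "H = (\<lambda>k i j p. \<Sum>m<nmin. L k m j * T.density m i p)"
  have H: "approximable l (H k i j)" if "i < n" for k i j
    unfolding H_def using T.approximable_density[OF that] by (intro approximable_sum approximable_cmult)
  \<comment> \<open>B(t) dt becomes du on the last block and, the orientation being reversed, yields
    the opposite sign on the first; hence the factor -1.\<close>
  define K where "K = (\<lambda>i j. if rm < r \<and> blk ns j = r - 1 then (\<lambda>p. H (r - 1) i j (fst p, prim (bb (r - 1)) (snd p)))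
      else if 0 < rm \<and> blk ns j = 0 then (\<lambda>p. - 1 * H 0 i j (fst p, prim (bb 0) (snd p))) else (\<lambda>_. 0))"
  have K_X: "X1_0 l (K i j) \<and> Xinf_0 l (K i j)" if i: "i < n" for i j
  proof -
    consider (last) "rm < r \<and> blk ns j = r - 1"
      | (first) "\<not> (rm < r \<and> blk ns j = r - 1)" "0 < rm \<and> blk ns j = 0"
      | (zero) "\<not> (rm < r \<and> blk ns j = r - 1)" "\<not> (0 < rm \<and> blk ns j = 0)" by blast
    then show ?thesis
    proof cases
      case last
      then have "K i j = (\<lambda>p. H (r - 1) i j (fst p, prim (bb (r - 1)) (snd p)))" unfolding K_def by (rule if_P)
      then show ?thesis using approximable_X[OF H[OF i] speed_bb[of "r - 1"]] r0 by simp
    next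
      case first
      then have "K i j = (\<lambda>p. - 1 * H 0 i j (fst p, prim (bb 0) (snd p)))"
        unfolding K_def if_not_P[OF first(1)] by (intro if_P)
      then show ?thesis
        using approximable_X[OF approximable_cmult[OF H[OF i], of "- 1"] speed_bb[OF r0]] by simp
    next
      case zero
      then have "K i j = (\<lambda>_. 0)" unfolding K_def if_not_P[OF zero(1)] by (intro if_not_P)
      then show ?thesis using X_0[OF l_pos] by simp
    qed
  qed
  \<comment> \<open>Off N the original and modified speeds agree, and the left inverse reduces the
    sum over the block to column m.\<close>
  have block_sum: "(\<Sum>j<n. if blk ns j = k then H k i j (x, prim (bb k) t) * of_real (\<beta> k t) *
        (wave lam (\<rho> k t) * A j m) else 0)
      = of_real (bb k t) * (wave lam (prim (bb k) t) * T.density m i (x, prim (bb k) t))"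
    if k: "k < r" and t: "t \<in> {0..l}" "t \<notin> N" and m: "m < nmin" for k i x t m lam
  proof -
    define c where "c = complex_of_real (bb k t) * wave lam (prim (bb k) t)"
    define D where "D = (\<lambda>m. T.density m i (x, prim (bb k) t))"
    have b: "\<beta> k t = bb k t" "\<rho> k t = prim (bb k) t"
      using t rho[OF k] bb[of k t] by simp_all
    have "(\<Sum>j<n. if blk ns j = k then H k i j (x, prim (bb k) t) * of_real (\<beta> k t) *
        (wave lam (\<rho> k t) * A j m) else 0)
        = (\<Sum>j<n. \<Sum>m'<nmin. c * D m' * (if blk ns j = k then L k m' j * A j m else 0))"
      unfolding b by (intro sum.cong refl) (simp add: H_def c_def D_def sum_distrib_left sum_distrib_right ac_simps)
    also have "\<dots> = (\<Sum>m'<nmin. c * D m' * (\<Sum>j<n. if blk ns j = k then L k m' j * A j m else 0))"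
      by (subst sum.swap) (simp add: sum_distrib_left)
    also have "\<dots> = (\<Sum>m'<nmin. if m' = m then c * D m' else 0)"
      using L[OF k _ m] by (intro sum.cong refl) simp
    also have "\<dots> = c * D m" using m by simp
    finally show ?thesis by (simp add: c_def D_def mult.assoc)
  qed
  let ?S = "\<lambda>lam i m x t. \<Sum>j<n. K i j (x, t) * complex_of_real (\<beta> (blk ns j) t) *
    (wave lam (\<rho> (blk ns j) t) * A j m)"
  have K_sum: "?S lam i m x t
      = of_real (bu t) * (wave lam (prim bu t) * T.density m i (x, prim bu t))
        - of_real (bl t) * (wave lam (prim bl t) * T.density m i (x, prim bl t))"
    if t: "t \<in> {0..l}" "t \<notin> N" and m: "m < nmin" for i x t m lam
  proof -
    define S where "S = (\<lambda>k j. if blk ns j = k then H k i j (x, prim (bb k) t) * of_real (\<beta> k t) *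
        (wave lam (\<rho> k t) * A j m) else 0)"
    have "K i j (x, t) * complex_of_real (\<beta> (blk ns j) t) *
        (wave lam (\<rho> (blk ns j) t) * A j m)
        = (if rm < r then S (r - 1) j else 0) - (if 0 < rm then S 0 j else 0)" for j
    proof (cases "rm < r \<and> blk ns j = r - 1")
      case True
      \<comment> \<open>With 0 < rm < r there are at least two blocks, so the first and the last one
        differ.\<close>
      then have "0 < rm \<longrightarrow> blk ns j \<noteq> 0" by auto
      then show ?thesis using True by (auto simp: K_def S_def)
    next
      case False
      then have "(if rm < r then S (r - 1) j else 0) = 0" by (auto simp: S_def)
      then show ?thesis using False by (auto simp: K_def S_def)
    qed
    then have "?S lam i m x t
        = (if rm < r then \<Sum>j<n. S (r - 1) j else 0) - (if 0 < rm then \<Sum>j<n. S 0 j else 0)"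
      by (simp add: sum_subtractf)
    also have "(if rm < r then \<Sum>j<n. S (r - 1) j else 0)
        = of_real (bu t) * (wave lam (prim bu t) * T.density m i (x, prim bu t))"
    proof (cases "rm < r")
      case True
      have "(\<Sum>j<n. S (r - 1) j) = of_real (bb (r - 1) t) *
          (wave lam (prim (bb (r - 1)) t) * T.density m i (x, prim (bb (r - 1)) t))"
        unfolding S_def by (rule block_sum) (use r0 t m in simp_all)
      then show ?thesis by (simp only: bu_def True if_True)
    qed (simp add: bu_def)
    also have "(if 0 < rm then \<Sum>j<n. S 0 j else 0)
        = of_real (bl t) * (wave lam (prim bl t) * T.density m i (x, prim bl t))"
    proof (cases "0 < rm")
      case True
      have "(\<Sum>j<n. S 0 j) = of_real (bb 0 t) *
          (wave lam (prim (bb 0) t) * T.density m i (x, prim (bb 0) t))"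
        unfolding S_def by (rule block_sum) (use r0 t m in simp_all)
      then show ?thesis by (simp only: bl_def True if_True)
    qed (simp add: bl_def)
    finally show ?thesis .
  qed
  have bu_pull: "set_integrable lborel {0..x} (\<lambda>t. of_real (bu t) * f (prim bu t)) \<and>
      (LBINT t:{0..x}. of_real (bu t) * f (prim bu t)) = (LBINT u:{0..prim bu x}. f u)"
    if f: "integrable lborel f" and x: "0 \<le> x" for f :: "real \<Rightarrow> complex" and x
  proof (cases "rm < r")
    case True
    then interpret u: speed bu \<theta> using speed_bb[of "r - 1"] by (simp add: bu_def)
    have "\<forall>x. \<theta> \<le> bu x" using True bb_pos[of "r - 1"] by (simp add: bu_def)
    from u.pull_back_moment[OF this f x] show ?thesis by blast
  next
    case False
    then have "bu = (\<lambda>_. 0)" unfolding bu_def by (rule if_not_P)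
    moreover have "(LBINT u:{0..0}. f u) = 0"
      unfolding set_lebesgue_integral_def
      by (rule integral_eq_zero_AE) (use AE_lborel_singleton[of 0] in eventually_elim, simp)
    ultimately show ?thesis by (simp add: prim_0_fun set_integrable_def set_lebesgue_integral_def)
  qed
  have bl_pull: "set_integrable lborel {0..x} (\<lambda>t. of_real (bl t) * f (prim bl t)) \<and>
      (LBINT t:{0..x}. of_real (bl t) * f (prim bl t)) = - (LBINT u:{prim bl x..0}. f u)"
    if f: "integrable lborel f" and x: "0 \<le> x" for f :: "real \<Rightarrow> complex" and x
  proof (cases "0 < rm")
    case True
    then interpret u: speed bl \<theta> using speed_bb[OF r0] by (simp add: bl_def)
    have "\<forall>x. bl x \<le> - \<theta>" using True bb_neg[of 0] by (simp add: bl_def)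
    from u.pull_back_moment_neg[OF this f x] show ?thesis by blast
  next
    case False
    then have "bl = (\<lambda>_. 0)" unfolding bl_def by (rule if_not_P)
    moreover have "(LBINT u:{0..0}. f u) = 0"
      unfolding set_lebesgue_integral_def
      by (rule integral_eq_zero_AE) (use AE_lborel_singleton[of 0] in eventually_elim, simp)
    ultimately show ?thesis by (simp add: prim_0_fun set_integrable_def set_lebesgue_integral_def)
  qed
  have [measurable]: "bu \<in> borel_measurable borel" "bl \<in> borel_measurable borel"
    using bb_m[of "r - 1"] bb_m[OF r0] r0 by (simp_all add: bu_def bl_def)
  have [measurable]: "prim bu \<in> borel_measurable borel" "prim bl \<in> borel_measurable borel"
    by (intro borel_measurable_continuous_onI continuous_prim bu_loc bl_loc)+
  \<comment> \<open>The two substitutions together cover u from \<open>prim bl x\<close> to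
    \<open>prim bu x\<close>, and the density at time x is supported there.\<close>
  have transform: "set_integrable lebesgue {0..x} (?S lam i m x) \<and>
      (LINT t:{0..x}|lebesgue. ?S lam i m x t)
      = (LBINT u. wave lam u * T.density m i (x, u))"
    if x: "x \<in> {0..l}" and i: "i < n" and m: "m < nmin" for x i m lam
  proof -
    define f where "f = (\<lambda>u. wave lam u * T.density m i (x, u))"
    have f: "integrable lborel f"
      unfolding f_def using x by (intro T.density_moment(1)[OF i]) simp_all
    have [measurable]: "f \<in> borel_measurable borel" using f by (simp add: borel_measurable_integrable)
    define h where "h = (\<lambda>t. complex_of_real (bu t) * f (prim bu t) - of_real (bl t) * f (prim bl t))"
    have hm: "h \<in> borel_measurable borel" unfolding h_def by measurable
    have ae: "AE t in lborel. t \<in> {0..x} \<longrightarrow>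
        ?S lam i m x t = h t"
      using off_N
    proof eventually_elim
      case (elim t)
      show ?case
      proof
        assume "t \<in> {0..x}"
        then have "t \<in> {0..l}" using x by simp
        from K_sum[OF this elim m, of i x lam]
        show "?S lam i m x t = h t"
          by (simp only: h_def f_def)
      qed
    qed
    have u: "set_integrable lborel {0..x} (\<lambda>t. of_real (bu t) * f (prim bu t))"
      "(LBINT t:{0..x}. of_real (bu t) * f (prim bu t)) = (LBINT u:{0..prim bu x}. f u)"
      using bu_pull[OF f, of x] x by simp_all
    have v: "set_integrable lborel {0..x} (\<lambda>t. of_real (bl t) * f (prim bl t))"
      "(LBINT t:{0..x}. of_real (bl t) * f (prim bl t)) = - (LBINT u:{prim bl x..0}. f u)"
      using bl_pull[OF f, of x] x by simp_all
    have hi: "set_integrable lborel {0..x} h"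
      unfolding h_def by (rule set_integral_diff(1)[OF u(1) v(1)])
    have "(LBINT t:{0..x}. h t) = (LBINT u:{0..prim bu x}. f u) + (LBINT u:{prim bl x..0}. f u)"
      unfolding h_def by (subst set_integral_diff(2)[OF u(1) v(1)]) (simp add: u(2) v(2))
    also have "\<dots> = (LBINT u. indicator {0..prim bu x} u *\<^sub>R f u + indicator {prim bl x..0} u *\<^sub>R f u)"
      unfolding set_lebesgue_integral_def
      by (intro Bochner_Integration.integral_add[symmetric] integrable_mult_indicator f) simp_all
    \<comment> \<open>The two ranges overlap in u = 0 only, and off their union the density
      vanishes.\<close>
    also have "\<dots> = (LBINT u. f u)"
    proof (rule integral_cong_AE)
      show "AE u in lborel. indicator {0..prim bu x} u *\<^sub>R f u + indicator {prim bl x..0} u *\<^sub>R f u = f u"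
        using AE_lborel_singleton[of 0]
      proof eventually_elim
        case (elim u)
        show ?case
        proof (cases "f u = 0")
          case False
          then have "T.density m i (x, u) \<noteq> 0" by (auto simp: f_def)
          then have "prim bl x \<le> u \<and> u \<le> prim bu x"
            using T.density_support[OF i, of x m u] x by simp
          then show ?thesis using elim by (cases "0 \<le> u") (auto simp: indicator_def)
        qed simp
      qed
    qed simp_all
    finally have "(LBINT t:{0..x}. h t) = (LBINT u. f u)" .
    then show ?thesis
      using lebesgue_set_integral_AE[OF hm _ ae] hi by (simp add: f_def)
  qed
  have solution: "Y i m x = wave lam (\<rho> (blk ns i) x) * A i m
      + (LBINT u. wave lam u * T.density m i (x, u))"
    if Y: "is_solution l n nmin (\<lambda>i. \<beta> (blk ns i)) Q A lam Y"
      and x: "x \<in> {0..l}" and i: "i < n" and m: "m < nmin" for lam Y x i m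
  proof -
    \<comment> \<open>A solution is continuous on [0, l], so its extension by 0 is a bounded Borel
      function on the line.\<close>
    define y where "y = (\<lambda>i t. if t \<in> {0..l} then Y i m t else 0)"
    have Yi: "set_integrable lebesgue {0..l} (\<lambda>t. \<i> * lam * complex_of_real (\<beta> (blk ns i) t) * Y i m t - (\<Sum>k<n. Q i k t * Y k m t))"
      and Ye: "\<And>x. x \<in> {0..l} \<Longrightarrow> Y i m x = A i m + (LINT t:{0..x}|lebesgue.
          \<i> * lam * complex_of_real (\<beta> (blk ns i) t) * Y i m t - (\<Sum>k<n. Q i k t * Y k m t))" if "i < n" for i
      using Y that m unfolding is_solution_def by blast+
    have Yc: "continuous_on {0..l} (Y i m)" if "i < n" for i
      by (rule solution_continuous[OF Yi[OF that] Ye[OF that]])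
    have ym: "y i \<in> borel_measurable borel" if "i < n" for i
      unfolding y_def by (rule borel_measurable_continuous_on_if) (use Yc[OF that] in simp_all)
    have "\<exists>M. \<forall>t\<in>{0..l}. norm (y i t) \<le> M" if "i < n" for i
    proof -
      have "bounded (Y i m ` {0..l})"
        by (intro compact_imp_bounded compact_continuous_image Yc that) simp
      then show ?thesis by (auto simp: bounded_iff y_def)
    qed
    then obtain Mi where Mi: "\<And>i t. i < n \<Longrightarrow> t \<in> {0..l} \<Longrightarrow> norm (y i t) \<le> Mi i" by metis
    define M where "M = (\<Sum>i<n. \<bar>Mi i\<bar>)"
    have M: "norm (y i t) \<le> M" if "i < n" "0 \<le> t" "t \<le> l" for i t
    proof -
      have "norm (y i t) \<le> \<bar>Mi i\<bar>" using Mi[of i t] that by simp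
      also have "\<dots> \<le> M" unfolding M_def using that by (intro member_le_sum) simp_all
      finally show ?thesis .
    qed
    have qy_int: "set_integrable lborel {0..l} (\<lambda>s. q i k s * y k s)" if ik: "i < n" "k < n" for i k
    proof (rule set_integrable_mult_bounded[OF _ ym[OF ik(2)]])
      show "set_integrable lborel {0..l} (q i k)"
        unfolding set_integrable_def using q_int[OF ik] by (intro integrable_mult_indicator) simp_all
      show "norm (y k s) \<le> M" if "s \<in> {0..l}" for s using M[OF ik(2)] that by simp
    qed
    \<comment> \<open>Each component solves a scalar equation with source w, the i-th component of Q
      Y; variation of constants removes the term with lambda.\<close>
    have duhamel: "y i t = wave lam (prim (bb (blk ns i)) t) * A i m
        - (\<Sum>k<n. T.duhamel lam i k (y k) t)" if i: "i < n" and t: "0 \<le> t" "t \<le> l" for i t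
    proof -
      interpret s: speed "bb (blk ns i)" \<theta> by (rule speed_bb[OF blk_r[OF i]])
      define w where "w = (\<lambda>s. \<Sum>k<n. q i k s * y k s)"
      have w: "set_integrable lborel {0..l} w"
        using qy_int[OF i] unfolding w_def set_integrable_def scaleR_sum_right
        by (intro Bochner_Integration.integrable_sum) simp
      have wm: "w \<in> borel_measurable borel"
        unfolding w_def using i q_int ym
        by (intro borel_measurable_sum borel_measurable_times) (auto simp: borel_measurable_integrable)
      have eq: "y i z = A i m + (LBINT s:{0..z}. \<i> * lam * of_real (bb (blk ns i) s) * y i s - w s)"
        if z: "0 \<le> z" "z \<le> l" for z
      proof -
        have "AE s in lborel. \<forall>k\<in>{..<n}. s \<in> {0..l} \<longrightarrow> q i k s = Q i k s"
          by (rule AE_finite_allI) (use q_eq[OF i] in simp_all)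
        with off_N have ae: "AE s in lborel. s \<in> {0..z} \<longrightarrow>
            \<i> * lam * complex_of_real (\<beta> (blk ns i) s) * Y i m s - (\<Sum>k<n. Q i k s * Y k m s)
            = \<i> * lam * of_real (bb (blk ns i) s) * y i s - w s"
        proof eventually_elim
          case (elim s)
          show ?case
          proof
            assume "s \<in> {0..z}"
            then have s: "s \<in> {0..l}" using z by simp
            have "w s = (\<Sum>k<n. Q i k s * Y k m s)"
              unfolding w_def using elim(2) s by (intro sum.cong refl) (simp add: y_def)
            moreover have "bb (blk ns i) s = \<beta> (blk ns i) s" using elim(1) s bb by simp
            moreover have "y i s = Y i m s" using s by (simp add: y_def)
            ultimately show "\<i> * lam * complex_of_real (\<beta> (blk ns i) s) * Y i m s - (\<Sum>k<n. Q i k s * Y k m s)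
              = \<i> * lam * of_real (bb (blk ns i) s) * y i s - w s" by (simp only:)
          qed
        qed
        have hm: "(\<lambda>s. \<i> * lam * complex_of_real (bb (blk ns i) s) * y i s - w s) \<in> borel_measurable borel"
          using wm ym[OF i] s.meas by measurable
        have "y i z = Y i m z" using z by (simp add: y_def)
        also have "\<dots> = A i m + (LINT s:{0..z}|lebesgue. \<i> * lam * complex_of_real (\<beta> (blk ns i) s) * Y i m s - (\<Sum>k<n. Q i k s * Y k m s))"
          using z by (intro Ye[OF i]) simp
        also have "(LINT s:{0..z}|lebesgue. \<i> * lam * complex_of_real (\<beta> (blk ns i) s) * Y i m s - (\<Sum>k<n. Q i k s * Y k m s))
            = (LBINT s:{0..z}. \<i> * lam * of_real (bb (blk ns i) s) * y i s - w s)"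
          by (rule lebesgue_set_integral_AE(2)[OF hm _ ae]) simp
        finally show ?thesis .
      qed
      have "y i t = wave lam (prim (bb (blk ns i)) t) * A i m
          - (LBINT s:{0..t}. wave lam (prim (bb (blk ns i)) t - prim (bb (blk ns i)) s) * w s)"
        by (rule s.variation_of_constants[OF ym[OF i] M[OF i] w eq t])
      also have "(LBINT s:{0..t}. wave lam (prim (bb (blk ns i)) t - prim (bb (blk ns i)) s) * w s)
          = (LBINT s:{0..t}. \<Sum>k<n. q i k s * (wave lam (prim (bb (blk ns i)) t - prim (bb (blk ns i)) s) * y k s))"
        unfolding w_def sum_distrib_left by (simp only: mult.left_commute)
      also have "\<dots> = (\<Sum>k<n. T.duhamel lam i k (y k) t)"
        unfolding T.duhamel_def set_lebesgue_integral_def scaleR_sum_right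
      proof (rule Bochner_Integration.integral_sum)
        fix k assume "k \<in> {..<n}"
        then have k: "k < n" by simp
        have "set_integrable lborel {0..t} (\<lambda>s. q i k s * (wave lam (prim (bb (blk ns i)) t - prim (bb (blk ns i)) s) * y k s))"
          by (rule T.duhamel_integrable[where M = M, OF i k t(2) ym[OF k]]) (use M[OF k] t in simp)
        then show "integrable lborel (\<lambda>s. indicator {0..t} s *\<^sub>R (q i k s * (wave lam (prim (bb (blk ns i)) t - prim (bb (blk ns i)) s) * y k s)))"
          by (simp only: set_integrable_def)
      qed
      finally show ?thesis .
    qed
    have "y i x = wave lam (prim (bb (blk ns i)) x) * A i m
        + (LBINT u. wave lam u * T.density m i (x, u))"
      by (rule T.duhamel_unique[where M = M, OF ym M duhamel i]) (use x in simp_all)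
    then show ?thesis
      using x rho[OF blk_r[OF i] x] by (simp add: y_def)
  qed
  show ?thesis
  proof (intro exI[of _ K] conjI allI impI ballI)
    fix i j assume "i < n"
    then show "X1_0 l (K i j)" "Xinf_0 l (K i j)" using K_X by blast+
  next
    fix lam Y x i m
    assume Y: "is_solution l n nmin (\<lambda>i. \<beta> (blk ns i)) Q A lam Y" and x: "x \<in> {0..l}" and im: "i < n" "m < nmin"
    note tr = transform[OF x im, of lam]
    show "set_integrable lebesgue {0..x} (?S lam i m x)"
      using tr by blast
    show "Y i m x = wave lam (\<rho> (blk ns i) x) * A i m +
        (LINT t:{0..x}|lebesgue. ?S lam i m x t)"
      unfolding conjunct2[OF tr] by (rule solution[OF Y x im])
  qed
qed

end
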